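(* For every convergent sequence of ordered graphs $\{G_n\}_{n\in\mathbb{N}}$, there exists an orderon $W$ such that $t(F,G_n)\to t(F,W)$ as $n\to\infty$ for every simple ordered graph $F$.
   Context: An ordered graph on $n$ vertices is a symmetric function $G:[n]^2\to\{0,1\}$, where $[n]=\{1,\dots,n\}$ carries its natural order; it is simple if $G(x,x)=0$ for all $x$. There are no nontrivial isomorphisms between ordered graphs. For a simple ordered graph $F$ on $k$ vertices and an ordered graph $G$ on $n$ vertices, $t(F,G)$ is the probability that, if $k$ vertices of $G$ are picked uniformly and independently (repetitions allowed) and sorted as $x_1\le\cdots\le x_k$, one has $F(i,j)=G(x_i,x_j)$ for all $1\le i<j\le k$. A sequence $\{G_n\}$ of ordered graphs is convergent if $|V(G_n)|\to\infty$ and $t(F,G_n)$ converges for every simple ordered graph $F$. An orderon is a (Lebesgue) measurable function $W:([0,1]^2)^2\to[0,1]$ with $W(u,v)=W(v,u)$ for all $u,v\in[0,1]^2$. For a simple ordered graph $F=([k],E)$ and an orderon $W$, with $\pi_1(y,b)=y$, $$t(F,W)=k!\int_{v\in([0,1]^2)^k,\ \pi_1(v_1)\le\cdots\le\pi_1(v_k)}\ \prod_{i<j,\ ij\in E}W(v_i,v_j)\prod_{i<j,\ ij\notin E}(1-W(v_i,v_j))\,dv .$$ *)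

theory Defs
  imports "HOL-Probability.Probability"
begin

(* The vertex set is {1..nverts G} with the order of nat; values of adj outside it are
   irrelevant. *)
record ordered_graph =
  nverts :: nat
  adj :: "nat \<Rightarrow> nat \<Rightarrow> bool"

definition is_ordered_graph :: "ordered_graph \<Rightarrow> bool" where
  "is_ordered_graph G \<longleftrightarrow>
     (\<forall>x\<in>{1..nverts G}. \<forall>y\<in>{1..nverts G}. adj G x y = adj G y x)"

definition simple_ordered_graph :: "ordered_graph \<Rightarrow> bool" where
  "simple_ordered_graph G \<longleftrightarrow>
     is_ordered_graph G \<and> (\<forall>x\<in>{1..nverts G}. \<not> adj G x x)"

(* The drawn vertices form a 0-indexed list, so x_i is entry i - 1 of the sorted list.
   For nverts G = 0 and nverts F > 0 the value is unspecified, as pmf_of_set {} is. *)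
definition density_graph :: "ordered_graph \<Rightarrow> ordered_graph \<Rightarrow> real" where
  "density_graph F G =
     measure_pmf.prob (replicate_pmf (nverts F) (pmf_of_set {1..nverts G}))
       {xs. \<forall>i\<in>{1..nverts F}. \<forall>j\<in>{1..nverts F}. i < j \<longrightarrow>
              adj F i j = adj G (sort xs ! (i - 1)) (sort xs ! (j - 1))}"

definition convergent_ordered_graphs :: "(nat \<Rightarrow> ordered_graph) \<Rightarrow> bool" where
  "convergent_ordered_graphs G \<longleftrightarrow>
     (\<forall>n. is_ordered_graph (G n)) \<and>
     filterlim (\<lambda>n. nverts (G n)) at_top sequentially \<and>
     (\<forall>F. simple_ordered_graph F \<longrightarrow> convergent (\<lambda>n. density_graph F (G n)))"

definition unit_square :: "(real \<times> real) set" where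
  "unit_square = {0..1} \<times> {0..1}"

definition orderon :: "(real \<times> real \<Rightarrow> real \<times> real \<Rightarrow> real) \<Rightarrow> bool" where
  "orderon W \<longleftrightarrow>
     (\<lambda>(u, v). W u v) \<in> borel_measurable (lebesgue_on (unit_square \<times> unit_square)) \<and>
     (\<forall>u\<in>unit_square. \<forall>v\<in>unit_square. W u v \<in> {0..1} \<and> W u v = W v u)"

definition ordered_points :: "nat \<Rightarrow> (nat \<Rightarrow> real \<times> real) set" where
  "ordered_points k =
     {v \<in> {1..k} \<rightarrow>\<^sub>E unit_square.
        \<forall>i\<in>{1..k}. \<forall>j\<in>{1..k}. i \<le> j \<longrightarrow> fst (v i) \<le> fst (v j)}"

(* Lebesgue measure on the k-th power of the plane is the completion of the product of the
   Borel-Lebesgue measures. Without completion the integrand need not be measurable, since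
   W is only Lebesgue measurable on pairs. *)
definition density_orderon ::
    "ordered_graph \<Rightarrow> (real \<times> real \<Rightarrow> real \<times> real \<Rightarrow> real) \<Rightarrow> real" where
  "density_orderon F W =
     fact (nverts F) *
     (LINT v : ordered_points (nverts F) | completion (Pi\<^sub>M {1..nverts F} (\<lambda>_. lborel)).
        (\<Prod>(i, j) \<in> {(i, j) \<in> {1..nverts F} \<times> {1..nverts F}. i < j \<and> adj F i j}. W (v i) (v j)) *
        (\<Prod>(i, j) \<in> {(i, j) \<in> {1..nverts F} \<times> {1..nverts F}. i < j \<and> \<not> adj F i j}. 1 - W (v i) (v j)))"

end

theory Submission
  imports Defs
begin

text \<open>
  The proof gives a compactness theorem: every sequence of ordered graphs whose orders tend to
  infinity has a subsequence along which all densities converge to those of one orderon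
  (\<open>ordered_graph_compactness\<close>). For a convergent sequence the limit along a subsequence is the
  limit of the sequence.

  Every density is, up to a factor \<open>k!\<close> and a vanishing error caused by repeated vertices, an integral
  over \<open>k\<close> independent points of a product of kernels, one for each pair of vertices, where the
  indicator that the pair is in the right order is a factor of the kernel (\<open>pair_integral\<close>). The
  counting lemma (\<open>counting_lemma\<close>) says that such an integral changes little if every kernel is
  changed by an amount that is small when tested against products \<open>f x * g y\<close> of functions with values
  in the unit interval. It covers both perturbations that are small in the cut norm and perturbations
  that are small in mean.

  For each graph, nested partitions of the vertices are built. Their level \<open>m\<close> combines the
  position of a vertex among \<open>4 ^ m\<close> consecutive columns with a label of \<open>m\<close> base 4 digits. The next digit
  of the label records membership in the two sides of a rectangle on which the graph deviates most
  from its averages over cells. The square of this deviation is at most the increment of the energy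
  (\<open>greedy_label_sequence\<close>). Energies are bounded, and after passage to a subsequence they converge at
  every level; so the cut distance between the graphs and their averages at level \<open>m\<close> has a limit superior
  that tends to 0 as \<open>m\<close> grows. This replaces a regularity lemma with prescribed accuracy.

  Along the same subsequence the masses of all cells and the edge densities between them converge.
  The limits are realised on the unit square in two steps, both of which take limits of
  bounded martingales (\<open>L1_limit_of_cell_martingale\<close>). First, the share of the labels below a given one
  within the column of \<open>y\<close> converges as the columns shrink; the limits, as functions of \<open>y\<close>, cut the
  vertical segment at \<open>y\<close> into layers, and column together with layer has the prescribed joint
  distribution (\<open>measure_address\<close>). Second, the edge densities at the addresses of two points form a
  martingale whose limit is the orderon (\<open>ex_limit_orderon\<close>).

  The densities of a graph and of the orderon are then compared through the step functions of level
  \<open>m\<close> with the order observed only at a coarser level \<open>l\<close> of columns. Letting first the graphs grow, then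
  \<open>m\<close> and finally \<open>l\<close> tend to infinity removes all errors (\<open>density_tendsto\<close>).
\<close>

section \<open>Integrals and subsequences\<close>

text \<open>Keeps the index sets \<open>{1..k}\<close> in this form.\<close>

declare One_nat_def [simp del]

lemma (in prob_space) integrable_unit_interval:
  fixes f :: "'a \<Rightarrow> real"
  assumes "f \<in> borel_measurable M" "\<And>x. x \<in> space M \<Longrightarrow> 0 \<le> f x" "\<And>x. x \<in> space M \<Longrightarrow> f x \<le> 1"
  shows "integrable M f"
  using assms by (intro integrable_const_bound[of _ 1] AE_I2) auto

text \<open>
  If \<open>f\<close> is not integrable, its integral is 0 by convention. This default makes the bound applicable
  to inner integrals without a proof that they are measurable in the outer variable.
\<close>

lemma abs_integral_le_integral:
  fixes f g :: "'a \<Rightarrow> real"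
  assumes "integrable M g" "\<And>x. x \<in> space M \<Longrightarrow> \<bar>f x\<bar> \<le> g x"
  shows "\<bar>\<integral>x. f x \<partial>M\<bar> \<le> (\<integral>x. g x \<partial>M)"
proof (cases "integrable M f")
  case True
  have "\<bar>\<integral>x. f x \<partial>M\<bar> \<le> (\<integral>x. \<bar>f x\<bar> \<partial>M)"
    by (rule integral_abs_bound)
  also have "\<dots> \<le> (\<integral>x. g x \<partial>M)"
    using True assms by (intro integral_mono) auto
  finally show ?thesis .
next
  case False
  have "0 \<le> (\<integral>x. g x \<partial>M)"
    using assms(2) by (intro integral_nonneg_AE AE_I2) (meson abs_ge_zero order_trans)
  with False show ?thesis by (simp add: not_integrable_integral_eq)
qed

section \<open>Limits of bounded martingales\<close>

text \<open>
  By Tychonoff's theorem the countable product of unit intervals is compact and metrisable.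
\<close>

lemma bounded_family_convergent_subseq:
  fixes f :: "nat \<Rightarrow> 'i::countable \<Rightarrow> real"
  assumes "\<And>n i. f n i \<in> {0..1}"
  obtains r where "strict_mono r" "\<And>i. convergent (\<lambda>n. f (r n) i)"
proof -
  have "compactin (product_topology (\<lambda>i::'i. euclidean) UNIV) (PiE UNIV (\<lambda>_. {0..1::real}))"
    by (subst compactin_PiE) auto
  then have "compact (PiE (UNIV::'i set) (\<lambda>_. {0..1::real}))"
    by (simp add: euclidean_product_topology)
  then have "seq_compact (PiE (UNIV::'i set) (\<lambda>_. {0..1::real}))"
    by (rule compact_imp_seq_compact)
  moreover have "\<forall>n. f n \<in> PiE UNIV (\<lambda>_. {0..1})"
    using assms by auto
  ultimately obtain l r where lr: "strict_mono (r :: nat \<Rightarrow> nat)" "(f \<circ> r) \<longlonglongrightarrow> l"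
    by (rule seq_compactE)
  have "(\<lambda>n. f (r n) i) \<longlonglongrightarrow> l i" for i
    using continuous_on_tendsto_compose[OF continuous_on_product_coordinates[of i] lr(2)]
    by (simp add: o_def)
  then show thesis
    by (intro that[OF lr(1)]) (auto simp: convergent_def)
qed

lemma (in prob_space) integral_abs_le_sqrt:
  fixes f :: "'a \<Rightarrow> real"
  assumes f: "integrable M f" and f2: "integrable M (\<lambda>x. (f x)\<^sup>2)"
  shows "(\<integral>x. \<bar>f x\<bar> \<partial>M) \<le> sqrt (\<integral>x. (f x)\<^sup>2 \<partial>M)"
proof -
  have "variance (\<lambda>x. \<bar>f x\<bar>) = (\<integral>x. (f x)\<^sup>2 \<partial>M) - (\<integral>x. \<bar>f x\<bar> \<partial>M)\<^sup>2"
    using assms by (subst variance_eq) auto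
  moreover have "0 \<le> variance (\<lambda>x. \<bar>f x\<bar>)"
    by (rule integral_nonneg_AE) auto
  ultimately show ?thesis
    by (intro real_le_rsqrt) auto
qed

text \<open>
  By orthogonality the squared L2 distance of \<open>f l\<close> and \<open>f m\<close> is the difference of their second moments.
  These increase and are bounded, so the sequence is Cauchy in L2 and hence in L1. The limit is found
  as the limit almost everywhere of a subsequence.
\<close>

lemma (in prob_space) L1_convergent_if_orthogonal_increments:
  fixes f :: "nat \<Rightarrow> 'a \<Rightarrow> real"
  assumes meas [measurable]: "\<And>m. f m \<in> borel_measurable M"
    and bounds: "\<And>m x. x \<in> space M \<Longrightarrow> f m x \<in> {0..1}"
    and orth: "\<And>l m. l \<le> m \<Longrightarrow> (\<integral>x. f l x * f m x \<partial>M) = (\<integral>x. f l x * f l x \<partial>M)"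
  obtains g where "g \<in> borel_measurable M" "\<And>x. g x \<in> {0..1}"
    "(\<lambda>m. \<integral>x. \<bar>f m x - g x\<bar> \<partial>M) \<longlonglongrightarrow> 0"
proof -
  have f_int: "integrable M (f m)" for m
    using bounds by (intro integrable_unit_interval) auto
  have ff_int: "integrable M (\<lambda>x. f l x * f m x)" for l m
    using bounds by (intro integrable_unit_interval) (auto intro!: mult_le_one)
  define e where "e m = (\<integral>x. f m x * f m x \<partial>M)" for m
  have square: "(a - b)\<^sup>2 = a * a - 2 * (b * a) + b * b" for a b :: real
    by algebra
  have dist: "(\<integral>x. (f m x - f l x)\<^sup>2 \<partial>M) = e m - e l" if "l \<le> m" for l m
  proof -
    have "(\<integral>x. (f m x - f l x)\<^sup>2 \<partial>M) = (\<integral>x. f m x * f m x - 2 * (f l x * f m x) + f l x * f l x \<partial>M)"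
      by (intro Bochner_Integration.integral_cong refl) (rule square)
    also have "\<dots> = e m - 2 * (\<integral>x. f l x * f m x \<partial>M) + e l"
      using ff_int by (simp add: e_def)
    finally show ?thesis using orth[OF that] by (simp add: e_def)
  qed
  have "e l \<le> e m" if "l \<le> m" for l m
  proof -
    have "0 \<le> (\<integral>x. (f m x - f l x)\<^sup>2 \<partial>M)" by (rule integral_nonneg_AE) auto
    then show ?thesis using dist[OF that] by simp
  qed
  moreover have "e m \<le> 1" for m
    unfolding e_def using bounds
    by (intro integral_le_const ff_int AE_I2) (auto intro!: mult_le_one)
  moreover have "0 \<le> e m" for m
    unfolding e_def by (rule integral_nonneg_AE) auto
  ultimately have "convergent e"
    using incseq_convergent[of e 1] by (metis convergentI incseq_def)
  then have cauchy_e: "Cauchy e" by (simp add: convergent_Cauchy)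
  have cauchy: "\<exists>N. \<forall>i\<ge>N. \<forall>j\<ge>N. (\<integral>x. norm (f i x - f j x) \<partial>M) < \<epsilon>" if "\<epsilon> > 0" for \<epsilon> :: real
  proof -
    have "0 < \<epsilon>\<^sup>2" using that by simp
    then obtain N where "\<forall>i\<ge>N. \<forall>j\<ge>N. dist (e i) (e j) < \<epsilon>\<^sup>2"
      using metric_CauchyD[OF cauchy_e] by blast
    then have N: "\<bar>e i - e j\<bar> < \<epsilon>\<^sup>2" if "i \<ge> N" "j \<ge> N" for i j
      using that by (simp add: dist_real_def)
    have le: "(\<integral>x. \<bar>f i x - f j x\<bar> \<partial>M) < \<epsilon>" if ij: "i \<ge> j" "j \<ge> N" for i j
    proof -
      have "(\<integral>x. \<bar>f i x - f j x\<bar> \<partial>M) \<le> sqrt (\<integral>x. (f i x - f j x)\<^sup>2 \<partial>M)"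
        using ff_int f_int
        by (intro integral_abs_le_sqrt) (auto simp: square)
      also have "\<dots> = sqrt (e i - e j)" using dist[OF ij(1)] by simp
      also have "\<dots> < \<epsilon>" using N[of i j] ij \<open>\<epsilon> > 0\<close> by (intro real_less_lsqrt) auto
      finally show ?thesis .
    qed
    have "(\<integral>x. norm (f i x - f j x) \<partial>M) < \<epsilon>" if "i \<ge> N" "j \<ge> N" for i j
      using le[of i j] le[of j i] that by (cases "i \<ge> j") (auto simp: abs_minus_commute)
    then show ?thesis by auto
  qed
  obtain r where r: "strict_mono r" "AE x in M. Cauchy (\<lambda>i. f (r i) x)"
    using cauchy_L1_AE_cauchy_subseq[OF f_int cauchy] by blast
  define g where "g x = max 0 (min 1 (lim (\<lambda>i. f (r i) x)))" for x
  have [measurable]: "g \<in> borel_measurable M"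
    unfolding g_def by measurable
  have lim: "AE x in M. (\<lambda>i. f (r i) x) \<longlonglongrightarrow> g x"
    using r(2) AE_space
  proof eventually_elim
    case (elim x)
    then have L: "(\<lambda>i. f (r i) x) \<longlonglongrightarrow> lim (\<lambda>i. f (r i) x)"
      using Cauchy_convergent convergent_LIMSEQ_iff by blast
    have "lim (\<lambda>i. f (r i) x) \<in> {0..1}"
      using bounds[OF elim(2)] by (intro Lim_in_closed_set[OF _ _ _ L]) auto
    then show ?case using L by (simp add: g_def)
  qed
  have g01: "g x \<in> {0..1}" for x by (auto simp: g_def)
  have g_int: "integrable M g" using g01 by (intro integrable_unit_interval) auto
  have "(\<lambda>i. \<integral>x. \<bar>f (r i) x - g x\<bar> \<partial>M) \<longlonglongrightarrow> (\<integral>x. 0 \<partial>M)"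
  proof (rule integral_dominated_convergence[where w="\<lambda>_. 1"])
    show "AE x in M. (\<lambda>i. \<bar>f (r i) x - g x\<bar>) \<longlonglongrightarrow> 0"
      using lim by eventually_elim (auto intro: tendsto_rabs_zero LIM_zero)
    show "AE x in M. norm \<bar>f (r i) x - g x\<bar> \<le> 1" for i
    proof (intro AE_I2)
      fix x assume "x \<in> space M"
      then show "norm \<bar>f (r i) x - g x\<bar> \<le> 1"
        using bounds[of x "r i"] g01[of x] by auto
    qed
  qed auto
  then have sub: "(\<lambda>i. \<integral>x. \<bar>f (r i) x - g x\<bar> \<partial>M) \<longlonglongrightarrow> 0" by simp
  have "(\<lambda>m. \<integral>x. \<bar>f m x - g x\<bar> \<partial>M) \<longlonglongrightarrow> 0"
  proof (rule LIMSEQ_I)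
    fix \<epsilon> :: real assume "\<epsilon> > 0"
    obtain N where N: "\<And>i j. i \<ge> N \<Longrightarrow> j \<ge> N \<Longrightarrow> (\<integral>x. norm (f i x - f j x) \<partial>M) < \<epsilon>/2"
      using cauchy[of "\<epsilon>/2"] \<open>\<epsilon> > 0\<close> by auto
    obtain K where K: "\<And>i. i \<ge> K \<Longrightarrow> (\<integral>x. \<bar>f (r i) x - g x\<bar> \<partial>M) < \<epsilon>/2"
      using LIMSEQ_D[OF sub, of "\<epsilon>/2"] \<open>\<epsilon> > 0\<close> by (auto simp: abs_less_iff)
    define i where "i = max N K"
    have "r i \<ge> N" using seq_suble[OF r(1), of i] by (simp add: i_def)
    have "(\<integral>x. \<bar>f m x - g x\<bar> \<partial>M) < \<epsilon>" if "m \<ge> N" for m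
    proof -
      have "(\<integral>x. \<bar>f m x - g x\<bar> \<partial>M) \<le> (\<integral>x. \<bar>f m x - f (r i) x\<bar> + \<bar>f (r i) x - g x\<bar> \<partial>M)"
        using f_int g_int by (intro integral_mono) auto
      also have "\<dots> = (\<integral>x. \<bar>f m x - f (r i) x\<bar> \<partial>M) + (\<integral>x. \<bar>f (r i) x - g x\<bar> \<partial>M)"
        using f_int g_int by (intro Bochner_Integration.integral_add) auto
      also have "\<dots> < \<epsilon>/2 + \<epsilon>/2"
        using N[OF that \<open>r i \<ge> N\<close>] K[of i] by (intro add_strict_mono) (auto simp: i_def)
      finally show ?thesis by simp
    qed
    then show "\<exists>N. \<forall>m\<ge>N. norm ((\<integral>x. \<bar>f m x - g x\<bar> \<partial>M) - 0) < \<epsilon>"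
      by (intro exI[of _ N]) simp
  qed
  then show thesis by (intro that[of g] g01) auto
qed

lemma (in prob_space) integral_finite_range:
  fixes \<phi> :: "'c \<Rightarrow> real"
  assumes \<kappa>: "\<kappa> \<in> measurable M (count_space UNIV)" and C: "finite C" "\<And>x. x \<in> space M \<Longrightarrow> \<kappa> x \<in> C"
  shows "(\<integral>x. \<phi> (\<kappa> x) \<partial>M) = (\<Sum>c\<in>C. \<phi> c * measure M {x\<in>space M. \<kappa> x = c})"
proof -
  have [measurable]: "{x\<in>space M. \<kappa> x = c} \<in> sets M" for c
    using \<kappa> by measurable
  have "(\<integral>x. \<phi> (\<kappa> x) \<partial>M) = (\<integral>x. (\<Sum>c\<in>C. \<phi> c * indicator {x\<in>space M. \<kappa> x = c} x) \<partial>M)"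
  proof (intro Bochner_Integration.integral_cong refl)
    fix x assume x: "x \<in> space M"
    have "(\<Sum>c\<in>C. \<phi> c * indicator {x\<in>space M. \<kappa> x = c} x) = (\<Sum>c\<in>C. if \<kappa> x = c then \<phi> c else 0)"
      using x by (intro sum.cong refl) auto
    then show "\<phi> (\<kappa> x) = (\<Sum>c\<in>C. \<phi> c * indicator {x\<in>space M. \<kappa> x = c} x)"
      using C x by simp
  qed
  also have "\<dots> = (\<Sum>c\<in>C. \<phi> c * measure M {x\<in>space M. \<kappa> x = c})"
  proof -
    have "integrable M (indicat_real {x\<in>space M. \<kappa> x = c})" for c
      by (intro integrable_unit_interval) (auto simp: indicator_def)
    then show ?thesis by (subst Bochner_Integration.integral_sum) auto
  qed
  finally show ?thesis .
qed

text \<open>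
  The labels \<open>\<kappa> m\<close> define refining finite partitions, and the hypothesis on sums says that \<open>\<phi> l \<circ> \<kappa> l\<close> is
  the conditional expectation of \<open>\<phi> m \<circ> \<kappa> m\<close> given the label \<open>\<kappa> l\<close>. Testing against functions of \<open>\<kappa> l\<close> shows
  that the increments are orthogonal. It also shows that the integral over a cell of level \<open>l\<close> is the
  same at all later levels, so it is inherited by the limit.
\<close>

lemma (in prob_space) L1_limit_of_cell_martingale:
  fixes \<phi> :: "nat \<Rightarrow> 'c \<Rightarrow> real" and \<kappa> :: "nat \<Rightarrow> 'a \<Rightarrow> 'c"
  assumes \<kappa>: "\<And>m. \<kappa> m \<in> measurable M (count_space UNIV)"
    and C: "\<And>m. finite (C m)" "\<And>m x. x \<in> space M \<Longrightarrow> \<kappa> m x \<in> C m"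
    and \<phi>: "\<And>m c. c \<in> C m \<Longrightarrow> \<phi> m c \<in> {0..1}"
    and q: "\<And>m c. c \<in> C m \<Longrightarrow> measure M {x\<in>space M. \<kappa> m x = c} = q m c"
    and \<rho>: "\<And>l m c. l \<le> m \<Longrightarrow> c \<in> C m \<Longrightarrow> \<rho> l m c \<in> C l"
    and nested: "\<And>l m. l \<le> m \<Longrightarrow> AE x in M. \<kappa> l x = \<rho> l m (\<kappa> m x)"
    and mart: "\<And>l m c. l \<le> m \<Longrightarrow> c \<in> C l \<Longrightarrow>
       (\<Sum>c'\<in>{c'\<in>C m. \<rho> l m c' = c}. \<phi> m c' * q m c') = \<phi> l c * q l c"
  obtains g where "g \<in> borel_measurable M" "\<And>x. g x \<in> {0..1}"
    "(\<lambda>m. \<integral>x. \<bar>\<phi> m (\<kappa> m x) - g x\<bar> \<partial>M) \<longlonglongrightarrow> 0"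
    "\<And>l c. c \<in> C l \<Longrightarrow> (\<integral>x. of_bool (\<kappa> l x = c) * g x \<partial>M) = \<phi> l c * q l c"
proof -
  have meas: "(\<lambda>x. h (\<kappa> m x)) \<in> borel_measurable M" for h :: "'c \<Rightarrow> real" and m
    using measurable_compose[OF \<kappa>[of m], of h borel] by simp
  have test: "(\<integral>x. h (\<kappa> l x) * \<phi> m (\<kappa> m x) \<partial>M) = (\<Sum>c\<in>C l. h c * (\<phi> l c * q l c))"
    if lm: "l \<le> m" for h :: "'c \<Rightarrow> real" and l m
  proof -
    have "(\<integral>x. h (\<kappa> l x) * \<phi> m (\<kappa> m x) \<partial>M) = (\<integral>x. h (\<rho> l m (\<kappa> m x)) * \<phi> m (\<kappa> m x) \<partial>M)"
      using nested[OF lm] by (intro integral_cong_AE borel_measurable_times meas) auto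
    also have "\<dots> = (\<Sum>c'\<in>C m. h (\<rho> l m c') * \<phi> m c' * q m c')"
      by (subst integral_finite_range[OF \<kappa> C, of "\<lambda>c. h (\<rho> l m c) * \<phi> m c"]) (auto simp: q)
    also have "\<dots> = (\<Sum>c\<in>C l. \<Sum>c'\<in>{c'\<in>C m. \<rho> l m c' = c}. h (\<rho> l m c') * \<phi> m c' * q m c')"
      using \<rho>[OF lm] C by (intro sum.group[symmetric]) auto
    also have "\<dots> = (\<Sum>c\<in>C l. \<Sum>c'\<in>{c'\<in>C m. \<rho> l m c' = c}. h c * (\<phi> m c' * q m c'))"
      by (intro sum.cong refl) auto
    also have "\<dots> = (\<Sum>c\<in>C l. h c * (\<phi> l c * q l c))"
      by (intro sum.cong refl) (simp add: sum_distrib_left[symmetric] mart[OF lm])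
    finally show ?thesis .
  qed
  obtain g where g: "g \<in> borel_measurable M" "\<And>x. g x \<in> {0..1}"
    "(\<lambda>m. \<integral>x. \<bar>\<phi> m (\<kappa> m x) - g x\<bar> \<partial>M) \<longlonglongrightarrow> 0"
  proof (rule L1_convergent_if_orthogonal_increments)
    show "(\<lambda>x. \<phi> m (\<kappa> m x)) \<in> borel_measurable M" for m by (rule meas)
    show "\<phi> m (\<kappa> m x) \<in> {0..1}" if "x \<in> space M" for m x using \<phi> C that by blast
    show "(\<integral>x. \<phi> l (\<kappa> l x) * \<phi> m (\<kappa> m x) \<partial>M) = (\<integral>x. \<phi> l (\<kappa> l x) * \<phi> l (\<kappa> l x) \<partial>M)" if "l \<le> m" for l m
      unfolding test[OF that] test[OF order_refl] ..
  qed blast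
  show thesis
  proof (rule that[OF g])
    fix l c assume c: "c \<in> C l"
    let ?I = "\<lambda>x. of_bool (\<kappa> l x = c) :: real"
    have g_int: "integrable M g" using g by (intro integrable_unit_interval) auto
    have I_meas [measurable]: "?I \<in> borel_measurable M" using meas[of "\<lambda>d. of_bool (d = c)" l] .
    have \<phi>_int: "integrable M (\<lambda>x. \<phi> m (\<kappa> m x))" for m
      using \<phi> C by (intro integrable_unit_interval meas) fastforce+
    have int: "integrable M (\<lambda>x. ?I x * h x)" if "integrable M h" for h
      using that by (intro Bochner_Integration.integrable_bound[OF that]) auto
    have "(\<lambda>m. (\<integral>x. ?I x * \<phi> m (\<kappa> m x) \<partial>M) - (\<integral>x. ?I x * g x \<partial>M)) \<longlonglongrightarrow> 0"
    proof (rule Lim_null_comparison[OF _ g(3)], intro always_eventually allI)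
      fix m
      have "(\<integral>x. ?I x * \<phi> m (\<kappa> m x) \<partial>M) - (\<integral>x. ?I x * g x \<partial>M) =
          (\<integral>x. ?I x * \<phi> m (\<kappa> m x) - ?I x * g x \<partial>M)"
        by (rule Bochner_Integration.integral_diff[symmetric, OF int[OF \<phi>_int] int[OF g_int]])
      then show "norm ((\<integral>x. ?I x * \<phi> m (\<kappa> m x) \<partial>M) - (\<integral>x. ?I x * g x \<partial>M)) \<le> (\<integral>x. \<bar>\<phi> m (\<kappa> m x) - g x\<bar> \<partial>M)"
        using \<phi>_int g_int by (auto intro!: abs_integral_le_integral)
    qed
    moreover have "eventually (\<lambda>m. (\<integral>x. ?I x * \<phi> m (\<kappa> m x) \<partial>M) = \<phi> l c * q l c) sequentially"
      using eventually_ge_at_top[of l]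
    proof eventually_elim
      case (elim m)
      have "(\<integral>x. ?I x * \<phi> m (\<kappa> m x) \<partial>M) = (\<Sum>d\<in>C l. of_bool (d = c) * (\<phi> l d * q l d))"
        by (rule test[OF elim])
      also have "\<dots> = (\<Sum>d\<in>C l. if d = c then \<phi> l d * q l d else 0)"
        by (intro sum.cong) auto
      finally show ?case using c C by simp
    qed
    ultimately have "(\<lambda>m. \<phi> l c * q l c - (\<integral>x. ?I x * g x \<partial>M)) \<longlonglongrightarrow> 0"
      by (elim Lim_transform_eventually) (auto elim: eventually_mono)
    then show "(\<integral>x. ?I x * g x \<partial>M) = \<phi> l c * q l c"
      by (simp add: LIMSEQ_const_iff)
  qed
qed

text \<open>
  The integral of the positive part of \<open>f - h\<close> is at most the sum of the two L1 errors.
\<close>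

lemma (in prob_space) AE_le_of_L1_limits:
  fixes f h :: "'a \<Rightarrow> real"
  assumes int: "integrable M f" "integrable M h" "\<And>m. integrable M (F m)" "\<And>m. integrable M (H m)"
    and lim: "(\<lambda>m. \<integral>x. \<bar>F m x - f x\<bar> \<partial>M) \<longlonglongrightarrow> 0" "(\<lambda>m. \<integral>x. \<bar>H m x - h x\<bar> \<partial>M) \<longlonglongrightarrow> 0"
    and le: "eventually (\<lambda>m. \<forall>x\<in>space M. F m x \<le> H m x) sequentially"
  shows "AE x in M. f x \<le> h x"
proof -
  let ?d = "\<lambda>x. max 0 (f x - h x)"
  have d_int: "integrable M ?d" using int by auto
  have "(\<lambda>m. (\<integral>x. \<bar>F m x - f x\<bar> \<partial>M) + (\<integral>x. \<bar>H m x - h x\<bar> \<partial>M)) \<longlonglongrightarrow> 0 + 0"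
    by (intro tendsto_add lim)
  moreover have "eventually (\<lambda>m. (\<integral>x. ?d x \<partial>M) \<le> (\<integral>x. \<bar>F m x - f x\<bar> \<partial>M) + (\<integral>x. \<bar>H m x - h x\<bar> \<partial>M)) sequentially"
    using le
  proof eventually_elim
    case (elim m)
    have "(\<integral>x. ?d x \<partial>M) \<le> (\<integral>x. \<bar>F m x - f x\<bar> + \<bar>H m x - h x\<bar> \<partial>M)"
    proof (intro integral_mono d_int)
      fix x assume "x \<in> space M"
      then have "F m x \<le> H m x" using elim by blast
      then show "?d x \<le> \<bar>F m x - f x\<bar> + \<bar>H m x - h x\<bar>" by linarith
    qed (use int in auto)
    then show ?case using int by simp
  qed
  ultimately have "(\<integral>x. ?d x \<partial>M) \<le> 0 + 0"
    by (rule tendsto_lowerbound) simp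
  moreover have "0 \<le> (\<integral>x. ?d x \<partial>M)" by (rule integral_nonneg_AE) auto
  ultimately have "(\<integral>x. ?d x \<partial>M) = 0" by simp
  then have "AE x in M. ?d x = 0"
    using d_int by (subst (asm) integral_nonneg_eq_0_iff_AE) auto
  then show ?thesis by eventually_elim (auto simp: max_def split: if_splits)
qed

section \<open>Pair integrals and the counting lemma\<close>

definition vertex_pairs :: "nat \<Rightarrow> (nat \<times> nat) set" where
  "vertex_pairs k = {(i, j). i \<in> {1..k} \<and> j \<in> {1..k} \<and> i < j}"

text \<open>
  All densities are brought to this form, for the uniform measure on the vertices of a graph as well as
  for the measure of the unit square. The kernels need not be symmetric, so a kernel can contain the
  condition that its two arguments are in increasing order.
\<close>

definition pair_integral ::
    "nat \<Rightarrow> 'a measure \<Rightarrow> (nat \<times> nat \<Rightarrow> 'a \<Rightarrow> 'a \<Rightarrow> real) \<Rightarrow> real" where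
  "pair_integral k M a =
     (\<integral>v. (\<Prod>q\<in>vertex_pairs k. a q (v (fst q)) (v (snd q))) \<partial>Pi\<^sub>M {1..k} (\<lambda>_. M))"

lemma finite_vertex_pairs [simp, intro]: "finite (vertex_pairs k)"
  by (rule finite_subset[of _ "{1..k} \<times> {1..k}"]) (auto simp: vertex_pairs_def)

text \<open>
  The bounds hold at all points, and not only almost everywhere, so that partial products of kernels
  can serve as test functions.
\<close>

definition unit_kernel :: "'a measure \<Rightarrow> ('a \<Rightarrow> 'a \<Rightarrow> real) \<Rightarrow> bool" where
  "unit_kernel M a \<longleftrightarrow> case_prod a \<in> borel_measurable (M \<Otimes>\<^sub>M M) \<and> (\<forall>x y. a x y \<in> {0..1})"

lemma unit_kernelD:
  assumes "unit_kernel M a"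
  shows "case_prod a \<in> borel_measurable (M \<Otimes>\<^sub>M M)" "0 \<le> a x y" "a x y \<le> 1"
  using assms by (auto simp: unit_kernel_def)

lemma measurable_kernel_comp:
  assumes "case_prod a \<in> borel_measurable (M \<Otimes>\<^sub>M M)" "f \<in> measurable N M" "g \<in> measurable N M"
  shows "(\<lambda>x. a (f x) (g x)) \<in> borel_measurable N"
  using measurable_compose[OF measurable_Pair[OF assms(2,3)] assms(1)] by simp

lemma (in prob_space) abs_integral_le_const:
  fixes f :: "'a \<Rightarrow> real"
  assumes "\<And>x. x \<in> space M \<Longrightarrow> \<bar>f x\<bar> \<le> c"
  shows "\<bar>\<integral>x. f x \<partial>M\<bar> \<le> c"
  using abs_integral_le_integral[of M "\<lambda>_. c" f] assms by (simp add: prob_space)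

text \<open>
  Let \<open>q = (i, j)\<close>, and fix the points of all vertices except \<open>i\<close> and \<open>j\<close>. No kernel in \<open>S\<close> depends on both
  remaining points, so the product of these kernels has the form \<open>f y * g z\<close>, and the assumption bounds
  the inner double integral.
\<close>

lemma (in prob_space) integral_pair_factor_le:
  fixes D :: "'a \<Rightarrow> 'a \<Rightarrow> real" and R :: "nat \<times> nat \<Rightarrow> 'a \<Rightarrow> 'a \<Rightarrow> real"
  assumes q: "q \<in> vertex_pairs k" and S: "S \<subseteq> vertex_pairs k - {q}"
    and D: "case_prod D \<in> borel_measurable (M \<Otimes>\<^sub>M M)" "\<And>x y. \<bar>D x y\<bar> \<le> 1"
    and R: "\<And>s. s \<in> S \<Longrightarrow> unit_kernel M (R s)"
    and \<delta>: "\<And>f g. f \<in> borel_measurable M \<Longrightarrow> g \<in> borel_measurable M \<Longrightarrow>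
        (\<And>x. f x \<in> {0..1}) \<Longrightarrow> (\<And>x. g x \<in> {0..1}) \<Longrightarrow>
        \<bar>\<integral>x. (\<integral>y. f x * g y * D x y \<partial>M) \<partial>M\<bar> \<le> \<delta>"
  shows "\<bar>\<integral>v. (\<Prod>s\<in>S. R s (v (fst s)) (v (snd s))) * D (v (fst q)) (v (snd q))
          \<partial>Pi\<^sub>M {1..k} (\<lambda>_. M)\<bar> \<le> \<delta>"
proof -
  have finS: "finite S" using S finite_subset by blast
  obtain i j where qij: "q = (i, j)" and ij: "i \<in> {1..k}" "j \<in> {1..k}" "i < j"
    using q by (auto simp: vertex_pairs_def)
  define J where "J = {1..k} - {i, j}"
  have I: "{1..k} = insert j (insert i J)" and notin: "j \<notin> insert i J" "i \<notin> J" and J: "finite J"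
    using ij by (auto simp: J_def)
  interpret P: product_sigma_finite "\<lambda>_::nat. M"
    by standard
  have P': "prob_space (Pi\<^sub>M L (\<lambda>_::nat. M))" for L
    by (intro prob_space_PiM prob_space_axioms)
  define h where "h v = (\<Prod>s\<in>S. R s (v (fst s)) (v (snd s))) * D (v i) (v j)" for v
  have S_in: "fst s \<in> {1..k}" "snd s \<in> {1..k}" if "s \<in> S" for s
    using S that by (auto simp: vertex_pairs_def)
  have comp: "(\<lambda>v. v l) \<in> measurable (Pi\<^sub>M {1..k} (\<lambda>_. M)) M" if "l \<in> {1..k}" for l
    using that by measurable
  have [measurable]: "h \<in> borel_measurable (Pi\<^sub>M {1..k} (\<lambda>_. M))"
    unfolding h_def using S_in ij
    by (intro borel_measurable_times borel_measurable_prod measurable_kernel_comp[OF unit_kernelD(1)[OF R]]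
        measurable_kernel_comp[OF D(1)] comp) auto
  have h_le: "\<bar>h v\<bar> \<le> 1" for v
    unfolding h_def abs_mult using D(2) unit_kernelD(2,3)[OF R] 
    by (intro mult_le_one) (auto simp: abs_prod intro!: prod_le_1)
  have h_int: "integrable (Pi\<^sub>M {1..k} (\<lambda>_. M)) h"
    using h_le by (intro finite_measure.integrable_const_bound[of _ _ 1]
        prob_space.finite_measure P') auto
  have "(\<integral>v. h v \<partial>Pi\<^sub>M {1..k} (\<lambda>_. M)) =
      (\<integral>x. (\<integral>z. h (x(j := z)) \<partial>M) \<partial>Pi\<^sub>M (insert i J) (\<lambda>_. M))"
    using h_int notin J unfolding I by (intro P.product_integral_insert) auto
  also have "\<dots> = (\<integral>x. (\<integral>y. (\<integral>z. h (x(i := y, j := z)) \<partial>M) \<partial>M) \<partial>Pi\<^sub>M J (\<lambda>_. M))"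
  proof (intro P.product_integral_insert J notin)
    have [measurable]: "(\<lambda>(x, z). h (x(j := z))) \<in> borel_measurable (Pi\<^sub>M (insert i J) (\<lambda>_. M) \<Otimes>\<^sub>M M)"
    proof -
      have "(\<lambda>p. (fst p)(j := snd p)) \<in> measurable (Pi\<^sub>M (insert i J) (\<lambda>_. M) \<Otimes>\<^sub>M M) (Pi\<^sub>M {1..k} (\<lambda>_. M))"
        unfolding I by (rule measurable_fun_upd[where J="insert i J"]) auto
      from measurable_compose[OF this \<open>h \<in> borel_measurable _\<close>] show ?thesis by (simp add: case_prod_beta')
    qed
    show "integrable (Pi\<^sub>M (insert i J) (\<lambda>_. M)) (\<lambda>x. \<integral>z. h (x(j := z)) \<partial>M)"
      using h_le by (intro finite_measure.integrable_const_bound[of _ _ 1]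
        prob_space.finite_measure P' AE_I2) (auto intro!: abs_integral_le_const)
  qed
  also have "\<bar>\<dots>\<bar> \<le> \<delta>"
  proof (rule prob_space.abs_integral_le_const[OF P'])
    fix x assume x: "x \<in> space (Pi\<^sub>M J (\<lambda>_. M))"
    \<comment> \<open>A pair in \<open>S2\<close> does not contain \<open>i\<close>, because the only pair with entries \<open>i\<close> and \<open>j\<close> is \<open>q\<close>.\<close>
    define S1 where "S1 = {s\<in>S. fst s \<noteq> j \<and> snd s \<noteq> j}"
    define S2 where "S2 = {s\<in>S. fst s = j \<or> snd s = j}"
    define f where "f y = (\<Prod>s\<in>S1. R s ((x(i := y)) (fst s)) ((x(i := y)) (snd s)))" for y
    define g where "g z = (\<Prod>s\<in>S2. R s ((x(j := z)) (fst s)) ((x(j := z)) (snd s)))" for z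
    have S2: "fst s \<noteq> i" "snd s \<noteq> i" if "s \<in> S2" for s
      using that S ij qij by (auto simp: S2_def vertex_pairs_def)
    have split: "h (x(i := y, j := z)) = f y * g z * D y z" for y z
    proof -
      have "(\<Prod>s\<in>S. R s ((x(i := y, j := z)) (fst s)) ((x(i := y, j := z)) (snd s)))
        = (\<Prod>s\<in>S1. R s ((x(i := y, j := z)) (fst s)) ((x(i := y, j := z)) (snd s))) *
          (\<Prod>s\<in>S2. R s ((x(i := y, j := z)) (fst s)) ((x(i := y, j := z)) (snd s)))"
        using finS by (subst prod.union_disjoint[symmetric]) (auto simp: S1_def S2_def intro!: prod.cong)
      also have "\<dots> = f y * g z"
        unfolding f_def g_def using S2
        by (intro arg_cong2[where f="(*)"] prod.cong) (auto simp: S1_def)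
      finally show ?thesis using ij by (simp add: h_def)
    qed
    have upd: "(\<lambda>y. (x(l := y)) m) \<in> measurable M M" if "m \<in> insert l J" for l m
      using that space_PiM[of J "\<lambda>_. M"] x by (cases "m = l") (auto simp: PiE_iff)
    have "f \<in> borel_measurable M"
      unfolding f_def using S_in
      by (intro borel_measurable_prod measurable_kernel_comp[OF unit_kernelD(1)[OF R]] upd)
         (auto simp: S1_def J_def)
    moreover have "g \<in> borel_measurable M"
      unfolding g_def using S_in S2
      by (intro borel_measurable_prod measurable_kernel_comp[OF unit_kernelD(1)[OF R]] upd)
         (auto simp: S2_def J_def)
    moreover have "f y \<in> {0..1}" "g z \<in> {0..1}" for y z
      unfolding f_def g_def using unit_kernelD(2,3)[OF R]
      by (auto intro!: prod_nonneg prod_le_1 simp: S1_def S2_def)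
    ultimately show "\<bar>\<integral>y. (\<integral>z. h (x(i := y, j := z)) \<partial>M) \<partial>M\<bar> \<le> \<delta>"
      unfolding split by (rule \<delta>)
  qed
  finally show ?thesis by (simp add: h_def[abs_def] qij)
qed

text \<open>
  The kernels \<open>b\<close> are replaced by \<open>a\<close> one pair at a time, each time at the cost of \<open>\<delta>\<close>.
\<close>

lemma (in prob_space) counting_lemma:
  fixes \<delta> :: real
  assumes a: "\<And>q. q \<in> vertex_pairs k \<Longrightarrow> unit_kernel M (a q)"
    and b: "\<And>q. q \<in> vertex_pairs k \<Longrightarrow> unit_kernel M (b q)"
    and \<delta>: "\<And>q f g. q \<in> vertex_pairs k \<Longrightarrow> f \<in> borel_measurable M \<Longrightarrow> g \<in> borel_measurable M \<Longrightarrow>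
        (\<And>x. f x \<in> {0..1}) \<Longrightarrow> (\<And>x. g x \<in> {0..1}) \<Longrightarrow>
        \<bar>\<integral>x. (\<integral>y. f x * g y * (a q x y - b q x y) \<partial>M) \<partial>M\<bar> \<le> \<delta>"
  shows "\<bar>pair_integral k M a - pair_integral k M b\<bar> \<le> card (vertex_pairs k) * \<delta>"
proof -
  let ?Q = "vertex_pairs k" and ?P = "Pi\<^sub>M {1..k} (\<lambda>_::nat. M)"
  have P': "prob_space ?P"
    by (intro prob_space_PiM prob_space_axioms)
  \<comment> \<open>The hybrid in which the pairs in \<open>A\<close> have already been replaced.\<close>
  define c where "c A q = (if q \<in> A then a q else b q)" for A q
  have c: "unit_kernel M (c A q)" if "q \<in> ?Q" for A q
    using a b that by (auto simp: c_def)
  have c_int: "integrable ?P (\<lambda>v. (\<Prod>q\<in>?Q. c A q (v (fst q)) (v (snd q))))" for A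
  proof (rule prob_space.integrable_unit_interval[OF P'])
    show "(\<lambda>v. (\<Prod>q\<in>?Q. c A q (v (fst q)) (v (snd q)))) \<in> borel_measurable ?P"
      by (intro borel_measurable_prod measurable_kernel_comp[OF unit_kernelD(1)[OF c]] 
          measurable_component_singleton) (auto simp: vertex_pairs_def)
  qed (auto intro!: prod_nonneg prod_le_1 unit_kernelD(2,3)[OF c])
  have "\<bar>pair_integral k M (c A) - pair_integral k M b\<bar> \<le> card A * \<delta>" if "A \<subseteq> ?Q" for A
    using finite_subset[OF that finite_vertex_pairs] that
  proof (induction A rule: finite_induct)
    case empty
    then show ?case by (simp add: c_def)
  next
    case (insert q A)
    then have q: "q \<in> ?Q" and A: "A \<subseteq> ?Q" "q \<notin> A" by auto
    have split: "(\<Prod>s\<in>?Q. c B s (v (fst s)) (v (snd s))) =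
        (\<Prod>s\<in>?Q - {q}. c A s (v (fst s)) (v (snd s))) * c B q (v (fst q)) (v (snd q))"
      if "B = A \<or> B = insert q A" for B v
      using that q by (subst prod.remove[of _ q]) (auto simp: c_def mult.commute intro!: prod.cong)
    have cq: "c (insert q A) q = a q" "c A q = b q"
      using A by (auto simp: c_def)
    have "pair_integral k M (c (insert q A)) - pair_integral k M (c A) =
        (\<integral>v. (\<Prod>s\<in>?Q - {q}. c A s (v (fst s)) (v (snd s))) *
           (a q (v (fst q)) (v (snd q)) - b q (v (fst q)) (v (snd q))) \<partial>?P)"
      unfolding pair_integral_def using A
      by (subst Bochner_Integration.integral_diff[symmetric, OF c_int c_int])
         (auto simp: split right_diff_distrib cq intro!: Bochner_Integration.integral_cong)
    also have "\<bar>\<dots>\<bar> \<le> \<delta>"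
    proof (rule integral_pair_factor_le[OF q order_refl])
      show "(\<lambda>(x, y). a q x y - b q x y) \<in> borel_measurable (M \<Otimes>\<^sub>M M)"
        using unit_kernelD(1)[OF a[OF q]] unit_kernelD(1)[OF b[OF q]] by measurable
      show "\<bar>a q x y - b q x y\<bar> \<le> 1" for x y
        using unit_kernelD(2,3)[OF a[OF q], of x y] unit_kernelD(2,3)[OF b[OF q], of x y] by linarith
    qed (use c \<delta>[OF q] in auto)
    finally show ?case
      using insert by (simp add: algebra_simps)
  qed
  from this[of ?Q] show ?thesis
    by (simp add: c_def pair_integral_def cong: prod.cong)
qed

text \<open>
  A difference of kernels that is small in mean stays small when multiplied by test functions with
  values in the unit interval.
\<close>

lemma (in prob_space) counting_lemma_L1:
  assumes a: "\<And>q. q \<in> vertex_pairs k \<Longrightarrow> unit_kernel M (a q)"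
    and b: "\<And>q. q \<in> vertex_pairs k \<Longrightarrow> unit_kernel M (b q)"
    and D: "unit_kernel M D"
    and le: "\<And>q x y. q \<in> vertex_pairs k \<Longrightarrow> x \<in> space M \<Longrightarrow> y \<in> space M \<Longrightarrow> \<bar>a q x y - b q x y\<bar> \<le> D x y"
  shows "\<bar>pair_integral k M a - pair_integral k M b\<bar> \<le> card (vertex_pairs k) * (\<integral>x. (\<integral>y. D x y \<partial>M) \<partial>M)"
  proof (rule counting_lemma)
  show "unit_kernel M (a q)" "unit_kernel M (b q)" if "q \<in> vertex_pairs k" for q
    using a b that by auto
  fix q f g
  assume q: "q \<in> vertex_pairs k" and fg [measurable]: "f \<in> borel_measurable M" "g \<in> borel_measurable M"
    and f: "\<And>x::'a. f x \<in> {0..1::real}" and g: "\<And>x::'a. g x \<in> {0..1::real}"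
  note m [measurable] = unit_kernelD(1)[OF a[OF q]] unit_kernelD(1)[OF b[OF q]] unit_kernelD(1)[OF D]
  let ?h = "\<lambda>x y. f x * g y * (a q x y - b q x y)"
  have le': "\<bar>?h x y\<bar> \<le> D x y" if "x \<in> space M" "y \<in> space M" for x y
  proof -
    have "\<bar>?h x y\<bar> \<le> 1 * \<bar>a q x y - b q x y\<bar>"
      unfolding abs_mult using f[of x] g[of y] by (intro mult_right_mono mult_le_one) auto
    also have "\<dots> \<le> D x y" using le[OF q that] by simp
    finally show ?thesis .
  qed
  have D_int: "integrable M (D x)" if "x \<in> space M" for x
    using unit_kernelD[OF D] that by (intro integrable_unit_interval) auto
  have DD_int: "integrable M (\<lambda>x. \<integral>y. D x y \<partial>M)"
    using unit_kernelD[OF D] D_int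
    by (intro integrable_unit_interval) (auto intro!: integral_le_const AE_I2 integral_nonneg_AE)
  have inner: "\<bar>\<integral>y. ?h x y \<partial>M\<bar> \<le> (\<integral>y. D x y \<partial>M)" if "x \<in> space M" for x
    using D_int[OF that] le'[OF that] by (intro abs_integral_le_integral) auto
  show "\<bar>\<integral>x. (\<integral>y. ?h x y \<partial>M) \<partial>M\<bar> \<le> (\<integral>x. (\<integral>y. D x y \<partial>M) \<partial>M)"
    using DD_int inner by (rule abs_integral_le_integral)
qed

text \<open>
  If the kernels depend on their arguments only through a label with finitely many values, the integral
  is a polynomial in the probabilities of the labels and in the values of the kernels. This is how
  densities are carried over from finite graphs to the unit square.
\<close>

lemma (in prob_space) pair_integral_step:
  assumes \<kappa>: "\<kappa> \<in> measurable M (count_space UNIV)" and C: "finite C" "\<And>x. x \<in> space M \<Longrightarrow> \<kappa> x \<in> C"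
  shows "pair_integral k M (\<lambda>q x y. a q (\<kappa> x) (\<kappa> y)) =
    (\<Sum>c\<in>PiE {1..k} (\<lambda>_. C). (\<Prod>i\<in>{1..k}. measure M {x\<in>space M. \<kappa> x = c i}) *
       (\<Prod>q\<in>vertex_pairs k. a q (c (fst q)) (c (snd q))))"
proof -
  interpret P: product_sigma_finite "\<lambda>_::nat. M"
    by standard
  let ?P = "Pi\<^sub>M {1..k} (\<lambda>_::nat. M)" and ?E = "PiE {1..k} (\<lambda>_. C)"
  let ?A = "\<lambda>c::nat \<Rightarrow> 'b. \<Prod>q\<in>vertex_pairs k. a q (c (fst q)) (c (snd q))"
  let ?I = "\<lambda>c v. \<Prod>i\<in>{1..k}. indicat_real {x\<in>space M. \<kappa> x = c i} (v i)"
  have E: "finite ?E" using C by (intro finite_PiE) auto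
  have [measurable]: "{x\<in>space M. \<kappa> x = c} \<in> sets M" for c
    using \<kappa> by measurable
  have int: "integrable M (indicat_real {x\<in>space M. \<kappa> x = c})" for c
    by (intro integrable_unit_interval) (auto simp: indicator_def)
  have "(\<Prod>q\<in>vertex_pairs k. a q (\<kappa> (v (fst q))) (\<kappa> (v (snd q)))) = (\<Sum>c\<in>?E. ?I c v * ?A c)"
    if v: "v \<in> space ?P" for v
  proof -
    define c0 where "c0 = restrict (\<lambda>i. \<kappa> (v i)) {1..k}"
    have vM: "v i \<in> space M" if "i \<in> {1..k}" for i using v that by (auto simp: space_PiM)
    have c0: "c0 \<in> ?E" using vM C by (auto simp: c0_def)
    have "?I c v = of_bool (c = c0)" if "c \<in> ?E" for c
    proof (cases "c = c0")
      case True
      then show ?thesis using vM by (auto simp: c0_def intro!: prod.neutral)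
    next
      case False
      have "c = c0" if "\<And>i. i \<in> {1..k} \<Longrightarrow> c i = c0 i"
        using \<open>c \<in> ?E\<close> c0 that by (rule PiE_ext)
      with False obtain i where "i \<in> {1..k}" "c i \<noteq> c0 i" by blast
      then have "indicat_real {x \<in> space M. \<kappa> x = c i} (v i) = 0"
        by (auto simp: c0_def)
      then show ?thesis using False \<open>i \<in> {1..k}\<close> by (auto intro!: prod_zero)
    qed
    then have "(\<Sum>c\<in>?E. ?I c v * ?A c) = (\<Sum>c\<in>?E. if c = c0 then ?A c else 0)"
      by (intro sum.cong) auto
    also have "\<dots> = ?A c0" using c0 E by simp
    also have "\<dots> = (\<Prod>q\<in>vertex_pairs k. a q (\<kappa> (v (fst q))) (\<kappa> (v (snd q))))"
      by (intro prod.cong) (auto simp: c0_def vertex_pairs_def)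
    finally show ?thesis by simp
  qed
  then have "pair_integral k M (\<lambda>q x y. a q (\<kappa> x) (\<kappa> y)) = (\<integral>v. (\<Sum>c\<in>?E. ?I c v * ?A c) \<partial>?P)"
    unfolding pair_integral_def by (intro Bochner_Integration.integral_cong) auto
  also have "\<dots> = (\<Sum>c\<in>?E. (\<integral>v. ?I c v \<partial>?P) * ?A c)"
    using int by (subst Bochner_Integration.integral_sum) (auto intro!: P.product_integrable_prod)
  also have "\<dots> = (\<Sum>c\<in>?E. (\<Prod>i\<in>{1..k}. measure M {x\<in>space M. \<kappa> x = c i}) * ?A c)"
    using int
    by (intro sum.cong refl arg_cong2[where f="(*)"])
       (subst P.product_integral_prod, auto intro!: prod.cong)
  finally show ?thesis .
qed

section \<open>Energy of vertex partitions\<close>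

definition cell :: "'a set \<Rightarrow> ('a \<Rightarrow> 'c) \<Rightarrow> 'c \<Rightarrow> 'a set" where
  "cell V \<kappa> c = {x \<in> V. \<kappa> x = c}"

definition cell_mass :: "'a set \<Rightarrow> ('a \<Rightarrow> 'c) \<Rightarrow> 'c \<Rightarrow> real" where
  "cell_mass V \<kappa> c = card (cell V \<kappa> c) / card V"

text \<open>
  The value is 0 if one of the two cells is empty.
\<close>

definition cell_average :: "'a set \<Rightarrow> ('a \<Rightarrow> 'c) \<Rightarrow> ('a \<Rightarrow> 'a \<Rightarrow> real) \<Rightarrow> 'c \<Rightarrow> 'c \<Rightarrow> real" where
  "cell_average V \<kappa> g c d =
     (\<Sum>x\<in>cell V \<kappa> c. \<Sum>y\<in>cell V \<kappa> d. g x y) / (card (cell V \<kappa> c) * card (cell V \<kappa> d))"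

text \<open>
  The squared L2 norm of the step function that replaces \<open>g\<close> by its averages over pairs of cells.
\<close>

definition energy :: "'a set \<Rightarrow> ('a \<Rightarrow> 'c) \<Rightarrow> ('a \<Rightarrow> 'a \<Rightarrow> real) \<Rightarrow> real" where
  "energy V \<kappa> g = (\<Sum>x\<in>V. \<Sum>y\<in>V. (cell_average V \<kappa> g (\<kappa> x) (\<kappa> y))\<^sup>2) / (card V)\<^sup>2"

lemma finite_cell [simp, intro]: "finite V \<Longrightarrow> finite (cell V \<kappa> c)"
  by (simp add: cell_def)

lemma sum_cells:
  assumes "finite V"
  shows "(\<Sum>x\<in>V. f x) = (\<Sum>c\<in>\<kappa> ` V. \<Sum>x\<in>cell V \<kappa> c. f x)"
  unfolding cell_def by (rule sum.image_gen[OF assms])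

lemma card_mult_cell_average:
  assumes "finite V"
  shows "real (card (cell V \<kappa> c)) * real (card (cell V \<kappa> d)) * cell_average V \<kappa> g c d =
    (\<Sum>x\<in>cell V \<kappa> c. \<Sum>y\<in>cell V \<kappa> d. g x y)"
proof (cases "card (cell V \<kappa> c) = 0 \<or> card (cell V \<kappa> d) = 0")
  case True
  then have "cell V \<kappa> c = {} \<or> cell V \<kappa> d = {}" using assms by auto
  then show ?thesis by auto
qed (simp add: cell_average_def)

lemma cell_average_bounds:
  assumes "finite V" and g: "\<And>x y. g x y \<in> {0..1}"
  shows "0 \<le> cell_average V \<kappa> g c d" "cell_average V \<kappa> g c d \<le> 1"
proof -
  have "(\<Sum>x\<in>cell V \<kappa> c. \<Sum>y\<in>cell V \<kappa> d. g x y) \<le> (\<Sum>x\<in>cell V \<kappa> c. \<Sum>y\<in>cell V \<kappa> d. 1)"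
    using g by (intro sum_mono) auto
  then show "cell_average V \<kappa> g c d \<le> 1"
    unfolding cell_average_def by (intro divide_le_eq_1[THEN iffD2]) (auto simp: zero_less_mult_iff)
  show "0 \<le> cell_average V \<kappa> g c d"
    unfolding cell_average_def using g by (intro divide_nonneg_nonneg sum_nonneg) auto
qed

lemma cell_average_sym:
  assumes "\<And>x y. x \<in> V \<Longrightarrow> y \<in> V \<Longrightarrow> g x y = g y x"
  shows "cell_average V \<kappa> g c d = cell_average V \<kappa> g d c"
proof -
  have "(\<Sum>x\<in>cell V \<kappa> c. \<Sum>y\<in>cell V \<kappa> d. g x y) = (\<Sum>x\<in>cell V \<kappa> c. \<Sum>y\<in>cell V \<kappa> d. g y x)"
    by (intro sum.cong assms) (auto simp: cell_def)
  also have "\<dots> = (\<Sum>y\<in>cell V \<kappa> d. \<Sum>x\<in>cell V \<kappa> c. g y x)"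
    by (rule sum.swap)
  finally show ?thesis by (simp add: cell_average_def mult.commute)
qed

text \<open>
  The deviation of \<open>g\<close> from its averages is orthogonal to every function of the two labels, because it
  sums to 0 over each pair of cells.
\<close>

lemma sum_mult_deviation_eq_0:
  assumes "finite V"
  shows "(\<Sum>x\<in>V. \<Sum>y\<in>V. h (\<kappa> x) (\<kappa> y) * (g x y - cell_average V \<kappa> g (\<kappa> x) (\<kappa> y))) = 0"
proof -
  let ?A = "cell_average V \<kappa> g"
  have "(\<Sum>x\<in>V. \<Sum>y\<in>V. h (\<kappa> x) (\<kappa> y) * (g x y - ?A (\<kappa> x) (\<kappa> y))) =
      (\<Sum>c\<in>\<kappa> ` V. \<Sum>x\<in>cell V \<kappa> c. \<Sum>d\<in>\<kappa> ` V. \<Sum>y\<in>cell V \<kappa> d.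
         h (\<kappa> x) (\<kappa> y) * (g x y - ?A (\<kappa> x) (\<kappa> y)))"
    by (subst sum_cells[OF assms, of _ \<kappa>], subst sum_cells[OF assms, of _ \<kappa>]) simp
  also have "\<dots> = (\<Sum>c\<in>\<kappa> ` V. \<Sum>x\<in>cell V \<kappa> c. \<Sum>d\<in>\<kappa> ` V. \<Sum>y\<in>cell V \<kappa> d. h c d * (g x y - ?A c d))"
    by (intro sum.cong refl) (auto simp: cell_def)
  also have "\<dots> = (\<Sum>c\<in>\<kappa> ` V. \<Sum>d\<in>\<kappa> ` V. \<Sum>x\<in>cell V \<kappa> c. \<Sum>y\<in>cell V \<kappa> d. h c d * (g x y - ?A c d))"
    by (intro sum.cong refl sum.swap)
  also have "\<dots> = (\<Sum>c\<in>\<kappa> ` V. \<Sum>d\<in>\<kappa> ` V. h c d *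
      ((\<Sum>x\<in>cell V \<kappa> c. \<Sum>y\<in>cell V \<kappa> d. g x y) - card (cell V \<kappa> c) * card (cell V \<kappa> d) * ?A c d))"
    by (intro sum.cong refl) (simp add: sum_distrib_left[symmetric] sum_subtractf)
  also have "\<dots> = 0"
    by (simp add: card_mult_cell_average[OF assms])
  finally show ?thesis .
qed

text \<open>
  Pythagoras: the averages over the coarse cells are the orthogonal projection of the averages over the
  fine ones.
\<close>

lemma sum_sq_refinement:
  fixes \<kappa>' :: "'a \<Rightarrow> 'd" and \<kappa> :: "'a \<Rightarrow> 'c"
  assumes "finite V" and \<rho>: "\<And>x. x \<in> V \<Longrightarrow> \<kappa> x = \<rho> (\<kappa>' x)"
  shows "(\<Sum>x\<in>V. \<Sum>y\<in>V. (cell_average V \<kappa>' g (\<kappa>' x) (\<kappa>' y) - cell_average V \<kappa> g (\<kappa> x) (\<kappa> y))\<^sup>2)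
    = (card V)\<^sup>2 * (energy V \<kappa>' g - energy V \<kappa> g)"
proof (cases "card V = 0")
  case True
  then show ?thesis using assms(1) by simp
next
  case False
  define A where "A x y = cell_average V \<kappa> g (\<kappa> x) (\<kappa> y)" for x y
  define B where "B x y = cell_average V \<kappa>' g (\<kappa>' x) (\<kappa>' y)" for x y
  have "(\<Sum>x\<in>V. \<Sum>y\<in>V. A x y * (g x y - B x y)) =
      (\<Sum>x\<in>V. \<Sum>y\<in>V. cell_average V \<kappa> g (\<rho> (\<kappa>' x)) (\<rho> (\<kappa>' y)) * (g x y - B x y))"
    by (intro sum.cong refl) (simp add: A_def \<rho>)
  also have "\<dots> = 0"
    unfolding B_def by (rule sum_mult_deviation_eq_0[OF assms(1)])
  finally have 1: "(\<Sum>x\<in>V. \<Sum>y\<in>V. A x y * (g x y - B x y)) = 0" .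
  have 2: "(\<Sum>x\<in>V. \<Sum>y\<in>V. A x y * (g x y - A x y)) = 0"
    unfolding A_def by (rule sum_mult_deviation_eq_0[OF assms(1)])
  have "(\<Sum>x\<in>V. \<Sum>y\<in>V. (B x y - A x y)\<^sup>2) =
      (\<Sum>x\<in>V. \<Sum>y\<in>V. (B x y)\<^sup>2 - (A x y)\<^sup>2 +
         2 * (A x y * (g x y - B x y)) - 2 * (A x y * (g x y - A x y)))"
    by (intro sum.cong refl) algebra
  also have "\<dots> = (\<Sum>x\<in>V. \<Sum>y\<in>V. (B x y)\<^sup>2) - (\<Sum>x\<in>V. \<Sum>y\<in>V. (A x y)\<^sup>2)"
    using 1 2 by (simp add: sum_subtractf sum.distrib sum_distrib_left[symmetric])
  also have "\<dots> = (card V)\<^sup>2 * (energy V \<kappa>' g - energy V \<kappa> g)"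
    using False by (simp add: energy_def A_def B_def field_simps)
  finally show ?thesis by (simp add: A_def B_def)
qed

text \<open>
  The rectangle is a union of pairs of fine cells, so on it \<open>g\<close> has the same sum as its averages over
  fine cells. The Cauchy-Schwarz inequality then compares the fine averages with the coarse ones.
\<close>

lemma rectangle_deviation_le_energy_increment:
  fixes \<kappa>' :: "'a \<Rightarrow> 'd" and \<kappa> :: "'a \<Rightarrow> 'c"
  assumes V: "finite V" and \<rho>: "\<And>x. x \<in> V \<Longrightarrow> \<kappa> x = \<rho> (\<kappa>' x)"
    and S: "S \<subseteq> V" "\<And>x. x \<in> V \<Longrightarrow> x \<in> S \<longleftrightarrow> \<sigma> (\<kappa>' x)"
    and T: "T \<subseteq> V" "\<And>x. x \<in> V \<Longrightarrow> x \<in> T \<longleftrightarrow> \<tau> (\<kappa>' x)"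
  shows "(\<Sum>x\<in>S. \<Sum>y\<in>T. g x y - cell_average V \<kappa> g (\<kappa> x) (\<kappa> y))\<^sup>2
    \<le> (card V)^4 * (energy V \<kappa>' g - energy V \<kappa> g)"
proof -
  define A where "A x y = cell_average V \<kappa> g (\<kappa> x) (\<kappa> y)" for x y
  define B where "B x y = cell_average V \<kappa>' g (\<kappa>' x) (\<kappa>' y)" for x y
  have rect: "(\<Sum>x\<in>S. \<Sum>y\<in>T. f x y) = (\<Sum>x\<in>V. \<Sum>y\<in>V. of_bool (\<sigma> (\<kappa>' x) \<and> \<tau> (\<kappa>' y)) * f x y)"
    for f :: "'a \<Rightarrow> 'a \<Rightarrow> real"
  proof -
    have "(\<Sum>x\<in>V. \<Sum>y\<in>V. of_bool (\<sigma> (\<kappa>' x) \<and> \<tau> (\<kappa>' y)) * f x y) =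
        (\<Sum>x\<in>V. \<Sum>y\<in>V. if x \<in> S then if y \<in> T then f x y else 0 else 0)"
      using S(2) T(2) by (intro sum.cong refl) auto
    also have "\<dots> = (\<Sum>x\<in>V. if x \<in> S then \<Sum>y\<in>V. if y \<in> T then f x y else 0 else 0)"
      by (intro sum.cong refl) auto
    also have "\<dots> = (\<Sum>x\<in>S. \<Sum>y\<in>T. f x y)"
      using S(1) T(1) V by (simp add: sum.If_cases Int_absorb1)
    finally show ?thesis by simp
  qed
  have "(\<Sum>x\<in>S. \<Sum>y\<in>T. g x y - B x y) = 0"
    unfolding rect B_def
    by (rule sum_mult_deviation_eq_0[OF V, where h="\<lambda>c d. of_bool (\<sigma> c \<and> \<tau> d)"])
  then have "(\<Sum>x\<in>S. \<Sum>y\<in>T. g x y - A x y) = (\<Sum>x\<in>S. \<Sum>y\<in>T. B x y - A x y)"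
    by (simp add: sum_subtractf)
  also have "\<dots> = (\<Sum>(x, y)\<in>S \<times> T. B x y - A x y)"
    by (simp add: sum.cartesian_product)
  finally have "(\<Sum>x\<in>S. \<Sum>y\<in>T. g x y - A x y)\<^sup>2 = (\<Sum>(x, y)\<in>S \<times> T. B x y - A x y)\<^sup>2"
    by simp
  also have "\<dots> \<le> (\<Sum>(x, y)\<in>S \<times> T. (B x y - A x y)\<^sup>2) * card (S \<times> T)"
    using sum_squared_le_sum_of_squares[of "\<lambda>(x, y). B x y - A x y" "S \<times> T"]
    by (simp add: case_prod_beta')
  also have "\<dots> \<le> (\<Sum>(x, y)\<in>V \<times> V. (B x y - A x y)\<^sup>2) * (card V)\<^sup>2"
  proof (intro mult_mono)
    show "(\<Sum>(x, y)\<in>S \<times> T. (B x y - A x y)\<^sup>2) \<le> (\<Sum>(x, y)\<in>V \<times> V. (B x y - A x y)\<^sup>2)"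
      using S T V by (intro sum_mono2) auto
    have "card (S \<times> T) \<le> card (V \<times> V)" using S T V by (intro card_mono) auto
    then show "real (card (S \<times> T)) \<le> (card V)\<^sup>2"
      by (simp add: card_cartesian_product power2_eq_square flip: of_nat_mult)
  qed (auto intro!: sum_nonneg)
  also have "(\<Sum>(x, y)\<in>V \<times> V. (B x y - A x y)\<^sup>2) = (card V)\<^sup>2 * (energy V \<kappa>' g - energy V \<kappa> g)"
    using sum_sq_refinement[where \<kappa>=\<kappa> and \<kappa>'=\<kappa>' and \<rho>=\<rho> and g=g, OF V \<rho>] by (simp add: A_def B_def sum.cartesian_product)
  finally show ?thesis
    by (simp add: A_def power2_eq_square power4_eq_xxxx algebra_simps)
qed

text \<open>
  The largest value of the left-hand side is the cut norm of the deviation of \<open>g\<close> from its averages over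
  the cells of \<open>\<kappa>\<close>.
\<close>

definition energy_controls_cut ::
    "'a set \<Rightarrow> ('a \<Rightarrow> 'a \<Rightarrow> real) \<Rightarrow> ('a \<Rightarrow> 'c) \<Rightarrow> ('a \<Rightarrow> 'd) \<Rightarrow> bool" where
  "energy_controls_cut V g \<kappa> \<kappa>' \<longleftrightarrow> (\<forall>S T. S \<subseteq> V \<longrightarrow> T \<subseteq> V \<longrightarrow>
     \<bar>\<Sum>x\<in>S. \<Sum>y\<in>T. g x y - cell_average V \<kappa> g (\<kappa> x) (\<kappa> y)\<bar>
       \<le> (real (card V))\<^sup>2 * sqrt (energy V \<kappa>' g - energy V \<kappa> g))"

text \<open>
  Each step appends a base 4 digit to the labels. Its two bits record membership in the sides \<open>S\<close> and
  \<open>T\<close> of a rectangle on which the deviation from the current averages is maximal. The preceding lemma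
  bounds the deviation on this rectangle, and by maximality it bounds the deviation on all rectangles.
\<close>

lemma greedy_label_sequence:
  fixes col :: "nat \<Rightarrow> 'a \<Rightarrow> nat" and g :: "'a \<Rightarrow> 'a \<Rightarrow> real"
  assumes V: "finite V" and col: "\<And>m x. x \<in> V \<Longrightarrow> col m x = col (Suc m) x div 4"
  shows "\<exists>z :: nat \<Rightarrow> 'a \<Rightarrow> nat. (\<forall>x. z 0 x = 0) \<and> (\<forall>m x. z m x = z (Suc m) x div 4) \<and>
    (\<forall>m. energy_controls_cut V g (\<lambda>x. (col m x, z m x)) (\<lambda>x. (col (Suc m) x, z (Suc m) x)))"
proof -
  let ?cut = "\<lambda>m \<zeta> \<zeta>'. energy_controls_cut V g (\<lambda>x. (col m x, \<zeta> x)) (\<lambda>x. (col (Suc m) x, \<zeta>' x))"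
  have "\<exists>z :: nat \<Rightarrow> 'a \<Rightarrow> nat. \<forall>m. (m = 0 \<longrightarrow> z m = (\<lambda>_. 0)) \<and>
      ((\<forall>x. z m x = z (Suc m) x div 4) \<and> ?cut m (z m) (z (Suc m)))"
  proof (rule dependent_nat_choice)
    fix \<zeta> :: "'a \<Rightarrow> nat" and m
    define dev where "dev S T = \<bar>\<Sum>x\<in>S. \<Sum>y\<in>T. g x y -
        cell_average V (\<lambda>x. (col m x, \<zeta> x)) g (col m x, \<zeta> x) (col m y, \<zeta> y)\<bar>" for S T
    let ?D = "(\<lambda>(S, T). dev S T) ` (Pow V \<times> Pow V)"
    have fin: "finite ?D" "?D \<noteq> {}" using V by auto
    obtain p where "p \<in> Pow V \<times> Pow V" "Max ?D = (\<lambda>(S, T). dev S T) p"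
      using Max_in[OF fin] by blast
    then obtain S T where ST: "S \<subseteq> V" "T \<subseteq> V" "Max ?D = dev S T"
      by (cases p) auto
    have max: "dev S' T' \<le> dev S T" if "S' \<subseteq> V" "T' \<subseteq> V" for S' T'
      unfolding ST(3)[symmetric] using that fin by (intro Max_ge) auto
    define r where "r x = 2 * of_bool (x \<in> S) + (of_bool (x \<in> T) :: nat)" for x
    define \<zeta>' where "\<zeta>' x = 4 * \<zeta> x + r x" for x
    have "r x < 4" for x by (simp add: r_def)
    then have div: "\<zeta>' x div 4 = \<zeta> x" and mod: "\<zeta>' x mod 4 = r x" for x
      by (simp_all add: \<zeta>'_def)
    \<comment> \<open>The first bit of the digit \<open>r x\<close> stands for \<open>S\<close>, the second one for \<open>T\<close>.\<close>
    have r: "x \<in> S \<longleftrightarrow> r x \<in> {2, 3}" "x \<in> T \<longleftrightarrow> r x \<in> {1, 3}" for x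
      by (auto simp: r_def)
    let ?e = "energy V (\<lambda>x. (col (Suc m) x, \<zeta>' x)) g - energy V (\<lambda>x. (col m x, \<zeta> x)) g"
    have "(dev S T)\<^sup>2 \<le> (card V)^4 * ?e"
      unfolding dev_def power2_abs
    proof (rule rectangle_deviation_le_energy_increment[OF V])
      show "(col m x, \<zeta> x) = (\<lambda>(d, e). (d div 4, e div 4)) (col (Suc m) x, \<zeta>' x)" if "x \<in> V" for x
        by (simp add: div flip: col[OF that])
      show "x \<in> S \<longleftrightarrow> (\<lambda>(d, e). e mod 4 \<in> {2, 3}) (col (Suc m) x, \<zeta>' x)" for x
        using mod r(1) by simp
      show "x \<in> T \<longleftrightarrow> (\<lambda>(d, e). e mod 4 \<in> {1, 3}) (col (Suc m) x, \<zeta>' x)" for x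
        using mod r(2) by simp
    qed (use ST in auto)
    then have "dev S T \<le> sqrt ((card V)^4 * ?e)"
      by (rule real_le_rsqrt)
    also have "\<dots> = sqrt (real (card V) ^ 4) * sqrt ?e" by (simp add: real_sqrt_mult)
    also have "sqrt (real (card V) ^ 4) = (real (card V))\<^sup>2"
      by (rule real_sqrt_unique) (simp_all flip: power_mult)
    finally have "dev S' T' \<le> (real (card V))\<^sup>2 * sqrt ?e" if "S' \<subseteq> V" "T' \<subseteq> V" for S' T'
      using max[OF that] by (rule order_trans[rotated])
    then have "?cut m \<zeta> \<zeta>'"
      unfolding energy_controls_cut_def dev_def by blast
    then show "\<exists>\<zeta>'. (Suc m = 0 \<longrightarrow> \<zeta>' = (\<lambda>_. 0)) \<and> ((\<forall>x. \<zeta> x = \<zeta>' x div 4) \<and> ?cut m \<zeta> \<zeta>')"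
      by (intro exI[of _ \<zeta>'] conjI allI div[symmetric]) simp_all
  qed auto
  then obtain z :: "nat \<Rightarrow> 'a \<Rightarrow> nat" where z: "\<forall>m. (m = 0 \<longrightarrow> z m = (\<lambda>_. 0)) \<and>
      ((\<forall>x. z m x = z (Suc m) x div 4) \<and> ?cut m (z m) (z (Suc m)))"
    by (elim exE)
  have "z 0 = (\<lambda>_. 0)" using z by blast
  then have "\<forall>x. z 0 x = 0" by (simp only: simp_thms)
  then show ?thesis using z by blast
qed

lemma sum_cell_refinement:
  assumes V: "finite V" and \<rho>: "\<And>x. x \<in> V \<Longrightarrow> \<kappa> x = \<rho> (\<kappa>' x)"
    and C: "finite C" "\<And>x. x \<in> V \<Longrightarrow> \<kappa>' x \<in> C"
  shows "(\<Sum>x\<in>cell V \<kappa> c. f x) = (\<Sum>c'\<in>{c'\<in>C. \<rho> c' = c}. \<Sum>x\<in>cell V \<kappa>' c'. f x)"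
proof -
  have "(\<Sum>c'\<in>{c'\<in>C. \<rho> c' = c}. \<Sum>x\<in>{x\<in>cell V \<kappa> c. \<kappa>' x = c'}. f x) = (\<Sum>x\<in>cell V \<kappa> c. f x)"
    using V C \<rho> by (intro sum.group) (auto simp: cell_def)
  moreover have "{x\<in>cell V \<kappa> c. \<kappa>' x = c'} = cell V \<kappa>' c'" if "\<rho> c' = c" for c'
    using that \<rho> by (auto simp: cell_def)
  ultimately show ?thesis by simp
qed

lemma cell_mass_refinement:
  assumes V: "finite V" and \<rho>: "\<And>x. x \<in> V \<Longrightarrow> \<kappa> x = \<rho> (\<kappa>' x)"
    and C: "finite C" "\<And>x. x \<in> V \<Longrightarrow> \<kappa>' x \<in> C"
  shows "cell_mass V \<kappa> c = (\<Sum>c'\<in>{c'\<in>C. \<rho> c' = c}. cell_mass V \<kappa>' c')"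
  using sum_cell_refinement[where \<kappa>=\<kappa> and \<kappa>'=\<kappa>' and \<rho>=\<rho>, OF assms, where c=c and f="\<lambda>_. 1 :: real"]
  by (simp add: cell_mass_def sum_divide_distrib[symmetric])

lemma mass_average_eq:
  assumes "finite V"
  shows "cell_mass V \<kappa> c * cell_mass V \<kappa> d * cell_average V \<kappa> g c d =
     (\<Sum>x\<in>cell V \<kappa> c. \<Sum>y\<in>cell V \<kappa> d. g x y) / (card V)\<^sup>2"
  unfolding card_mult_cell_average[OF assms, symmetric] by (simp add: cell_mass_def power2_eq_square)

lemma mass_average_refinement:
  assumes V: "finite V" and \<rho>: "\<And>x. x \<in> V \<Longrightarrow> \<kappa> x = \<rho> (\<kappa>' x)"
    and C: "finite C" "\<And>x. x \<in> V \<Longrightarrow> \<kappa>' x \<in> C"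
  shows "cell_mass V \<kappa> c * cell_mass V \<kappa> d * cell_average V \<kappa> g c d =
    (\<Sum>c'\<in>{c'\<in>C. \<rho> c' = c}. \<Sum>d'\<in>{d'\<in>C. \<rho> d' = d}.
       cell_mass V \<kappa>' c' * cell_mass V \<kappa>' d' * cell_average V \<kappa>' g c' d')"
proof -
  have "(\<Sum>x\<in>cell V \<kappa> c. \<Sum>y\<in>cell V \<kappa> d. g x y) =
     (\<Sum>c'\<in>{c'\<in>C. \<rho> c' = c}. \<Sum>x\<in>cell V \<kappa>' c'. \<Sum>d'\<in>{d'\<in>C. \<rho> d' = d}. \<Sum>y\<in>cell V \<kappa>' d'. g x y)"
    by (simp add: sum_cell_refinement[where \<kappa>=\<kappa> and \<kappa>'=\<kappa>' and \<rho>=\<rho>, OF assms])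
  also have "\<dots> = (\<Sum>c'\<in>{c'\<in>C. \<rho> c' = c}. \<Sum>d'\<in>{d'\<in>C. \<rho> d' = d}. \<Sum>x\<in>cell V \<kappa>' c'. \<Sum>y\<in>cell V \<kappa>' d'. g x y)"
    by (intro sum.cong refl sum.swap)
  finally show ?thesis
    by (simp add: mass_average_eq[OF V] sum_divide_distrib)
qed

lemma energy_bounds:
  assumes V: "finite V" and g: "\<And>x y. g x y \<in> {0..1}"
  shows "0 \<le> energy V \<kappa> g" "energy V \<kappa> g \<le> 1"
proof -
  show "0 \<le> energy V \<kappa> g"
    unfolding energy_def by (intro divide_nonneg_nonneg sum_nonneg) auto
  have "(\<Sum>x\<in>V. \<Sum>y\<in>V. (cell_average V \<kappa> g (\<kappa> x) (\<kappa> y))\<^sup>2) \<le> (\<Sum>x\<in>V. \<Sum>y\<in>V. 1)"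
    using cell_average_bounds[OF assms] by (intro sum_mono power_le_one)
  then show "energy V \<kappa> g \<le> 1"
    unfolding energy_def by (intro divide_le_eq_1[THEN iffD2]) (auto simp: power2_eq_square zero_less_mult_iff)
qed

text \<open>
  A bilinear form on functions with values in the unit interval attains its maximum at indicator
  functions: first \<open>f\<close> and then \<open>g\<close> is replaced by the indicator of the set where its coefficient is
  positive. Applied to \<open>D\<close> and to \<open>- D\<close> this bounds the absolute value.
\<close>

lemma abs_sum_weighted_le_cut:
  fixes D :: "'a \<Rightarrow> 'a \<Rightarrow> real"
  assumes V: "finite V" and f: "\<And>x. f x \<in> {0..1}" and g: "\<And>x. g x \<in> {0..1}"
    and cut: "\<And>S T. S \<subseteq> V \<Longrightarrow> T \<subseteq> V \<Longrightarrow> \<bar>\<Sum>x\<in>S. \<Sum>y\<in>T. D x y\<bar> \<le> \<delta>"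
  shows "\<bar>\<Sum>x\<in>V. \<Sum>y\<in>V. f x * g y * D x y\<bar> \<le> \<delta>"
proof -
  have lin: "(\<Sum>x\<in>V. h x * \<phi> x) \<le> (\<Sum>x\<in>{x\<in>V. \<phi> x > 0}. \<phi> x)" if "\<And>x. h x \<in> {0..1}" for h \<phi> :: "'a \<Rightarrow> real"
  proof -
    have "(\<Sum>x\<in>V. h x * \<phi> x) \<le> (\<Sum>x\<in>V. if \<phi> x > 0 then \<phi> x else 0)"
    proof (intro sum_mono)
      fix x show "h x * \<phi> x \<le> (if \<phi> x > 0 then \<phi> x else 0)"
        using that[of x] mult_right_mono[of "h x" 1 "\<phi> x"] by (auto simp: mult_le_0_iff)
    qed
    then show ?thesis using V by (simp add: sum.If_cases Int_def)
  qed
  have le: "(\<Sum>x\<in>V. \<Sum>y\<in>V. f x * g y * E x y) \<le> \<delta>"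
    if E: "\<And>S T. S \<subseteq> V \<Longrightarrow> T \<subseteq> V \<Longrightarrow> (\<Sum>x\<in>S. \<Sum>y\<in>T. E x y) \<le> \<delta>" for E
  proof -
    have "(\<Sum>x\<in>V. \<Sum>y\<in>V. f x * g y * E x y) = (\<Sum>x\<in>V. f x * (\<Sum>y\<in>V. g y * E x y))"
      by (simp add: sum_distrib_left mult.assoc)
    also have "\<dots> \<le> (\<Sum>x\<in>{x\<in>V. (\<Sum>y\<in>V. g y * E x y) > 0}. \<Sum>y\<in>V. g y * E x y)" (is "_ \<le> (\<Sum>x\<in>?S. _)")
      by (rule lin[OF f])
    also have "\<dots> = (\<Sum>y\<in>V. g y * (\<Sum>x\<in>?S. E x y))"
      by (subst sum.swap) (simp add: sum_distrib_left)
    also have "\<dots> \<le> (\<Sum>y\<in>{y\<in>V. (\<Sum>x\<in>?S. E x y) > 0}. \<Sum>x\<in>?S. E x y)"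
      by (rule lin[OF g])
    also have "\<dots> \<le> \<delta>"
      by (subst sum.swap) (rule E, auto)
    finally show ?thesis .
  qed
  have "(\<Sum>x\<in>V. \<Sum>y\<in>V. f x * g y * D x y) \<le> \<delta>"
    using cut by (intro le) (force simp: abs_le_iff)
  moreover have "(\<Sum>x\<in>V. \<Sum>y\<in>V. f x * g y * - D x y) \<le> \<delta>"
    using cut by (intro le) (force simp: abs_le_iff sum_negf)
  ultimately show ?thesis
    by (simp add: abs_le_iff sum_negf)
qed

section \<open>Counting ordered copies\<close>

lemma pmf_replicate_pmf:
  "pmf (replicate_pmf k p) xs = of_bool (length xs = k) * (\<Prod>x\<leftarrow>xs. pmf p x)"
proof (induction k arbitrary: xs)
  case 0
  then show ?case by (auto simp: pmf_return)
next
  case (Suc k)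
  have eq: "replicate_pmf (Suc k) p = map_pmf (\<lambda>(x, xs). x # xs) (pair_pmf p (replicate_pmf k p))"
    by (simp add: pair_pmf_def map_bind_pmf map_pmf_def bind_assoc_pmf bind_return_pmf)
  show ?case
  proof (cases xs)
    case Nil
    have "pmf (replicate_pmf (Suc k) p) [] = 0"
      by (simp add: pmf_eq_0_set_pmf set_replicate_pmf del: replicate_pmf.simps)
    then show ?thesis using Nil by simp
  next
    case (Cons y ys)
    have "pmf (replicate_pmf (Suc k) p) xs = pmf (pair_pmf p (replicate_pmf k p)) (y, ys)"
      unfolding eq Cons by (subst pmf_map_inj'[symmetric, of "\<lambda>(x, xs). x # xs"]) (auto intro!: injI)
    then show ?thesis using Suc.IH[of ys] Cons by (simp add: pmf_pair del: replicate_pmf.simps)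
  qed
qed

lemma prob_replicate_pmf_of_set:
  assumes V: "finite V" "V \<noteq> {}"
  shows "measure_pmf.prob (replicate_pmf k (pmf_of_set V)) A =
     card {xs\<in>A. set xs \<subseteq> V \<and> length xs = k} / real (card V) ^ k"
proof -
  let ?L = "{xs. set xs \<subseteq> V \<and> length xs = k}"
  let ?p = "replicate_pmf k (pmf_of_set V)"
  have fin: "finite ?L" using V by (intro finite_lists_length_eq)
  have "set_pmf ?p = ?L"
    using V by (auto simp: set_replicate_pmf)
  then have "measure_pmf.prob ?p A = measure_pmf.prob ?p (A \<inter> ?L)"
    using measure_Int_set_pmf[of ?p A] by simp
  also have "\<dots> = (\<Sum>xs\<in>A \<inter> ?L. pmf ?p xs)"
    using fin by (intro measure_measure_pmf_finite) auto
  also have "\<dots> = (\<Sum>xs\<in>A \<inter> ?L. (1 / card V) ^ k)"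
  proof (intro sum.cong refl)
    fix xs assume "xs \<in> A \<inter> ?L"
    then have "(\<Prod>x\<leftarrow>xs. pmf (pmf_of_set V) x) = (\<Prod>x\<leftarrow>xs. 1 / real (card V))"
      using V by (intro arg_cong[of _ _ prod_list] map_cong) (auto simp: pmf_of_set)
    then show "pmf ?p xs = (1 / card V) ^ k"
      using \<open>xs \<in> A \<inter> ?L\<close> by (simp add: pmf_replicate_pmf map_replicate_const)
  qed
  also have "\<dots> = card (A \<inter> ?L) / real (card V) ^ k"
    by (simp add: power_one_over)
  also have "A \<inter> ?L = {xs\<in>A. set xs \<subseteq> V \<and> length xs = k}" by auto
  finally show ?thesis .
qed

lemma strict_increasing_list:
  fixes c :: "nat \<Rightarrow> nat"
  assumes "\<And>i j. 1 \<le> i \<Longrightarrow> i < j \<Longrightarrow> j \<le> k \<Longrightarrow> c i < c j"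
  shows "sorted_list_of_set (c ` {1..k}) = map c [1..<Suc k]"
    and "card (c ` {1..k}) = k"
proof -
  have sw: "sorted_wrt (<) (map c [1..<Suc k])"
    using assms by (auto simp: sorted_wrt_iff_nth_less simp del: upt_Suc)
  have "set (map c [1..<Suc k]) = c ` {1..k}"
    by (auto simp del: upt_Suc)
  then show "sorted_list_of_set (c ` {1..k}) = map c [1..<Suc k]"
    using sw by (metis sorted_list_of_set.idem_if_sorted_distinct strict_sorted_iff)
  have "inj_on c {1..k}"
  proof (rule linorder_inj_onI)
    show "c x \<noteq> c y" if "x < y" "x \<in> {1..k}" "y \<in> {1..k}" for x y
      using assms[of x y] that by auto
  qed auto
  then show "card (c ` {1..k}) = k" by (simp add: card_image)
qed

definition increasing_copies :: "ordered_graph \<Rightarrow> ordered_graph \<Rightarrow> (nat \<Rightarrow> nat) set" where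
  "increasing_copies F G =
     {c \<in> {1..nverts F} \<rightarrow>\<^sub>E {1..nverts G}. \<forall>(i, j)\<in>vertex_pairs (nverts F).
        c i < c j \<and> adj F i j = adj G (c i) (c j)}"

text \<open>
  Sorting sends exactly \<open>k!\<close> lists of distinct vertices, namely the permutations, to each increasing
  list.
\<close>

lemma card_distinct_copies:
  "card {xs. (\<forall>i\<in>{1..nverts F}. \<forall>j\<in>{1..nverts F}. i < j \<longrightarrow>
              adj F i j = adj G (sort xs ! (i - 1)) (sort xs ! (j - 1))) \<and>
          set xs \<subseteq> {1..nverts G} \<and> length xs = nverts F \<and> distinct xs} =
   fact (nverts F) * card (increasing_copies F G)" (is "card ?X = _")
proof -
  let ?k = "nverts F" and ?V = "{1..nverts G}" and ?I = "increasing_copies F G"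
  have inc: "c i < c j" if "c \<in> ?I" "1 \<le> i" "i < j" "j \<le> ?k" for c i j
    using that by (auto simp: increasing_copies_def vertex_pairs_def)
  have sorted: "sorted_list_of_set (c ` {1..?k}) = map c [1..<Suc ?k]" "card (c ` {1..?k}) = ?k"
    if "c \<in> ?I" for c
    by (rule strict_increasing_list; rule inc[OF that]; assumption)+
  have sort_eq: "sort xs = sorted_list_of_set (set xs)" if "distinct xs" for xs :: "nat list"
    using that by (simp add: sorted_list_of_set_sort_remdups distinct_remdups_id)
  have "?X = (\<Union>c\<in>?I. permutations_of_set (c ` {1..?k}))"
  proof (intro equalityI subsetI)
    fix xs assume xs: "xs \<in> ?X"
    define c where "c = restrict (\<lambda>i. sort xs ! (i - 1)) {1..?k}"
    have len: "length (sort xs) = ?k" using xs by simp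
    have mem: "sort xs ! (i - 1) \<in> ?V" if "i \<in> {1..?k}" for i
    proof -
      have "sort xs ! (i - 1) \<in> set (sort xs)" using that len by (intro nth_mem) auto
      then show ?thesis using xs by auto
    qed
    have "sorted_wrt (<) (sort xs)" using xs by (simp add: strict_sorted_iff)
    then have "c i < c j" if "(i, j) \<in> vertex_pairs ?k" for i j
      using that len by (auto simp: vertex_pairs_def c_def sorted_wrt_iff_nth_less)
    moreover have "adj F i j = adj G (c i) (c j)" if "(i, j) \<in> vertex_pairs ?k" for i j
      using that xs by (auto simp: vertex_pairs_def c_def)
    moreover have "c \<in> {1..?k} \<rightarrow>\<^sub>E ?V"
      unfolding c_def using mem by (intro restrict_PiE_iff[THEN iffD2]) auto
    ultimately have "c \<in> ?I"
      unfolding increasing_copies_def by blast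
    moreover have "c ` {1..?k} = set xs"
    proof -
      have "c ` {1..?k} = (!) (sort xs) ` ((\<lambda>i. i - 1) ` {1..?k})"
        by (auto simp: c_def image_image)
      also have "(\<lambda>i. i - 1) ` {1..?k} = {..<?k}"
        by (auto simp: image_iff intro!: bexI[of _ "Suc _"])
      also have "(!) (sort xs) ` {..<?k} = set xs"
        using len nth_image[of ?k "sort xs"] by (simp add: atLeast0LessThan[symmetric])
      finally show ?thesis .
    qed
    ultimately show "xs \<in> (\<Union>c\<in>?I. permutations_of_set (c ` {1..?k}))"
      using xs by (auto simp: permutations_of_set_def)
  next
    fix xs assume "xs \<in> (\<Union>c\<in>?I. permutations_of_set (c ` {1..?k}))"
    then obtain c where c: "c \<in> ?I" and xs: "set xs = c ` {1..?k}" "distinct xs"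
      by (auto simp: permutations_of_set_def)
    have sort: "sort xs = map c [1..<Suc ?k]"
      using sort_eq[OF xs(2)] sorted(1)[OF c] xs(1) by simp
    have nth: "sort xs ! (i - 1) = c i" if "i \<in> {1..?k}" for i
      using that unfolding sort by (subst nth_map) (auto simp del: upt_Suc)
    have "length xs = ?k"
      using distinct_card[OF xs(2)] xs(1) sorted(2)[OF c] by simp
    then show "xs \<in> ?X"
      using xs c nth by (auto simp: increasing_copies_def vertex_pairs_def)
  qed
  also have "card \<dots> = (\<Sum>c\<in>?I. card (permutations_of_set (c ` {1..?k})))"
  proof (intro card_UN_disjoint ballI impI)
    show "finite ?I"
      unfolding increasing_copies_def by (intro finite_subset[OF _ finite_PiE[of "{1..?k}" "\<lambda>_. ?V"]]) auto
    fix c d assume cd: "c \<in> ?I" "d \<in> ?I" "c \<noteq> d"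
    have "c = d" if "c ` {1..?k} = d ` {1..?k}"
    proof -
      have "map c [1..<Suc ?k] = map d [1..<Suc ?k]"
        using that sorted(1)[OF cd(1)] sorted(1)[OF cd(2)] by simp
      moreover have "i \<in> set [1..<Suc ?k]" if "i \<in> {1..?k}" for i
        using that by (auto simp del: upt_Suc)
      ultimately have "c i = d i" if "i \<in> {1..?k}" for i
        using that map_eq_conv[of c "[1..<Suc ?k]" d] by blast
      moreover have "c \<in> {1..?k} \<rightarrow>\<^sub>E {1..nverts G}" "d \<in> {1..?k} \<rightarrow>\<^sub>E {1..nverts G}"
        using cd by (auto simp: increasing_copies_def)
      ultimately show ?thesis by (intro PiE_ext)
    qed
    then show "permutations_of_set (c ` {1..?k}) \<inter> permutations_of_set (d ` {1..?k}) = {}"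
      using cd(3) by (auto simp: permutations_of_set_def)
  qed auto
  also have "\<dots> = (\<Sum>c\<in>?I. fact ?k)"
    using sorted(2) by (intro sum.cong refl) (auto simp: card_permutations_of_set)
  finally show ?thesis by simp
qed

text \<open>
  A list of vertices that realises the pattern without coming from an increasing copy contains a
  repetition. The right-hand side is the probability of a repetition.
\<close>

lemma density_graph_approx:
  fixes F G :: ordered_graph
  assumes "nverts G > 0"
  defines "N \<equiv> real (nverts G)" and "k \<equiv> nverts F"
  shows "\<bar>density_graph F G - fact k * (card (increasing_copies F G) / N ^ k)\<bar> \<le>
     1 - (\<Prod>i<k. N - real i) / N ^ k"
proof -
  let ?V = "{1..nverts G}"
  let ?P = "\<lambda>xs. \<forall>i\<in>{1..k}. \<forall>j\<in>{1..k}. i < j \<longrightarrow>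
              adj F i j = adj G (sort xs ! (i - 1)) (sort xs ! (j - 1))"
  let ?L = "{xs. set xs \<subseteq> ?V \<and> length xs = k}"
  let ?X = "{xs. ?P xs \<and> set xs \<subseteq> ?V \<and> length xs = k}"
  let ?Y = "{xs. ?P xs \<and> set xs \<subseteq> ?V \<and> length xs = k \<and> distinct xs}"
  let ?D = "{xs. length xs = k \<and> distinct xs \<and> set xs \<subseteq> ?V}"
  have finL: "finite ?L" by (rule finite_lists_length_eq) simp
  have fin: "finite ?X" "finite ?Y" "finite ?D"
    by (rule finite_subset[OF _ finL], auto)+
  have N: "N > 0" using assms by simp
  have dens: "density_graph F G = card ?X / N ^ k"
    unfolding density_graph_def using assms(1)
    by (subst prob_replicate_pmf_of_set) (auto simp: N_def k_def)
  have Y: "real (card ?Y) = fact k * card (increasing_copies F G)"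
    using card_distinct_copies[of F G] by (simp add: k_def)
  have "card ?X \<le> card ?Y + card (?L - ?D)"
    using fin finL by (intro order_trans[OF _ card_Un_le] card_mono) auto
  moreover have "card ?Y \<le> card ?X" using fin by (intro card_mono) auto
  moreover have "card (?L - ?D) = card ?L - card ?D"
    using fin by (intro card_Diff_subset) auto
  moreover have "card ?D \<le> card ?L" using finL by (intro card_mono) auto
  moreover have "real (card ?L) = N ^ k"
    using card_lists_length_eq[of ?V k] by (simp add: N_def)
  moreover have "(\<Prod>i<k. N - real i) \<le> real (card ?D)"
  proof (cases "k \<le> nverts G")
    case True
    have "real (card ?D) = real (\<Prod>{nverts G - k + 1..nverts G})"
      using card_lists_distinct_length_eq[of ?V k] True by simp
    also have "\<Prod>{nverts G - k + 1..nverts G} = (\<Prod>i<k. nverts G - i)"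
      using True by (intro prod.reindex_bij_witness[of _ "\<lambda>i. nverts G - i" "\<lambda>i. nverts G - i"]) auto
    also have "real \<dots> = (\<Prod>i<k. N - real i)"
      using True by (simp add: N_def of_nat_diff)
    finally show ?thesis by simp
  next
    case False
    then have "nverts G \<in> {..<k}" by auto
    then have "(\<Prod>i<k. N - real i) = 0" by (intro prod_zero) (auto simp: N_def)
    then show ?thesis by (rule ord_eq_le_trans) simp
  qed
  ultimately have "real (card ?Y) \<le> card ?X" "card ?X \<le> card ?Y + (N ^ k - (\<Prod>i<k. N - real i))"
    by linarith+
  then have "\<bar>real (card ?X) - card ?Y\<bar> / N ^ k \<le> (N ^ k - (\<Prod>i<k. N - real i)) / N ^ k"
    using N by (intro divide_right_mono) auto
  also have "\<dots> = 1 - (\<Prod>i<k. N - real i) / N ^ k"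
    using N by (simp add: diff_divide_distrib)
  also have "\<bar>real (card ?X) - card ?Y\<bar> / N ^ k =
      \<bar>density_graph F G - fact k * (card (increasing_copies F G) / N ^ k)\<bar>"
    unfolding dens Y times_divide_eq_right diff_divide_distrib[symmetric] using N by simp
  finally show ?thesis .
qed

lemma tendsto_falling_product:
  assumes "filterlim N at_top F"
  shows "((\<lambda>n. (\<Prod>i<k. N n - real i) / N n ^ k) \<longlongrightarrow> (1::real)) F"
proof -
  have "((\<lambda>n. \<Prod>i<k. (N n - real i) / N n) \<longlongrightarrow> (\<Prod>i<k. 1)) F"
  proof (intro tendsto_prod)
    fix i
    have "((\<lambda>n. 1 - real i / N n) \<longlongrightarrow> 1 - 0) F"
      using assms by (intro tendsto_diff tendsto_const real_tendsto_divide_at_top[OF tendsto_const])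
    moreover have "eventually (\<lambda>n. 1 - real i / N n = (N n - real i) / N n) F"
      using assms filterlim_at_top_dense[of N F] by (auto elim!: eventually_mono[of _ F] allE[of _ 0] simp: field_simps)
    ultimately show "((\<lambda>n. (N n - real i) / N n) \<longlongrightarrow> 1) F"
      by (simp add: filterlim_cong[OF refl refl])
  qed
  then show ?thesis by (simp add: prod_dividef)
qed

lemma uniform_count_measure_simps:
  assumes "finite V" "V \<noteq> {}"
  shows "prob_space (uniform_count_measure V)"
    and "(\<integral>x. f x \<partial>uniform_count_measure V) = (\<Sum>x\<in>V. f x) / card V"
    and "A \<subseteq> V \<Longrightarrow> measure (uniform_count_measure V) A = card A / card V"
  using assms
    apply (auto intro: prob_space_uniform_count_measure simp: measure_uniform_count_measure)
  apply (simp add: uniform_count_measure_def lebesgue_integral_point_measure_finite sum_divide_distrib)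
  done

lemma measurable_uniform_count_measure_pair:
  assumes "finite V"
  shows "h \<in> borel_measurable (uniform_count_measure V \<Otimes>\<^sub>M uniform_count_measure V)"
proof -
  have "h \<in> borel_measurable (count_space V \<Otimes>\<^sub>M count_space V)"
    using assms by (intro measurable_pair_measure_countable1) (auto intro: countable_finite)
  moreover have "sets (uniform_count_measure V \<Otimes>\<^sub>M uniform_count_measure V) = sets (count_space V \<Otimes>\<^sub>M count_space V)"
    by (intro sets_pair_measure_cong) (auto simp: sets_uniform_count_measure)
  ultimately show ?thesis using measurable_cong_sets by blast
qed

section \<open>The unit square and its columns\<close>

definition uniform_interval :: "real measure" where
  "uniform_interval = uniform_measure lborel {0..1}"

definition uniform_square :: "(real \<times> real) measure" where
  "uniform_square = uniform_measure lborel unit_square"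

lemma uniform_interval_simps [simp]:
  "space uniform_interval = UNIV" "sets uniform_interval = sets borel"
  by (simp_all add: uniform_interval_def)

lemma uniform_square_simps [simp]:
  "space uniform_square = UNIV" "sets uniform_square = sets borel"
  by (simp_all add: uniform_square_def)

declare uniform_interval_simps(2) [measurable_cong]

lemma sets_uniform_square_prod [measurable_cong]:
  "sets uniform_square = sets (borel \<Otimes>\<^sub>M borel)"
  unfolding uniform_square_simps(2) borel_prod ..

interpretation U: prob_space uniform_interval
  unfolding uniform_interval_def by (intro prob_space_uniform_measure) auto

lemma uniform_square_eq: "uniform_square = uniform_interval \<Otimes>\<^sub>M uniform_interval"
proof (rule sym, rule pair_measure_eqI)
  show "sigma_finite_measure uniform_interval" "sigma_finite_measure uniform_interval"
    by (rule U.sigma_finite_measure_axioms)+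
  show "sets (uniform_interval \<Otimes>\<^sub>M uniform_interval) = sets uniform_square"
    by (simp add: borel_prod[symmetric] cong: sets_pair_measure_cong)
  fix A B assume AB: "A \<in> sets uniform_interval" "B \<in> sets uniform_interval"
  have times: "emeasure lborel (X \<times> Y) = emeasure lborel X * emeasure lborel Y"
    if "X \<in> sets borel" "Y \<in> sets borel" for X Y :: "real set"
    using that by (subst lborel_prod[symmetric]) (simp add: lborel.emeasure_pair_measure_Times)
  have sq: "emeasure lborel unit_square = 1"
    unfolding unit_square_def by (simp add: times)
  have "unit_square \<inter> A \<times> B = ({0..1} \<inter> A) \<times> ({0..1} \<inter> B)" by (auto simp: unit_square_def)
  then show "emeasure uniform_interval A * emeasure uniform_interval B = emeasure uniform_square (A \<times> B)"
    using AB unfolding uniform_interval_def uniform_square_def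
    by (subst (1 2 3) emeasure_uniform_measure)
       (auto simp: times sq[unfolded unit_square_def] unit_square_def borel_prod[symmetric] divide_ennreal_def)
qed

interpretation SQ: prob_space uniform_square
  unfolding uniform_square_eq by (intro prob_space_pair U.prob_space_axioms)

interpretation UU: pair_prob_space uniform_interval uniform_interval ..

interpretation SS: pair_prob_space uniform_square uniform_square ..

lemma AE_unit_interval: "AE y in uniform_interval. 0 \<le> y \<and> y < 1"
proof -
  have "AE y in lborel. y \<noteq> (1::real)"
    by (rule AE_lborel_singleton)
  then show ?thesis
    unfolding uniform_interval_def by (intro AE_uniform_measureI) (auto elim!: eventually_mono)
qed

lemma AE_unit_square_fst:
  assumes "AE y in uniform_interval. P y"
  shows "AE u in uniform_square. P (fst u)"
proof (rule AE_distrD[where f=fst and M'=uniform_interval and P=P])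
  show "fst \<in> measurable uniform_square uniform_interval" by measurable
  show "AE y in distr uniform_square uniform_interval fst. P y"
    using assms unfolding uniform_square_eq U.distr_pair_fst .
qed

lemma AE_unit_square_snd: "AE u in uniform_square. 0 \<le> snd u \<and> snd u < 1"
proof -
  have "{u \<in> space uniform_square. 0 \<le> snd u \<and> snd u < 1} \<in> sets uniform_square"
    by measurable
  then show ?thesis
    using AE_unit_interval unfolding uniform_square_eq
    by (intro UU.AE_pair_measure) auto
qed

lemma measure_unit_interval_less:
  assumes "0 \<le> g" "g \<le> 1"
  shows "measure uniform_interval {b. b < g} = g"
proof -
  have "{0..1} \<inter> {b. b < g} = (if g = 0 then {} else {0..<g})" using assms by auto
  then show ?thesis unfolding uniform_interval_def using assms by simp
qed

text \<open>column\<close>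

text \<open>
  The unit interval is divided into \<open>4 ^ m\<close> columns of equal width. Points outside are sent to the first
  or the last column, so that the range is finite on the whole real line.
\<close>

definition column :: "nat \<Rightarrow> real \<Rightarrow> nat" where
  "column m y = min (4 ^ m - 1) (nat \<lfloor>4 ^ m * y\<rfloor>)"

lemma column_less: "column m y < 4 ^ m"
  by (simp add: column_def min_less_iff_disj)

lemma column_mono: "x \<le> y \<Longrightarrow> column m x \<le> column m y"
  unfolding column_def by (intro min.mono nat_mono floor_mono mult_left_mono) auto

lemma column_measurable [measurable]: "column m \<in> measurable borel (count_space UNIV)"
proof -
  have "(\<lambda>y::real. \<lfloor>4 ^ m * y\<rfloor>) \<in> measurable borel (count_space UNIV)" by measurable
  then show ?thesis
    unfolding column_def[abs_def] by (rule measurable_compose) simp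
qed

lemma column_eq_iff:
  assumes "0 \<le> y" "y < 1"
  shows "column m y = c \<longleftrightarrow> real c / 4 ^ m \<le> y \<and> y < (real c + 1) / 4 ^ m"
proof -
  have "4 ^ m * y < 4 ^ m" using assms by simp
  then have "\<lfloor>4 ^ m * y\<rfloor> < 4 ^ m" by (simp add: floor_less_iff)
  then have "nat \<lfloor>4 ^ m * y\<rfloor> < 4 ^ m" by (simp add: nat_less_iff)
  then have "column m y = nat \<lfloor>4 ^ m * y\<rfloor>"
    unfolding column_def by (intro min_absorb2) linarith
  also have "\<dots> = c \<longleftrightarrow> \<lfloor>4 ^ m * y\<rfloor> = int c" using assms by auto
  also have "\<dots> \<longleftrightarrow> real c \<le> 4 ^ m * y \<and> 4 ^ m * y < real c + 1" by (simp add: floor_eq_iff)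
  finally show ?thesis by (simp add: field_simps)
qed

lemma column_nested_unit:
  assumes "0 \<le> y" "y < 1" "l \<le> m"
  shows "column l y = column m y div 4 ^ (m - l)"
proof -
  let ?k = "(4::nat) ^ (m - l)"
  define c where "c = column m y"
  have pow: "(4::real) ^ m = 4 ^ l * ?k" using assms(3) by (simp add: power_add[symmetric])
  have c: "real c / 4 ^ m \<le> y" "y < (real c + 1) / 4 ^ m"
    using column_eq_iff[OF assms(1,2)] by (auto simp: c_def)
  have "real (c div ?k * ?k) \<le> real c" by (simp only: of_nat_le_iff) simp
  then have "real (c div ?k) / 4 ^ l \<le> real c / 4 ^ m"
    unfolding pow by (simp add: field_simps)
  moreover have "c + 1 \<le> (c div ?k + 1) * ?k"
    using dividend_less_div_times[of ?k c] by (simp add: algebra_simps)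
  then have "real c + 1 \<le> (real (c div ?k) + 1) * real ?k"
    by (metis (mono_tags) of_nat_1 of_nat_add of_nat_le_iff of_nat_mult)
  then have "(real c + 1) / 4 ^ m \<le> ((real (c div ?k) + 1) * real ?k) / 4 ^ m"
    by (rule divide_right_mono) simp
  then have "(real c + 1) / 4 ^ m \<le> (real (c div ?k) + 1) / 4 ^ l"
    unfolding pow by simp
  ultimately show ?thesis
    using c assms unfolding c_def[symmetric] by (subst column_eq_iff) auto
qed

text \<open>
  Sending outside points to the extreme columns is compatible with refinement.
\<close>

lemma column_nested:
  assumes "l \<le> m"
  shows "column l y = column m y div 4 ^ (m - l)"
proof -
  consider "y < 0" | "0 \<le> y" "y < 1" | "1 \<le> y" by linarith
  then show ?thesis
  proof cases
    case 1
    have "column j y = 0" for j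
    proof -
      have "4 ^ j * y \<le> 0" using 1 by (simp add: mult_le_0_iff)
      then have "nat \<lfloor>4 ^ j * y\<rfloor> = 0" by linarith
      then show ?thesis by (simp add: column_def)
    qed
    then show ?thesis by simp
  next
    case 2
    then show ?thesis using column_nested_unit assms by blast
  next
    case 3
    have top: "column j y = 4 ^ j - 1" for j
    proof -
      have "real (4 ^ j - 1) \<le> 4 ^ j * y"
        by (rule order_trans[OF _ mult_left_mono[OF 3]]) (simp_all add: of_nat_diff)
      then show ?thesis unfolding column_def by (intro min_absorb1) (simp add: le_nat_floor)
    qed
    let ?k = "(4::nat) ^ (m - l)"
    have "((4::nat) ^ m - 1) div ?k = ((4 ^ l - 1) * ?k + (?k - 1)) div ?k"
      using assms by (simp add: diff_mult_distrib power_add[symmetric])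
    also have "\<dots> = 4 ^ l - 1"
    proof -
      have "(q * ?k + (?k - 1)) div ?k = q" for q by (subst div_mult_self3) simp_all
      then show ?thesis .
    qed
    finally show ?thesis unfolding top by (rule sym)
  qed
qed

lemma measure_column:
  assumes "c < 4 ^ m"
  shows "measure uniform_interval {y. column m y = c} = 1 / 4 ^ m"
proof -
  let ?J = "{real c / 4 ^ m ..< (real c + 1) / 4 ^ m}"
  have c: "real c + 1 \<le> 4 ^ m"
    using assms by (metis Suc_eq_plus1 Suc_leI of_nat_1 of_nat_add of_nat_le_iff of_nat_numeral of_nat_power)
  have J: "{0..1} \<inter> ?J = ?J"
  proof -
    have "(real c + 1) / 4 ^ m \<le> 1" "0 \<le> real c / 4 ^ m" using c by auto
    then show ?thesis by (intro Int_absorb1 subsetI) (metis atLeastAtMost_iff atLeastLessThan_iff less_imp_le order_trans)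
  qed
  have "measure uniform_interval {y. column m y = c} = measure uniform_interval ?J"
  proof (rule U.finite_measure_eq_AE)
    show "AE y in uniform_interval. (y \<in> {y. column m y = c}) = (y \<in> ?J)"
      using AE_unit_interval by eventually_elim (simp add: column_eq_iff)
    have "{y \<in> space borel. column m y = c} \<in> sets borel" by measurable
    then show "{y. column m y = c} \<in> sets uniform_interval" by simp
  qed auto
  also have "\<dots> = (real c + 1) / 4 ^ m - real c / 4 ^ m"
    unfolding uniform_interval_def by (subst measure_uniform_measure) (auto simp: J divide_right_mono)
  also have "\<dots> = 1 / 4 ^ m" by (simp add: diff_divide_distrib[symmetric])
  finally show ?thesis .
qed

section \<open>Realising limits of cell masses and densities\<close>

text \<open>
  The addresses of level \<open>m\<close>: a column and a layer, each a number with \<open>m\<close> digits in base 4.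
\<close>

definition grid :: "nat \<Rightarrow> (nat \<times> nat) set" where
  "grid m = {..<4 ^ m} \<times> {..<4 ^ m}"

text \<open>
  Drops the last \<open>k\<close> base 4 digits of both components.
\<close>

definition coarsen :: "nat \<Rightarrow> nat \<times> nat \<Rightarrow> nat \<times> nat" where
  "coarsen k c = (fst c div 4 ^ k, snd c div 4 ^ k)"

lemma finite_grid [simp, intro]: "finite (grid m)"
  by (simp add: grid_def)

lemma div_power_less:
  assumes "c < (4::nat) ^ m" "l \<le> m"
  shows "c div 4 ^ (m - l) < 4 ^ l"
  using assms by (simp add: div_less_iff_less_mult power_add[symmetric])

lemma coarsen_grid: "c \<in> grid m \<Longrightarrow> l \<le> m \<Longrightarrow> coarsen (m - l) c \<in> grid l"
  by (auto simp: grid_def coarsen_def div_power_less)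

text \<open>
  The limits \<open>p\<close> of cell masses and \<open>w\<close> of edge densities between cells, with the relations that they
  inherit from finite graphs: the mass of a cell and the number of edges between two cells are sums over
  subcells, and all columns of a level have the same mass.
\<close>

locale cell_limit =
  fixes p :: "nat \<Rightarrow> nat \<times> nat \<Rightarrow> real"
    and w :: "nat \<Rightarrow> nat \<times> nat \<Rightarrow> nat \<times> nat \<Rightarrow> real"
  assumes p_nonneg: "c \<in> grid m \<Longrightarrow> 0 \<le> p m c"
    and p_coherent: "l \<le> m \<Longrightarrow> c \<in> grid l \<Longrightarrow>
      p l c = (\<Sum>c'\<in>{c'\<in>grid m. coarsen (m - l) c' = c}. p m c')"
    and p_column: "i < 4 ^ m \<Longrightarrow> (\<Sum>t<4 ^ m. p m (i, t)) = 1 / 4 ^ m"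
    and w_bounds: "w m c d \<in> {0..1}"
    and w_sym: "w m c d = w m d c"
    and w_coherent: "l \<le> m \<Longrightarrow> c \<in> grid l \<Longrightarrow> d \<in> grid l \<Longrightarrow>
      p l c * p l d * w l c d =
      (\<Sum>c'\<in>{c'\<in>grid m. coarsen (m - l) c' = c}. \<Sum>d'\<in>{d'\<in>grid m. coarsen (m - l) d' = d}.
         p m c' * p m d' * w m c' d')"
begin

text \<open>
  The proportion of the mass of column \<open>c\<close> that lies in the layers below \<open>n\<close>.
\<close>

definition height :: "nat \<Rightarrow> nat \<Rightarrow> nat \<Rightarrow> real" where
  "height m n c = 4 ^ m * (\<Sum>t<n. p m (c, t))"

text \<open>
  Layer \<open>z\<close> of level \<open>l\<close> begins with layer \<open>z * 4 ^ (m - l)\<close> of level \<open>m\<close>, so the mass of column \<open>c\<close> below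
  this boundary can be computed at either level.
\<close>

lemma sum_strip_refinement:
  assumes "l \<le> m" "z \<le> 4 ^ l" "c < 4 ^ l"
  shows "(\<Sum>c'\<in>{c'\<in>{..<4 ^ m}. c' div 4 ^ (m - l) = c}. \<Sum>t<z * 4 ^ (m - l). p m (c', t)) =
    (\<Sum>t<z. p l (c, t))"
proof -
  let ?k = "(4::nat) ^ (m - l)"
  define A where "A = {x \<in> grid m. fst x div ?k = c \<and> snd x div ?k < z}"
  have "z * ?k \<le> 4 ^ l * ?k" using assms(2) by simp
  also have "4 ^ l * ?k = 4 ^ m" using assms(1) by (simp add: power_add[symmetric])
  finally have zk: "z * ?k \<le> 4 ^ m" .
  have A: "A = {c'\<in>{..<4 ^ m}. c' div ?k = c} \<times> {..<z * ?k}"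
    using zk by (auto simp: A_def grid_def div_less_iff_less_mult)
  have "(\<Sum>t<z. p l (c, t)) = (\<Sum>t<z. \<Sum>x\<in>{x\<in>A. snd x div ?k = t}. p m x)"
  proof (intro sum.cong refl)
    fix t assume t: "t \<in> {..<z}"
    then have "(c, t) \<in> grid l" using assms by (auto simp: grid_def)
    moreover have "{x\<in>grid m. coarsen (m - l) x = (c, t)} = {x\<in>A. snd x div ?k = t}"
      using t by (auto simp: A_def coarsen_def)
    ultimately show "p l (c, t) = (\<Sum>x\<in>{x\<in>A. snd x div ?k = t}. p m x)"
      using p_coherent[OF assms(1)] by simp
  qed
  also have "\<dots> = (\<Sum>x\<in>A. p m x)"
    by (intro sum.group) (auto simp: A_def)
  also have "\<dots> = (\<Sum>c'\<in>{c'\<in>{..<4 ^ m}. c' div 4 ^ (m - l) = c}. \<Sum>t<z * 4 ^ (m - l). p m (c', t))"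
    unfolding A by (simp add: sum.cartesian_product case_prod_beta')
  finally show ?thesis by simp
qed

lemma height_bounds:
  assumes "c < 4 ^ m" "n \<le> 4 ^ m"
  shows "0 \<le> height m n c" "height m n c \<le> 1"
proof -
  have nonneg: "0 \<le> p m (c, t)" if "t < 4 ^ m" for t
    using assms that by (intro p_nonneg) (auto simp: grid_def)
  then show "0 \<le> height m n c"
    unfolding height_def using assms by (intro mult_nonneg_nonneg sum_nonneg) auto
  have "(\<Sum>t<n. p m (c, t)) \<le> (\<Sum>t<4 ^ m. p m (c, t))"
    using assms nonneg by (intro sum_mono2) auto
  then show "height m n c \<le> 1"
    using p_column[OF assms(1)] by (simp add: height_def field_simps)
qed

lemma height_mono:
  assumes "c < 4 ^ m" "n \<le> n'" "n' \<le> 4 ^ m"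
  shows "height m n c \<le> height m n' c"
  unfolding height_def using assms p_nonneg
  by (intro mult_left_mono sum_mono2) (auto simp: grid_def)

lemma height_full: "c < 4 ^ m \<Longrightarrow> height m (4 ^ m) c = 1"
  by (simp add: height_def p_column)

text \<open>
  The value \<open>g y\<close> is the proportion of mass below layer \<open>z\<close> of level \<open>l\<close> at position \<open>y\<close> in the limit of
  infinitely thin columns. In other words, \<open>g\<close> is the Lebesgue density of the mass below this boundary
  as a measure on positions.
\<close>

definition is_profile :: "nat \<Rightarrow> nat \<Rightarrow> (real \<Rightarrow> real) \<Rightarrow> bool" where
  "is_profile l z g \<longleftrightarrow> g \<in> borel_measurable borel \<and> (\<forall>y. g y \<in> {0..1}) \<and>
     (\<lambda>m. \<integral>y. \<bar>height m (z * 4 ^ (m - l)) (column m y) - g y\<bar> \<partial>uniform_interval) \<longlonglongrightarrow> 0 \<and>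
     (\<forall>c<4 ^ l. (\<integral>y. of_bool (column l y = c) * g y \<partial>uniform_interval) = (\<Sum>t<z. p l (c, t)))"

lemma measurable_column_U: "column m \<in> measurable uniform_interval (count_space UNIV)"
  by measurable

text \<open>
  By \<open>sum_strip_refinement\<close> the heights of the boundary in the columns around \<open>y\<close> form a bounded
  martingale as the columns shrink, starting from level \<open>l\<close>.
\<close>

lemma ex_profile:
  assumes z: "z \<le> 4 ^ l"
  shows "\<exists>g. is_profile l z g"
proof -
  have z4: "z * 4 ^ j \<le> 4 ^ (l + j)" for j
    using z by (simp add: power_add)
  obtain g where g: "g \<in> borel_measurable uniform_interval" "\<And>y. g y \<in> {0..1}"
    "(\<lambda>j. \<integral>y. \<bar>height (l + j) (z * 4 ^ j) (column (l + j) y) - g y\<bar> \<partial>uniform_interval) \<longlonglongrightarrow> 0"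
    "\<And>i c. c \<in> {..<4 ^ (l + i)} \<Longrightarrow>
      (\<integral>y. of_bool (column (l + i) y = c) * g y \<partial>uniform_interval) =
      height (l + i) (z * 4 ^ i) c * (1 / 4 ^ (l + i))"
  proof (rule U.L1_limit_of_cell_martingale[where \<phi>="\<lambda>j. height (l + j) (z * 4 ^ j)"
        and \<kappa>="\<lambda>j. column (l + j)" and C="\<lambda>j. {..<4 ^ (l + j)}" and q="\<lambda>j (c::nat). 1 / 4 ^ (l + j)"
        and \<rho>="\<lambda>i j (c::nat). c div 4 ^ (j - i)"])
    show "column (l + j) \<in> measurable uniform_interval (count_space UNIV)" for j
      by (rule measurable_column_U)
    show "column (l + j) y \<in> {..<4 ^ (l + j)}" for j y
      by (simp add: column_less)
    show "height (l + j) (z * 4 ^ j) c \<in> {0..1}" if "c \<in> {..<4 ^ (l + j)}" for j c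
      using height_bounds[of c "l + j" "z * 4 ^ j"] that z4 by simp
    show "measure uniform_interval {x \<in> space uniform_interval. column (l + j) x = c} = 1 / 4 ^ (l + j)"
      if "c \<in> {..<4 ^ (l + j)}" for j c
      using measure_column[of c "l + j"] that by simp
    show "c div 4 ^ (j - i) \<in> {..<4 ^ (l + i)}" if "i \<le> j" "c \<in> {..<4 ^ (l + j)}" for i j and c :: nat
      using div_power_less[of c "l + j" "l + i"] that by simp
    show "AE y in uniform_interval. column (l + i) y = column (l + j) y div 4 ^ (j - i)" if "i \<le> j" for i j
      using column_nested[of "l + i" "l + j"] that by (intro AE_I2) simp
    fix i j c assume ij: "i \<le> j" and c: "c \<in> {..<(4::nat) ^ (l + i)}"
    have eq: "z * 4 ^ i * 4 ^ (l + j - (l + i)) = z * 4 ^ j"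
      using ij by (simp add: power_add[symmetric])
    have "(\<Sum>c'\<in>{c'\<in>{..<4 ^ (l + j)}. c' div 4 ^ (l + j - (l + i)) = c}. \<Sum>t<z * 4 ^ i * 4 ^ (l + j - (l + i)). p (l + j) (c', t)) =
      (\<Sum>t<z * 4 ^ i. p (l + i) (c, t))"
      using ij c z4[of i] by (intro sum_strip_refinement) auto
    then have "(\<Sum>c'\<in>{c'\<in>{..<4 ^ (l + j)}. c' div 4 ^ (j - i) = c}. \<Sum>t<z * 4 ^ j. p (l + j) (c', t)) =
      (\<Sum>t<z * 4 ^ i. p (l + i) (c, t))"
      unfolding eq by simp
    then show "(\<Sum>c'\<in>{c'\<in>{..<4 ^ (l + j)}. c' div 4 ^ (j - i) = c}.
        height (l + j) (z * 4 ^ j) c' * (1 / 4 ^ (l + j))) = height (l + i) (z * 4 ^ i) c * (1 / 4 ^ (l + i))"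
      by (simp add: height_def)
  qed auto
  let ?F = "\<lambda>m. \<integral>y. \<bar>height m (z * 4 ^ (m - l)) (column m y) - g y\<bar> \<partial>uniform_interval"
  have "(\<lambda>j. ?F (j + l)) \<longlonglongrightarrow> 0"
    using g(3) by (simp add: add.commute)
  then have "?F \<longlonglongrightarrow> 0" by (rule LIMSEQ_offset)
  moreover have "(\<integral>y. of_bool (column l y = c) * g y \<partial>uniform_interval) = (\<Sum>t<z. p l (c, t))"
    if "c < 4 ^ l" for c
    using g(4)[of c 0] that by (simp add: height_def)
  ultimately have "is_profile l z g"
    using g(1,2) measurable_cong_sets[OF uniform_interval_simps(2) refl] unfolding is_profile_def by blast
  then show ?thesis by (rule exI[of _ g])
qed

definition profile :: "nat \<Rightarrow> nat \<Rightarrow> real \<Rightarrow> real" where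
  "profile l z = (SOME g. is_profile l z g)"

lemma is_profile_profile: "z \<le> 4 ^ l \<Longrightarrow> is_profile l z (profile l z)"
  unfolding profile_def using someI_ex[OF ex_profile] by blast

lemma profileD:
  assumes "z \<le> 4 ^ l"
  shows "profile l z \<in> borel_measurable borel" "profile l z y \<in> {0..1}"
    "integrable uniform_interval (profile l z)"
proof -
  show meas: "profile l z \<in> borel_measurable borel" and bounds: "profile l z y \<in> {0..1}" for y
    using is_profile_profile[OF assms] by (auto simp: is_profile_def)
  show "integrable uniform_interval (profile l z)"
    using meas bounds measurable_cong_sets[OF uniform_interval_simps(2) refl]
    by (intro U.integrable_unit_interval) auto
qed

lemma integrable_height:
  assumes "n \<le> 4 ^ m"
  shows "integrable uniform_interval (\<lambda>y. height m n (column m y))"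
  using height_bounds[OF column_less assms]
  by (intro U.integrable_unit_interval measurable_compose[OF measurable_column_U]) auto

text \<open>
  At any common finer level the first boundary lies below the second one in every column. Equality of
  the two boundaries is the case in which the assumption holds in both directions.
\<close>

lemma AE_profile_mono:
  assumes z: "z \<le> 4 ^ l" "z' \<le> 4 ^ l'" and le: "z * 4 ^ l' \<le> z' * 4 ^ l"
  shows "AE y in uniform_interval. profile l z y \<le> profile l' z' y"
proof -
  have "is_profile l z (profile l z)" "is_profile l' z' (profile l' z')"
    using z by (auto intro: is_profile_profile)
  then have lim:
    "(\<lambda>m. \<integral>y. \<bar>height m (z * 4 ^ (m - l)) (column m y) - profile l z y\<bar> \<partial>uniform_interval) \<longlonglongrightarrow> 0"
    "(\<lambda>m. \<integral>y. \<bar>height m (z' * 4 ^ (m - l')) (column m y) - profile l' z' y\<bar> \<partial>uniform_interval) \<longlonglongrightarrow> 0"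
    by (auto simp: is_profile_def)
  define k where "k = max l l'"
  have bound: "z * 4 ^ (m + k - l) \<le> 4 ^ (m + k)" "z' * 4 ^ (m + k - l') \<le> 4 ^ (m + k)" for m
  proof -
    have "z * 4 ^ (m + k - l) \<le> 4 ^ l * 4 ^ (m + k - l)" "z' * 4 ^ (m + k - l') \<le> 4 ^ l' * 4 ^ (m + k - l')"
      using z by simp_all
    then show "z * 4 ^ (m + k - l) \<le> 4 ^ (m + k)" "z' * 4 ^ (m + k - l') \<le> 4 ^ (m + k)"
      by (simp_all add: power_add[symmetric] k_def)
  qed
  have mono: "z * 4 ^ (m + k - l) \<le> z' * 4 ^ (m + k - l')" for m
  proof -
    have "(z * 4 ^ l') * 4 ^ (m + k) \<le> (z' * 4 ^ l) * 4 ^ (m + k)" using le by simp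
    also have "(4::nat) ^ (m + k) = 4 ^ (m + k - l) * 4 ^ l" by (simp add: power_add[symmetric] k_def)
    finally have "z * 4 ^ (m + k - l) * (4 ^ l' * 4 ^ l) \<le> z' * (4 ^ (m + k - l) * 4 ^ l) * 4 ^ l"
      by (simp add: mult_ac)
    also have "(4::nat) ^ (m + k - l) * 4 ^ l = 4 ^ (m + k - l') * 4 ^ l'"
      by (simp add: power_add[symmetric] k_def)
    finally show ?thesis by (simp add: mult_ac)
  qed
  let ?h = "\<lambda>m y. height (m + k) (z * 4 ^ (m + k - l)) (column (m + k) y)"
  let ?h' = "\<lambda>m y. height (m + k) (z' * 4 ^ (m + k - l')) (column (m + k) y)"
  show ?thesis
  proof (rule U.AE_le_of_L1_limits)
    show "integrable uniform_interval (profile l z)" "integrable uniform_interval (profile l' z')"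
      using z by (auto intro: profileD)
    show "integrable uniform_interval (\<lambda>y. ?h m y)"
      "integrable uniform_interval (\<lambda>y. ?h' m y)" for m
      by (rule integrable_height bound)+
    show "\<forall>\<^sub>F m in sequentially. \<forall>y\<in>space uniform_interval.
        ?h m y
        \<le> ?h' m y"
      by (intro always_eventually allI ballI height_mono column_less bound mono)
  qed (rule LIMSEQ_ignore_initial_segment[OF lim(1)] LIMSEQ_ignore_initial_segment[OF lim(2)])+
qed

lemma AE_profile_0: "AE y in uniform_interval. profile l 0 y = 0"
proof -
  have p: "is_profile l 0 (profile l 0)" by (rule is_profile_profile) simp
  have "AE y in uniform_interval. profile l 0 y \<le> 0"
  proof (rule U.AE_le_of_L1_limits[where F="\<lambda>m y. height m (0 * 4 ^ (m - l)) (column m y)" and H="\<lambda>_ _. 0"])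
    show "integrable uniform_interval (\<lambda>y. height m (0 * 4 ^ (m - l)) (column m y))" for m
      by (rule integrable_height) simp
  qed (use p profileD(3)[of 0 l] in \<open>auto simp: is_profile_def height_def\<close>)
  then show ?thesis
  proof eventually_elim
    case (elim y)
    then show ?case using profileD(2)[of 0 l y] by simp
  qed
qed

lemma AE_profile_1: "AE y in uniform_interval. profile l (4 ^ l) y = 1"
proof -
  have p: "is_profile l (4 ^ l) (profile l (4 ^ l))" by (rule is_profile_profile) simp
  have pow: "(4::nat) ^ l * 4 ^ (m + l - l) = 4 ^ (m + l)" for m by (simp add: power_add)
  have "(\<lambda>m. \<integral>y. \<bar>height m (4 ^ l * 4 ^ (m - l)) (column m y) - profile l (4 ^ l) y\<bar> \<partial>uniform_interval) \<longlonglongrightarrow> 0"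
    using p by (simp add: is_profile_def)
  from LIMSEQ_ignore_initial_segment[OF this, of l]
  have lim: "(\<lambda>m. \<integral>y. \<bar>1 - profile l (4 ^ l) y\<bar> \<partial>uniform_interval) \<longlonglongrightarrow> 0"
    unfolding pow height_full[OF column_less] .
  have "AE y in uniform_interval. 1 \<le> profile l (4 ^ l) y"
    by (rule U.AE_le_of_L1_limits[where F="\<lambda>_ _. 1" and H="\<lambda>_ _. 1"])
       (use lim profileD(3)[of "4 ^ l" l] in auto)
  then show ?thesis
  proof eventually_elim
    case (elim y)
    then show ?case using profileD(2)[of "4 ^ l" l y] by simp
  qed
qed

text \<open>
  The relations between the countably many profiles hold simultaneously at almost every position.
\<close>

definition regular :: "real \<Rightarrow> bool" where
  "regular y \<longleftrightarrow> (\<forall>l. profile l 0 y = 0 \<and> profile l (4 ^ l) y = 1) \<and>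
     (\<forall>l z l' z'. z \<le> 4 ^ l \<longrightarrow> z' \<le> 4 ^ l' \<longrightarrow> z * 4 ^ l' \<le> z' * 4 ^ l \<longrightarrow> profile l z y \<le> profile l' z' y)"

lemma AE_regular: "AE y in uniform_interval. regular y"
  unfolding regular_def
  by (intro AE_conjI AE_all_countable[THEN iffD2] allI AE_profile_0 AE_profile_1 AE_impI AE_profile_mono)

text \<open>
  The vertical segment over a position is cut at the values of the profiles. The layer of a point is the
  number of inner cuts that do not lie above it.
\<close>

definition layer :: "nat \<Rightarrow> real \<times> real \<Rightarrow> nat" where
  "layer l u = (\<Sum>z\<in>{1..<4 ^ l}. if profile l z (fst u) \<le> snd u then 1 else 0)"

lemma layer_less: "layer l u < 4 ^ l"
proof -
  have "layer l u \<le> (\<Sum>z\<in>{1..<(4::nat) ^ l}. 1)" unfolding layer_def by (intro sum_mono) auto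
  also have "\<dots> < 4 ^ l" by simp
  finally show ?thesis .
qed

lemma layer_less_iff:
  assumes y: "regular y" and b: "0 \<le> b" "b < 1" and z: "z \<le> 4 ^ l"
  shows "layer l (y, b) < z \<longleftrightarrow> b < profile l z y"
proof -
  let ?S = "{t\<in>{1..<4 ^ l}. profile l t y \<le> b}"
  have layer: "layer l (y, b) = card ?S"
    unfolding layer_def card_eq_sum by (subst sum.inter_filter) simp_all
  have mono: "profile l t y \<le> profile l t' y" if "t \<le> t'" "t' \<le> 4 ^ l" for t t'
    using y that unfolding regular_def by simp
  have ends: "profile l 0 y = 0" "profile l (4 ^ l) y = 1"
    using y unfolding regular_def by auto
  show ?thesis
  proof
    assume "b < profile l z y"
    then have "z \<noteq> 0" using ends b by (intro notI) simp
    have "?S \<subseteq> {1..<z}"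
    proof
      fix t assume t: "t \<in> ?S"
      then have "\<not> z \<le> t" using mono[of z t] \<open>b < profile l z y\<close> by auto
      then show "t \<in> {1..<z}" using t by auto
    qed
    then have "card ?S \<le> card {1..<z}" by (intro card_mono) auto
    then show "layer l (y, b) < z" using \<open>z \<noteq> 0\<close> layer by simp
  next
    assume less: "layer l (y, b) < z"
    show "b < profile l z y"
    proof (rule ccontr)
      assume "\<not> b < profile l z y"
      then have le: "profile l z y \<le> b" by simp
      then have "z < 4 ^ l" using ends b z by (cases "z = 4 ^ l") auto
      then have "{1..z} \<subseteq> ?S" using order_trans[OF mono[OF _ z] le] by auto
      then have "card {1..z} \<le> card ?S" by (intro card_mono) auto
      then show False using less layer by simp
    qed
  qed
qed

text \<open>
  The boundary \<open>z\<close> of level \<open>l\<close> and the boundary \<open>z * 4 ^ (m - l)\<close> of level \<open>m\<close> have the same height over a regular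
  position, so a point lies below the first if and only if it lies below the second.
\<close>

lemma layer_nested:
  assumes y: "regular y" and b: "0 \<le> b" "b < 1" and lm: "l \<le> m"
  shows "layer l (y, b) = layer m (y, b) div 4 ^ (m - l)"
proof -
  let ?k = "(4::nat) ^ (m - l)"
  have pow: "(4::nat) ^ l * ?k = 4 ^ m" using lm by (simp add: power_add[symmetric])
  have iff: "layer l (y, b) < z \<longleftrightarrow> layer m (y, b) div ?k < z" if "z \<le> 4 ^ l" for z
  proof -
    have zk: "z * ?k \<le> 4 ^ m" using that pow by (metis mult_le_mono1)
    have "z * 4 ^ m = (z * ?k) * 4 ^ l" using pow by (metis mult.assoc mult.commute)
    note eq_imp_le[OF this] eq_imp_le[OF this[symmetric]]
    then have "profile l z y \<le> profile m (z * ?k) y" "profile m (z * ?k) y \<le> profile l z y"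
      using y[unfolded regular_def] that zk by blast+
    then have "profile l z y = profile m (z * ?k) y" by (rule antisym)
    then show ?thesis
      using layer_less_iff[OF y b that] layer_less_iff[OF y b zk] by (simp add: div_less_iff_less_mult)
  qed
  have "layer m (y, b) div ?k < 4 ^ l" using layer_less lm by (intro div_power_less) auto
  then have "layer l (y, b) \<le> layer m (y, b) div ?k"
    using iff[of "Suc (layer m (y, b) div ?k)"] by simp
  moreover have "layer m (y, b) div ?k \<le> layer l (y, b)"
    using iff[of "Suc (layer l (y, b))"] layer_less[of l "(y, b)"] by simp
  ultimately show ?thesis by (rule antisym)
qed

definition address :: "nat \<Rightarrow> real \<times> real \<Rightarrow> nat \<times> nat" where
  "address m u = (column m (fst u), layer m u)"

lemma address_grid: "address m u \<in> grid m"
  by (simp add: address_def grid_def column_less layer_less)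

lemma measurable_layer [measurable]: "layer m \<in> measurable (borel \<Otimes>\<^sub>M borel) (count_space UNIV)"
proof -
  have "(\<lambda>u. if profile m z (fst u) \<le> snd u then 1 else 0 :: nat) \<in> measurable (borel \<Otimes>\<^sub>M borel) (count_space UNIV)"
    if "z \<in> {1..<4 ^ m}" for z
  proof -
    have [measurable]: "profile m z \<in> borel_measurable borel" using that by (intro profileD) auto
    show ?thesis by measurable
  qed
  then show ?thesis unfolding layer_def[abs_def] by (rule measurable_sum_nat)
qed

lemma measurable_address: "address m \<in> measurable uniform_square (count_space UNIV)"
proof -
  have "address m \<in> measurable uniform_square (count_space UNIV \<Otimes>\<^sub>M count_space UNIV)"
    unfolding address_def[abs_def] by measurable
  then show ?thesis by (simp add: pair_measure_countable)
qed

lemma AE_address_nested: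
  assumes "l \<le> m"
  shows "AE u in uniform_square. address l u = coarsen (m - l) (address m u)"
  using AE_unit_square_fst[OF AE_regular] AE_unit_square_snd
proof eventually_elim
  case (elim u)
  then show ?case
    using column_nested[of l m "fst u"] layer_nested[of "fst u" "snd u" l m] assms
    by (simp add: address_def coarsen_def)
qed

text \<open>
  Over a regular position the points in layers below \<open>z\<close> form a segment whose length is the profile. By
  Fubini's theorem the measure is the integral of the profile over the column, which is the prescribed
  mass.
\<close>

lemma measure_column_layer:
  assumes c: "c < 4 ^ m" and z: "z \<le> 4 ^ m"
  shows "measure uniform_square {u. column m (fst u) = c \<and> layer m u < z} = (\<Sum>t<z. p m (c, t))"
proof -
  let ?I = "\<lambda>y b. of_bool (column m y = c \<and> layer m (y, b) < z) :: real"
  have meas: "case_prod ?I \<in> borel_measurable (uniform_interval \<Otimes>\<^sub>M uniform_interval)"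
    unfolding split_beta' by measurable
  have [measurable]: "profile m z \<in> borel_measurable borel" using z by (intro profileD)
  have "{u \<in> space uniform_square. column m (fst u) = c \<and> layer m u < z} \<in> sets uniform_square"
    by measurable
  then have "measure uniform_square {u. column m (fst u) = c \<and> layer m u < z} =
      (\<integral>u. indicator {u. column m (fst u) = c \<and> layer m u < z} u \<partial>uniform_square)"
    by simp
  also have "\<dots> = (\<integral>u. case_prod ?I u \<partial>(uniform_interval \<Otimes>\<^sub>M uniform_interval))"
    unfolding uniform_square_eq
    by (intro Bochner_Integration.integral_cong refl) (auto simp: indicator_def)
  also have "\<dots> = (\<integral>y. (\<integral>b. ?I y b \<partial>uniform_interval) \<partial>uniform_interval)"
    using meas by (intro UU.integral_fst[symmetric] UU.P.integrable_unit_interval) auto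
  also have "\<dots> = (\<integral>y. of_bool (column m y = c) * profile m z y \<partial>uniform_interval)"
  proof (intro integral_cong_AE)
    show "AE y in uniform_interval. (\<integral>b. ?I y b \<partial>uniform_interval) = of_bool (column m y = c) * profile m z y"
      using AE_regular
    proof eventually_elim
      case (elim y)
      have "(\<integral>b. ?I y b \<partial>uniform_interval) =
          (\<integral>b. of_bool (column m y = c) * indicator {b. b < profile m z y} b \<partial>uniform_interval)"
      proof (intro integral_cong_AE)
        show "AE b in uniform_interval. ?I y b = of_bool (column m y = c) * indicator {b. b < profile m z y} b"
          using AE_unit_interval by eventually_elim (use layer_less_iff[OF elim _ _ z] in auto)
      qed measurable
      also have "\<dots> = of_bool (column m y = c) * measure uniform_interval {b. b < profile m z y}"
        by (subst integral_mult_right_zero) simp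
      also have "measure uniform_interval {b. b < profile m z y} = profile m z y"
        using profileD(2)[OF z, of y] by (intro measure_unit_interval_less) auto
      finally show ?case .
    qed
  qed (use meas in measurable)
  also have "\<dots> = (\<Sum>t<z. p m (c, t))"
    using is_profile_profile[OF z] c by (simp add: is_profile_def)
  finally show ?thesis .
qed

lemma measure_address:
  assumes "c \<in> grid m"
  shows "measure uniform_square {u \<in> space uniform_square. address m u = c} = p m c"
proof -
  obtain d t where c: "c = (d, t)" and dt: "d < 4 ^ m" "t < 4 ^ m"
    using assms by (auto simp: grid_def)
  let ?A = "\<lambda>z. {u. column m (fst u) = d \<and> layer m u < z}"
  have sets: "?A z \<in> sets uniform_square" for z
  proof -
    have "{u \<in> space uniform_square. column m (fst u) = d \<and> layer m u < z} \<in> sets uniform_square"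
      by measurable
    then show ?thesis by simp
  qed
  have "{u \<in> space uniform_square. address m u = c} = ?A (Suc t) - ?A t"
    by (auto simp: address_def c)
  then have "measure uniform_square {u \<in> space uniform_square. address m u = c} =
      measure uniform_square (?A (Suc t)) - measure uniform_square (?A t)"
    using sets by (simp only:) (rule SQ.finite_measure_Diff, auto)
  also have "\<dots> = p m c"
    using dt by (simp add: measure_column_layer c)
  finally show ?thesis .
qed

lemma measurable_address_pair:
  "(\<lambda>u. (address m (fst u), address m (snd u))) \<in>
    measurable (uniform_square \<Otimes>\<^sub>M uniform_square) (count_space UNIV)"
proof -
  note [measurable] = measurable_address[of m]
  have "(\<lambda>u. (address m (fst u), address m (snd u))) \<in> measurable
      (uniform_square \<Otimes>\<^sub>M uniform_square) (count_space UNIV \<Otimes>\<^sub>M count_space UNIV)"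
    by measurable
  then show ?thesis by (simp add: pair_measure_countable)
qed

text \<open>
  Since two independent points have independent addresses, \<open>w_coherent\<close> says that the densities at their
  addresses form a martingale. Its limit is symmetrised; as \<open>w m\<close> is symmetric, this does not increase
  the distance.
\<close>

theorem ex_limit_orderon:
  obtains W :: "real \<times> real \<Rightarrow> real \<times> real \<Rightarrow> real"
  where "unit_kernel uniform_square W" "\<And>u v. W u v = W v u"
    "(\<lambda>m. \<integral>u. (\<integral>v. \<bar>w m (address m u) (address m v) - W u v\<bar> \<partial>uniform_square) \<partial>uniform_square) \<longlonglongrightarrow> 0"
proof -
  let ?S = uniform_square
  let ?\<kappa> = "\<lambda>m u. (address m (fst u), address m (snd u))"
  let ?f = "\<lambda>m u v. w m (address m u) (address m v)"
  obtain g where g: "g \<in> borel_measurable (?S \<Otimes>\<^sub>M ?S)" "\<And>u. g u \<in> {0..1}"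
    "(\<lambda>m. \<integral>u. \<bar>case_prod (w m) (?\<kappa> m u) - g u\<bar> \<partial>(?S \<Otimes>\<^sub>M ?S)) \<longlonglongrightarrow> 0"
  proof (rule SS.P.L1_limit_of_cell_martingale[where \<phi>="\<lambda>m. case_prod (w m)" and \<kappa>="?\<kappa>"
        and C="\<lambda>m. grid m \<times> grid m" and q="\<lambda>m c. p m (fst c) * p m (snd c)"
        and \<rho>="\<lambda>l m c. (coarsen (m - l) (fst c), coarsen (m - l) (snd c))"])
    show "?\<kappa> m \<in> measurable (?S \<Otimes>\<^sub>M ?S) (count_space UNIV)" for m by (rule measurable_address_pair)
    show "?\<kappa> m u \<in> grid m \<times> grid m" for m u by (simp add: address_grid)
    show "case_prod (w m) c \<in> {0..1}" for m c using w_bounds by (cases c) simp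
    show "measure (?S \<Otimes>\<^sub>M ?S) {u \<in> space (?S \<Otimes>\<^sub>M ?S). ?\<kappa> m u = c} = p m (fst c) * p m (snd c)"
      if "c \<in> grid m \<times> grid m" for m c
    proof -
      have "{u \<in> space (?S \<Otimes>\<^sub>M ?S). ?\<kappa> m u = c} =
          {u \<in> space ?S. address m u = fst c} \<times> {u \<in> space ?S. address m u = snd c}"
        by (auto simp: space_pair_measure)
      moreover have "{u \<in> space ?S. address m u = d} \<in> sets ?S" for d
        using measurable_address by measurable
      ultimately show ?thesis
        using that measure_address
        by (auto simp: measure_def SQ.emeasure_pair_measure_Times enn2real_mult)
    qed
    show "(coarsen (m - l) (fst c), coarsen (m - l) (snd c)) \<in> grid l \<times> grid l"
      if "l \<le> m" "c \<in> grid m \<times> grid m" for l m c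
      using that by (auto intro: coarsen_grid)
    show "AE u in ?S \<Otimes>\<^sub>M ?S. ?\<kappa> l u = (coarsen (m - l) (fst (?\<kappa> m u)), coarsen (m - l) (snd (?\<kappa> m u)))"
      if "l \<le> m" for l m
    proof (rule SS.AE_pair_measure)
      have "(\<lambda>u. (?\<kappa> l u, ?\<kappa> m u)) \<in> measurable (?S \<Otimes>\<^sub>M ?S) (count_space UNIV \<Otimes>\<^sub>M count_space UNIV)"
        by (intro measurable_Pair measurable_address_pair)
      then have "(\<lambda>u. (?\<kappa> l u, ?\<kappa> m u)) \<in> measurable (?S \<Otimes>\<^sub>M ?S) (count_space UNIV)"
        by (simp add: pair_measure_countable)
      from measurable_sets[OF this, of "{(c, d). c = (coarsen (m - l) (fst d), coarsen (m - l) (snd d))}"]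
      show "{u \<in> space (?S \<Otimes>\<^sub>M ?S). ?\<kappa> l u = (coarsen (m - l) (fst (?\<kappa> m u)), coarsen (m - l) (snd (?\<kappa> m u)))}
          \<in> sets (?S \<Otimes>\<^sub>M ?S)"
        by (simp add: vimage_def Int_def conj_commute)
      show "AE u in ?S. AE v in ?S. ?\<kappa> l (u, v) =
          (coarsen (m - l) (fst (?\<kappa> m (u, v))), coarsen (m - l) (snd (?\<kappa> m (u, v))))"
        using AE_address_nested[OF that]
      proof eventually_elim
        case (elim u)
        show ?case using AE_address_nested[OF that] by eventually_elim (simp add: elim)
      qed
    qed
    fix l m :: nat and c assume lm: "l \<le> m" and c: "c \<in> grid l \<times> grid l"
    have "{c'\<in>grid m \<times> grid m. (coarsen (m - l) (fst c'), coarsen (m - l) (snd c')) = c} =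
       {c'\<in>grid m. coarsen (m - l) c' = fst c} \<times> {d'\<in>grid m. coarsen (m - l) d' = snd c}"
      by (cases c) auto
    then show "(\<Sum>c'\<in>{c'\<in>grid m \<times> grid m. (coarsen (m - l) (fst c'), coarsen (m - l) (snd c')) = c}.
        case_prod (w m) c' * (p m (fst c') * p m (snd c'))) = case_prod (w l) c * (p l (fst c) * p l (snd c))"
      using w_coherent[OF lm, of "fst c" "snd c"] mem_Times_iff[of c "grid l" "grid l"] c
      by (simp add: sum.cartesian_product case_prod_beta' mult_ac)
  qed auto
  define W where "W u v = (g (u, v) + g (v, u)) / 2" for u v
  have g_swap: "(\<lambda>u. g (snd u, fst u)) \<in> borel_measurable (?S \<Otimes>\<^sub>M ?S)"
    using g(1) by measurable
  have W_meas: "case_prod W \<in> borel_measurable (?S \<Otimes>\<^sub>M ?S)"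
    unfolding W_def split_beta' using g(1) g_swap by simp
  have W01: "0 \<le> W u v" "W u v \<le> 1" for u v
    using g(2)[of "(u, v)"] g(2)[of "(v, u)"] by (auto simp: W_def)
  have f_meas: "(\<lambda>u. ?f m (fst u) (snd u)) \<in> borel_measurable (?S \<Otimes>\<^sub>M ?S)" for m
    using measurable_compose[OF measurable_address_pair[of m], of "case_prod (w m)" borel] by simp
  have le: "(\<integral>u. (\<integral>v. \<bar>?f m u v - W u v\<bar> \<partial>?S) \<partial>?S) \<le> (\<integral>u. \<bar>case_prod (w m) (?\<kappa> m u) - g u\<bar> \<partial>(?S \<Otimes>\<^sub>M ?S))" for m
  proof -
    let ?d = "\<lambda>u. \<bar>?f m (fst u) (snd u) - g u\<bar>"
    have d_meas: "?d \<in> borel_measurable (?S \<Otimes>\<^sub>M ?S)" using f_meas g(1) by measurable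
    have d_le: "?d u \<le> 1" for u
      using g(2)[of u] w_bounds[of m "address m (fst u)" "address m (snd u)"] by auto
    have d_int: "integrable (?S \<Otimes>\<^sub>M ?S) ?d"
      using d_meas d_le by (intro SS.P.integrable_unit_interval) auto
    have swap: "(\<integral>(u, v). ?d (v, u) \<partial>(?S \<Otimes>\<^sub>M ?S)) = (\<integral>u. ?d u \<partial>(?S \<Otimes>\<^sub>M ?S))"
      by (rule SS.integral_product_swap[OF d_meas])
    have swap_int: "integrable (?S \<Otimes>\<^sub>M ?S) (\<lambda>(u, v). ?d (v, u))"
      by (rule SS.integrable_product_swap[OF d_int])
    have W_int: "integrable (?S \<Otimes>\<^sub>M ?S) (\<lambda>(u, v). \<bar>?f m u v - W u v\<bar>)"
    proof (rule SS.P.integrable_unit_interval)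
      show "(\<lambda>(u, v). \<bar>?f m u v - W u v\<bar>) \<in> borel_measurable (?S \<Otimes>\<^sub>M ?S)"
        using f_meas[of m] W_meas by (simp add: split_beta')
      show "(case u of (u, v) \<Rightarrow> \<bar>?f m u v - W u v\<bar>) \<le> 1" for u
        using W01[of "fst u" "snd u"] w_bounds[of m "address m (fst u)" "address m (snd u)"]
        by (auto simp: split_beta')
    qed auto
    have "(\<integral>u. (\<integral>v. \<bar>?f m u v - W u v\<bar> \<partial>?S) \<partial>?S) = (\<integral>(u, v). \<bar>?f m u v - W u v\<bar> \<partial>(?S \<Otimes>\<^sub>M ?S))"
      by (rule SS.integral_fst[OF W_int])
    also have "\<dots> \<le> (\<integral>u. (?d u + (case u of (u, v) \<Rightarrow> ?d (v, u))) / 2 \<partial>(?S \<Otimes>\<^sub>M ?S))"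
    proof (rule integral_mono[OF W_int])
      show "(case u of (u, v) \<Rightarrow> \<bar>?f m u v - W u v\<bar>) \<le> (?d u + (case u of (u, v) \<Rightarrow> ?d (v, u))) / 2" for u
        using w_sym[of m "address m (fst u)" "address m (snd u)"]
        by (cases u) (simp add: W_def abs_if field_simps)
    qed (use d_int swap_int in auto)
    also have "\<dots> = (\<integral>u. ?d u \<partial>(?S \<Otimes>\<^sub>M ?S))"
      using d_int swap_int swap by simp
    finally show ?thesis by simp
  qed
  show thesis
  proof (rule that[of W])
    show "unit_kernel ?S W" using W_meas W01 by (simp add: unit_kernel_def)
    show "W u v = W v u" for u v by (simp add: W_def add.commute)
    show "(\<lambda>m. \<integral>u. (\<integral>v. \<bar>?f m u v - W u v\<bar> \<partial>?S) \<partial>?S) \<longlonglongrightarrow> 0"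
    proof (rule tendsto_sandwich[OF _ _ tendsto_const g(3)])
      show "\<forall>\<^sub>F m in sequentially. 0 \<le> (\<integral>u. (\<integral>v. \<bar>?f m u v - W u v\<bar> \<partial>?S) \<partial>?S)"
        by (intro always_eventually allI Bochner_Integration.integral_nonneg) auto
      show "\<forall>\<^sub>F m in sequentially. (\<integral>u. (\<integral>v. \<bar>?f m u v - W u v\<bar> \<partial>?S) \<partial>?S)
          \<le> (\<integral>u. \<bar>case_prod (w m) (?\<kappa> m u) - g u\<bar> \<partial>(?S \<Otimes>\<^sub>M ?S))"
        by (intro always_eventually allI le)
    qed
  qed
qed

end

section \<open>Densities as pair integrals\<close>

text \<open>
  The factor that the pair \<open>q\<close> of vertices of \<open>F\<close> contributes to a density: the two points must be in
  order, and \<open>U\<close> is their probability of being adjacent.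
\<close>

definition pattern_kernel ::
    "ordered_graph \<Rightarrow> ('a \<Rightarrow> 'a \<Rightarrow> bool) \<Rightarrow> ('a \<Rightarrow> 'a \<Rightarrow> real) \<Rightarrow> nat \<times> nat \<Rightarrow> 'a \<Rightarrow> 'a \<Rightarrow> real" where
  "pattern_kernel F prec U q x y =
     of_bool (prec x y) * (if adj F (fst q) (snd q) then U x y else 1 - U x y)"

lemma unit_kernel_pattern:
  assumes U: "unit_kernel M U"
    and prec: "{u \<in> space (M \<Otimes>\<^sub>M M). prec (fst u) (snd u)} \<in> sets (M \<Otimes>\<^sub>M M)"
  shows "unit_kernel M (pattern_kernel F prec U q)"
proof -
  note [measurable] = unit_kernelD(1)[OF U]
  have "(\<lambda>u. of_bool (prec (fst u) (snd u)) :: real) \<in> borel_measurable (M \<Otimes>\<^sub>M M)"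
    using prec by measurable
  moreover have "(\<lambda>u. U (fst u) (snd u)) \<in> borel_measurable (M \<Otimes>\<^sub>M M)"
    using unit_kernelD(1)[OF U] by (simp add: split_beta')
  ultimately have "(\<lambda>u. pattern_kernel F prec U q (fst u) (snd u)) \<in> borel_measurable (M \<Otimes>\<^sub>M M)"
    unfolding pattern_kernel_def by (cases "adj F (fst q) (snd q)") auto
  then show ?thesis
    using unit_kernelD(2,3)[OF U] by (auto simp: unit_kernel_def split_beta' pattern_kernel_def)
qed

lemma pattern_kernel_order_diff_le:
  assumes "0 \<le> U x y" "U x y \<le> 1"
  shows "\<bar>pattern_kernel F prec U q x y - pattern_kernel F prec' U q x y\<bar> \<le> of_bool (prec x y \<noteq> prec' x y)"
  using assms by (auto simp: pattern_kernel_def)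

lemma pattern_kernel_diff_le:
  "\<bar>pattern_kernel F prec U q x y - pattern_kernel F prec U' q x y\<bar> \<le> \<bar>U x y - U' x y\<bar>"
  by (auto simp: pattern_kernel_def)

lemma emeasure_uniform_square:
  assumes "A \<in> sets borel"
  shows "emeasure uniform_square A = emeasure lborel (unit_square \<inter> A)"
proof -
  have "emeasure lborel unit_square = 1"
    unfolding unit_square_def
    by (subst lborel_prod[symmetric]) (simp add: lborel.emeasure_pair_measure_Times)
  moreover have "unit_square \<in> sets borel"
    by (simp add: unit_square_def borel_closed closed_Times)
  ultimately show ?thesis
    using assms unfolding uniform_square_def by (simp add: divide_ennreal_def)
qed

text \<open>
  Both measures agree on boxes. With this identity the conditions that the points lie in the unit square
  become part of the measure.
\<close>

lemma PiM_uniform_square: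
  assumes "finite I"
  shows "Pi\<^sub>M I (\<lambda>_. uniform_square) =
    density (Pi\<^sub>M I (\<lambda>_. lborel)) (\<lambda>v. ennreal (\<Prod>i\<in>I. indicat_real unit_square (v i)))"
proof (rule sym, rule product_sigma_finite.PiM_eqI[OF _ assms])
  let ?L = "Pi\<^sub>M I (\<lambda>_. lborel :: (real \<times> real) measure)"
  let ?D = "\<lambda>v. ennreal (\<Prod>i\<in>I. indicat_real unit_square (v i))"
  show "product_sigma_finite (\<lambda>_. uniform_square)"
    by (simp add: product_sigma_finite_def SQ.sigma_finite_measure_axioms)
  interpret L: product_sigma_finite "\<lambda>_. lborel :: (real \<times> real) measure"
    by (simp add: product_sigma_finite_def lborel.sigma_finite_measure_axioms)
  have sq [measurable]: "unit_square \<in> sets borel"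
    by (simp add: unit_square_def borel_closed closed_Times)
  have D: "(\<lambda>v. \<Prod>i\<in>I. indicat_real unit_square (v i)) \<in> borel_measurable ?L"
    by (intro borel_measurable_prod measurable_compose[OF measurable_component_singleton]) auto
  show "sets (density ?L ?D) =
      sets (Pi\<^sub>M I (\<lambda>_. uniform_square))"
    unfolding sets_density by (intro sets_PiM_cong) auto
  fix A assume "\<And>i. i \<in> I \<Longrightarrow> A i \<in> sets uniform_square"
  then have A: "\<And>i. i \<in> I \<Longrightarrow> A i \<in> sets borel" by simp
  have PA: "Pi\<^sub>E I A \<in> sets ?L"
    using A assms by (intro sets_PiM_I_finite) auto
  have "emeasure (density ?L ?D) (Pi\<^sub>E I A) =
      (\<integral>\<^sup>+v. ennreal (\<Prod>i\<in>I. indicat_real unit_square (v i)) * indicator (Pi\<^sub>E I A) v \<partial>?L)"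
    using D PA by (intro emeasure_density) auto
  also have "\<dots> = (\<integral>\<^sup>+v. (\<Prod>i\<in>I. indicator (unit_square \<inter> A i) (v i)) \<partial>?L)"
  proof (intro nn_integral_cong)
    fix v assume "v \<in> space ?L"
    then have v: "v \<in> extensional I" by (simp add: space_PiM PiE_def)
    show "ennreal (\<Prod>i\<in>I. indicat_real unit_square (v i)) * indicator (Pi\<^sub>E I A) v =
        (\<Prod>i\<in>I. indicator (unit_square \<inter> A i) (v i))"
    proof (cases "v \<in> Pi\<^sub>E I A")
      case True
      then have "(\<Prod>i\<in>I. indicator (unit_square \<inter> A i) (v i)) = (\<Prod>i\<in>I. ennreal (indicat_real unit_square (v i)))"
        by (intro prod.cong refl) (auto simp: indicator_def)
      then show ?thesis using True by (simp add: prod_ennreal)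
    next
      case False
      then obtain i where "i \<in> I" "v i \<notin> A i" using v by (auto simp: PiE_iff)
      then have "(\<Prod>i\<in>I. indicator (unit_square \<inter> A i) (v i)) = (0::ennreal)"
        using assms by (intro prod_zero bexI[of _ i]) (auto simp: indicator_def)
      then show ?thesis using False by simp
    qed
  qed
  also have "\<dots> = (\<Prod>i\<in>I. emeasure lborel (unit_square \<inter> A i))"
    using A assms by (subst L.product_nn_integral_prod) auto
  also have "\<dots> = (\<Prod>i\<in>I. emeasure uniform_square (A i))"
    using A by (simp add: emeasure_uniform_square)
  finally show "emeasure (density ?L ?D) (Pi\<^sub>E I A) =
      (\<Prod>i\<in>I. emeasure uniform_square (A i))" .
qed

lemma prod_pattern_kernel:
  "(\<Prod>q\<in>vertex_pairs k. pattern_kernel F prec W q (v (fst q)) (v (snd q))) =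
    of_bool (\<forall>(i, j)\<in>vertex_pairs k. prec (v i) (v j)) *
    ((\<Prod>(i, j)\<in>{(i, j) \<in> {1..k} \<times> {1..k}. i < j \<and> adj F i j}. W (v i) (v j)) *
     (\<Prod>(i, j)\<in>{(i, j) \<in> {1..k} \<times> {1..k}. i < j \<and> \<not> adj F i j}. 1 - W (v i) (v j)))"
proof -
  let ?Q = "vertex_pairs k"
  let ?A = "{(i, j). adj F i j}"
  have "(\<Prod>q\<in>?Q. of_bool (prec (v (fst q)) (v (snd q)))) =
      (of_bool (\<forall>(i, j)\<in>?Q. prec (v i) (v j)) :: real)"
  proof (cases "\<forall>(i, j)\<in>?Q. prec (v i) (v j)")
    case True
    then show ?thesis by (auto intro!: prod.neutral)
  next
    case False
    then have "\<exists>q\<in>?Q. of_bool (prec (v (fst q)) (v (snd q))) = (0::real)" by force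
    then have "(\<Prod>q\<in>?Q. of_bool (prec (v (fst q)) (v (snd q)))) = (0::real)"
      by (intro prod_zero) auto
    then show ?thesis using False by (simp only: of_bool_def if_False)
  qed
  moreover have "(\<Prod>q\<in>?Q. if adj F (fst q) (snd q) then W (v (fst q)) (v (snd q)) else 1 - W (v (fst q)) (v (snd q))) =
     (\<Prod>q\<in>?Q \<inter> ?A. W (v (fst q)) (v (snd q))) * (\<Prod>q\<in>?Q \<inter> - ?A. 1 - W (v (fst q)) (v (snd q)))"
    by (subst prod.If_cases) (auto simp: split_beta' intro!: arg_cong2[where f="(*)"] prod.cong)
  moreover have "?Q \<inter> ?A = {(i, j) \<in> {1..k} \<times> {1..k}. i < j \<and> adj F i j}"
    "?Q \<inter> - ?A = {(i, j) \<in> {1..k} \<times> {1..k}. i < j \<and> \<not> adj F i j}"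
    by (auto simp: vertex_pairs_def)
  ultimately show ?thesis
    by (simp add: pattern_kernel_def prod.distrib split_beta')
qed

text \<open>
  The integrand is Borel measurable, so it has the same integral with respect to the completed measure
  as with respect to the product measure. The indicator of the ordered points is the product of the
  conditions that each point lies in the unit square and the conditions that each pair is in order.
\<close>

lemma density_orderon_eq_pair_integral:
  assumes W: "unit_kernel uniform_square W"
  shows "density_orderon F W = fact (nverts F) *
    pair_integral (nverts F) uniform_square (pattern_kernel F (\<lambda>u v. fst u \<le> fst v) W)"
proof -
  let ?k = "nverts F"
  let ?P = "Pi\<^sub>M {1..?k} (\<lambda>_. lborel :: (real \<times> real) measure)"
  let ?le = "\<lambda>u v :: real \<times> real. fst u \<le> fst v"
  define D where "D v = (\<Prod>i\<in>{1..?k}. indicat_real unit_square (v i))" for v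
  define f where "f v = (\<Prod>(i, j)\<in>{(i, j) \<in> {1..?k} \<times> {1..?k}. i < j \<and> adj F i j}. W (v i) (v j)) *
     (\<Prod>(i, j)\<in>{(i, j) \<in> {1..?k} \<times> {1..?k}. i < j \<and> \<not> adj F i j}. 1 - W (v i) (v j))" for v
  define h where "h v = (\<Prod>q\<in>vertex_pairs ?k. pattern_kernel F ?le W q (v (fst q)) (v (snd q)))" for v
  have sq [measurable]: "unit_square \<in> sets borel"
    by (simp add: unit_square_def borel_closed closed_Times)
  have D_meas: "D \<in> borel_measurable ?P"
    unfolding D_def by (intro borel_measurable_prod measurable_compose[OF measurable_component_singleton]) auto
  have sets_eq: "sets (uniform_square \<Otimes>\<^sub>M uniform_square) =
      sets ((lborel :: (real \<times> real) measure) \<Otimes>\<^sub>M (lborel :: (real \<times> real) measure))"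
    by (intro sets_pair_measure_cong) auto
  have le: "{u \<in> space (uniform_square \<Otimes>\<^sub>M uniform_square). ?le (fst u) (snd u)}
      \<in> sets (uniform_square \<Otimes>\<^sub>M uniform_square)"
    by measurable
  have pk: "unit_kernel uniform_square (pattern_kernel F ?le W q)" for q
    by (intro unit_kernel_pattern W le)
  have pk': "case_prod (pattern_kernel F ?le W q) \<in>
      borel_measurable ((lborel :: (real \<times> real) measure) \<Otimes>\<^sub>M (lborel :: (real \<times> real) measure))" for q
    using unit_kernelD(1)[OF pk[of q]] measurable_cong_sets[OF sets_eq refl] by blast
  have h_meas: "h \<in> borel_measurable ?P"
    unfolding h_def
  proof (intro borel_measurable_prod measurable_kernel_comp[OF pk'])
    fix q assume "q \<in> vertex_pairs ?k"
    then have "fst q \<in> {1..?k}" "snd q \<in> {1..?k}" by (auto simp: vertex_pairs_def)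
    then show "(\<lambda>v. v (fst q)) \<in> measurable ?P lborel" "(\<lambda>v. v (snd q)) \<in> measurable ?P lborel"
      by (auto intro: measurable_component_singleton)
  qed
  have Dh: "indicat_real (ordered_points ?k) v *\<^sub>R f v = D v *\<^sub>R h v" if "v \<in> space ?P" for v
  proof -
    have v: "v \<in> extensional {1..?k}" using that by (simp add: space_PiM PiE_def)
    have D: "D v = of_bool (\<forall>i\<in>{1..?k}. v i \<in> unit_square)"
      unfolding D_def by (auto simp: indicator_def)
    have "(\<forall>i\<in>{1..?k}. \<forall>j\<in>{1..?k}. i \<le> j \<longrightarrow> ?le (v i) (v j)) \<longleftrightarrow>
        (\<forall>(i, j)\<in>vertex_pairs ?k. ?le (v i) (v j))"
    proof (intro iffI ballI impI)
      fix i j assume "\<forall>(i, j)\<in>vertex_pairs ?k. ?le (v i) (v j)" "i \<in> {1..?k}" "j \<in> {1..?k}" "i \<le> j"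
      then show "?le (v i) (v j)" by (cases "i = j") (auto simp: vertex_pairs_def)
    qed (auto simp: vertex_pairs_def)
    then have "v \<in> ordered_points ?k \<longleftrightarrow>
        (\<forall>i\<in>{1..?k}. v i \<in> unit_square) \<and> (\<forall>(i, j)\<in>vertex_pairs ?k. ?le (v i) (v j))"
      using v unfolding ordered_points_def PiE_iff by blast
    then have "indicat_real (ordered_points ?k) v = D v * of_bool (\<forall>(i, j)\<in>vertex_pairs ?k. ?le (v i) (v j))"
      unfolding D by (simp add: indicator_def)
    then show ?thesis
      unfolding h_def prod_pattern_kernel f_def by simp
  qed
  have "(LINT v : ordered_points ?k | completion ?P. f v) =
      (\<integral>v. D v *\<^sub>R h v \<partial>completion ?P)"
    unfolding set_lebesgue_integral_def
    by (intro Bochner_Integration.integral_cong refl Dh) simp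
  also have "\<dots> = (\<integral>v. D v *\<^sub>R h v \<partial>?P)"
    using D_meas h_meas by (intro integral_completion) auto
  also have "\<dots> = (\<integral>v. h v \<partial>density ?P (\<lambda>v. ennreal (D v)))"
    using D_meas h_meas by (intro integral_density[symmetric]) (auto simp: D_def intro!: AE_I2 prod_nonneg)
  also have "density ?P (\<lambda>v. ennreal (D v)) = Pi\<^sub>M {1..?k} (\<lambda>_. uniform_square)"
    unfolding D_def by (rule PiM_uniform_square[symmetric]) simp
  finally show ?thesis
    unfolding density_orderon_def pair_integral_def f_def h_def by simp
qed

lemma orderonI:
  assumes "unit_kernel uniform_square W" "\<And>u v. W u v = W v u"
  shows "orderon W"
proof -
  have "sets (uniform_square \<Otimes>\<^sub>M uniform_square) =
      sets ((borel :: (real \<times> real) measure) \<Otimes>\<^sub>M (borel :: (real \<times> real) measure))"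
    by (intro sets_pair_measure_cong) simp_all
  also have "\<dots> = sets (lborel :: ((real \<times> real) \<times> (real \<times> real)) measure)"
    by (simp only: borel_prod sets_lborel)
  finally have sets_eq: "sets (uniform_square \<Otimes>\<^sub>M uniform_square) =
      sets (lborel :: ((real \<times> real) \<times> (real \<times> real)) measure)" .
  from measurable_cong_sets[OF this refl] have "case_prod W \<in> borel_measurable lborel"
    using unit_kernelD(1)[OF assms(1)] by blast
  then have "case_prod W \<in> borel_measurable (lebesgue_on (unit_square \<times> unit_square))"
    by (intro measurable_restrict_space1 measurable_completion)
  then show ?thesis
    using assms unit_kernelD(2,3)[OF assms(1)] by (auto simp: orderon_def)
qed

lemma increasing_copies_eq_pair_integral:
  assumes "nverts G > 0"
  shows "card (increasing_copies F G) / real (nverts G) ^ nverts F =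
    pair_integral (nverts F) (uniform_count_measure {1..nverts G})
      (pattern_kernel F (<) (\<lambda>x y. of_bool (adj G x y)))"
proof -
  let ?V = "{1..nverts G}" and ?k = "nverts F"
  let ?M = "uniform_count_measure ?V" and ?E = "{1..?k} \<rightarrow>\<^sub>E ?V"
  have V: "finite ?V" "?V \<noteq> {}" using assms by auto
  interpret M: prob_space ?M by (rule uniform_count_measure_simps(1)[OF V])
  have "pair_integral ?k ?M (pattern_kernel F (<) (\<lambda>x y. of_bool (adj G x y))) =
      (\<Sum>c\<in>?E. (\<Prod>i\<in>{1..?k}. measure ?M {x \<in> space ?M. x = c i}) *
        (\<Prod>q\<in>vertex_pairs ?k. pattern_kernel F (<) (\<lambda>x y. of_bool (adj G x y)) q (c (fst q)) (c (snd q))))"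
    using V by (intro M.pair_integral_step[of "\<lambda>x. x"]) (auto simp: space_uniform_count_measure measurable_def sets_uniform_count_measure)
  also have "\<dots> = (\<Sum>c\<in>?E. (1 / nverts G) ^ ?k * of_bool (c \<in> increasing_copies F G))"
  proof (intro sum.cong refl arg_cong2[where f="(*)"])
    fix c assume c: "c \<in> ?E"
    have "measure ?M {x \<in> space ?M. x = c i} = 1 / nverts G" if "i \<in> {1..?k}" for i
    proof -
      have "{x \<in> space ?M. x = c i} = {c i}" "c i \<in> ?V"
        using c that by (auto simp: space_uniform_count_measure)
      then show ?thesis using uniform_count_measure_simps(3)[OF V, of "{c i}"] by simp
    qed
    then show "(\<Prod>i\<in>{1..?k}. measure ?M {x \<in> space ?M. x = c i}) = (1 / nverts G) ^ ?k"
      by simp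
    let ?a = "\<lambda>q. pattern_kernel F (<) (\<lambda>x y. of_bool (adj G x y)) q (c (fst q)) (c (snd q)) :: real"
    have a: "?a q = of_bool (c (fst q) < c (snd q) \<and> adj F (fst q) (snd q) = adj G (c (fst q)) (c (snd q)))" for q
      by (auto simp: pattern_kernel_def)
    show "(\<Prod>q\<in>vertex_pairs ?k. ?a q) = of_bool (c \<in> increasing_copies F G)"
    proof (cases "c \<in> increasing_copies F G")
      case True
      then have "?a q = 1" if "q \<in> vertex_pairs ?k" for q
        using that unfolding a by (auto simp: increasing_copies_def split_beta')
      then show ?thesis using True by (simp del: of_bool_eq_1_iff)
    next
      case False
      then have "\<exists>q\<in>vertex_pairs ?k. ?a q = 0"
        using c unfolding a by (auto simp: increasing_copies_def split_beta')
      then have "(\<Prod>q\<in>vertex_pairs ?k. ?a q) = 0" by (intro prod_zero) auto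
      then show ?thesis using False by (simp only: of_bool_def if_False)
    qed
  qed
  also have "\<dots> = (1 / nverts G) ^ ?k * (\<Sum>c\<in>?E. of_bool (c \<in> increasing_copies F G))"
    by (rule sum_distrib_left[symmetric])
  also have "(\<Sum>c\<in>?E. of_bool (c \<in> increasing_copies F G)) = real (card (increasing_copies F G))"
  proof -
    have "?E \<inter> {c. c \<in> increasing_copies F G} = increasing_copies F G"
      by (auto simp: increasing_copies_def)
    then show ?thesis by (simp add: of_bool_def sum.If_cases finite_PiE)
  qed
  finally show ?thesis by (simp add: power_one_over field_simps)
qed

section \<open>Columns of vertices\<close>

text \<open>
  The vertex \<open>x\<close> occupies the position \<open>(x - 1) / N\<close> in the unit interval.
\<close>

definition vertex_column :: "nat \<Rightarrow> nat \<Rightarrow> nat \<Rightarrow> nat" where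
  "vertex_column N m x = 4 ^ m * (x - 1) div N"

lemma vertex_column_less:
  assumes "x \<in> {1..N}"
  shows "vertex_column N m x < 4 ^ m"
  using assms by (auto simp: vertex_column_def div_less_iff_less_mult)

lemma vertex_column_mono: "x \<le> y \<Longrightarrow> vertex_column N m x \<le> vertex_column N m y"
  unfolding vertex_column_def by (intro div_le_mono mult_le_mono) auto

lemma vertex_column_Suc: "vertex_column N m x = vertex_column N (Suc m) x div 4"
  unfolding vertex_column_def
  by (simp add: div_mult2_eq[symmetric] mult.commute[of N] mult.assoc)

text \<open>
  A half-open interval of length \<open>N / 4 ^ m\<close> contains this number of integers up to an error of 1.
\<close>

lemma card_vertex_column:
  assumes N: "N > 0" and d: "d < 4 ^ m"
  shows "\<bar>card {x\<in>{1..N}. vertex_column N m x = d} / real N - 1 / 4 ^ m\<bar> \<le> 1 / N"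
proof -
  define a where "a = real d * N / 4 ^ m"
  define b where "b = (real d + 1) * N / 4 ^ m"
  have d': "d + 1 \<le> 4 ^ m" using d by simp
  have iff: "vertex_column N m x = d \<longleftrightarrow> a \<le> real (x - 1) \<and> real (x - 1) < b" for x
  proof -
    have "vertex_column N m x = d \<longleftrightarrow> d * N \<le> 4 ^ m * (x - 1) \<and> 4 ^ m * (x - 1) < (d + 1) * N"
      unfolding vertex_column_def less_eq_div_iff_mult_less_eq[OF N, symmetric]
        div_less_iff_less_mult[OF N, symmetric] by linarith
    also have "d * N \<le> 4 ^ m * (x - 1) \<longleftrightarrow> a \<le> real (x - 1)"
    proof -
      have "d * N \<le> 4 ^ m * (x - 1) \<longleftrightarrow> real (d * N) \<le> real (4 ^ m * (x - 1))"
        by (simp only: of_nat_le_iff)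
      also have "\<dots> \<longleftrightarrow> a \<le> real (x - 1)"
        unfolding a_def by (simp add: field_simps)
      finally show ?thesis .
    qed
    also have "4 ^ m * (x - 1) < (d + 1) * N \<longleftrightarrow> real (x - 1) < b"
    proof -
      have "4 ^ m * (x - 1) < (d + 1) * N \<longleftrightarrow> real (4 ^ m * (x - 1)) < real ((d + 1) * N)"
        by (simp only: of_nat_less_iff)
      also have "\<dots> \<longleftrightarrow> real (x - 1) < b"
        unfolding b_def by (simp add: field_simps)
      finally show ?thesis .
    qed
    finally show ?thesis .
  qed
  have "b \<le> N"
  proof -
    have "(real d + 1) * N \<le> 4 ^ m * real N"
      using mult_right_mono[OF of_nat_mono[OF d'], of "real N"] by (simp add: algebra_simps)
    then show ?thesis by (simp add: b_def field_simps)
  qed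
  have "0 \<le> a" by (simp add: a_def)
  have ab: "b - a = N / 4 ^ m" "a \<le> b" by (simp_all add: a_def b_def field_simps)
  have "{x\<in>{1..N}. vertex_column N m x = d} = Suc ` {nat \<lceil>a\<rceil>..<nat \<lceil>b\<rceil>}"
  proof (intro equalityI subsetI)
    fix x assume "x \<in> {x\<in>{1..N}. vertex_column N m x = d}"
    then have x: "x \<ge> 1" "a \<le> real (x - 1)" "real (x - 1) < b" by (auto simp: iff)
    then have "nat \<lceil>a\<rceil> \<le> x - 1" "x - 1 < nat \<lceil>b\<rceil>"
      by (simp_all only: nat_ceiling_le_eq not_le[symmetric]) auto
    then show "x \<in> Suc ` {nat \<lceil>a\<rceil>..<nat \<lceil>b\<rceil>}" using x by (intro image_eqI[of _ _ "x - 1"]) auto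
  next
    fix x assume "x \<in> Suc ` {nat \<lceil>a\<rceil>..<nat \<lceil>b\<rceil>}"
    then obtain t where "x = Suc t" "t \<in> {nat \<lceil>a\<rceil>..<nat \<lceil>b\<rceil>}" by blast
    then have t: "x = Suc t" "nat \<lceil>a\<rceil> \<le> t" "t < nat \<lceil>b\<rceil>" by simp_all
    then have "a \<le> real t" "real t < b"
      by (simp_all only: nat_ceiling_le_eq not_le[symmetric]) auto
    then show "x \<in> {x\<in>{1..N}. vertex_column N m x = d}"
      using t \<open>b \<le> N\<close> by (auto simp: iff)
  qed
  then have "card {x\<in>{1..N}. vertex_column N m x = d} = nat \<lceil>b\<rceil> - nat \<lceil>a\<rceil>"
    by (simp add: card_image)
  also have "real \<dots> = real_of_int \<lceil>b\<rceil> - real_of_int \<lceil>a\<rceil>"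
  proof -
    have "\<lceil>a\<rceil> \<le> \<lceil>b\<rceil>" "0 \<le> \<lceil>a\<rceil>"
      using ceiling_mono[OF ab(2)] ceiling_mono[OF \<open>0 \<le> a\<close>] by simp_all
    then show ?thesis by linarith
  qed
  finally have "\<bar>real (card {x\<in>{1..N}. vertex_column N m x = d}) - N / 4 ^ m\<bar> \<le> 1"
    using ab ceiling_correct[of a] ceiling_correct[of b] by linarith
  then have "\<bar>real (card {x\<in>{1..N}. vertex_column N m x = d}) - N / 4 ^ m\<bar> / N \<le> 1 / N"
    by (intro divide_right_mono) auto
  moreover have "card {x\<in>{1..N}. vertex_column N m x = d} / real N - 1 / 4 ^ m =
      (real (card {x\<in>{1..N}. vertex_column N m x = d}) - N / 4 ^ m) / N"
    using N by (simp add: diff_divide_distrib)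
  ultimately show ?thesis
    by (simp only: abs_divide abs_of_nat)
qed

text \<open>
  The order condition is the sum over \<open>t\<close> of the products of the conditions \<open>col x = t\<close> and
  \<open>t < col y\<close>, and each product can be absorbed into the test functions.
\<close>

lemma abs_sum_ordered_le_cut:
  fixes D :: "'a \<Rightarrow> 'a \<Rightarrow> real" and col :: "'a \<Rightarrow> nat"
  assumes V: "finite V" and f: "\<And>x. f x \<in> {0..1}" and g: "\<And>x. g x \<in> {0..1}"
    and col: "\<And>x. x \<in> V \<Longrightarrow> col x < K"
    and cut: "\<And>S T. S \<subseteq> V \<Longrightarrow> T \<subseteq> V \<Longrightarrow> \<bar>\<Sum>x\<in>S. \<Sum>y\<in>T. D x y\<bar> \<le> \<delta>"
  shows "\<bar>\<Sum>x\<in>V. \<Sum>y\<in>V. f x * g y * (of_bool (col x < col y) * D x y)\<bar> \<le> K * \<delta>"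
proof -
  have "(\<Sum>x\<in>V. \<Sum>y\<in>V. f x * g y * (of_bool (col x < col y) * D x y)) =
      (\<Sum>x\<in>V. \<Sum>y\<in>V. \<Sum>t<K. (f x * of_bool (col x = t)) * (g y * of_bool (t < col y)) * D x y)"
  proof (intro sum.cong refl)
    fix x y assume "x \<in> V"
    have "(\<Sum>t<K. (f x * of_bool (col x = t)) * (g y * of_bool (t < col y)) * D x y) =
        (\<Sum>t<K. if col x = t then f x * g y * (of_bool (col x < col y) * D x y) else 0)"
      by (intro sum.cong) auto
    then show "f x * g y * (of_bool (col x < col y) * D x y) =
        (\<Sum>t<K. (f x * of_bool (col x = t)) * (g y * of_bool (t < col y)) * D x y)"
      using col[OF \<open>x \<in> V\<close>] by simp
  qed
  also have "\<dots> = (\<Sum>x\<in>V. \<Sum>t<K. \<Sum>y\<in>V. (f x * of_bool (col x = t)) * (g y * of_bool (t < col y)) * D x y)"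
    by (intro sum.cong refl sum.swap)
  also have "\<dots> = (\<Sum>t<K. \<Sum>x\<in>V. \<Sum>y\<in>V. (f x * of_bool (col x = t)) * (g y * of_bool (t < col y)) * D x y)"
    by (rule sum.swap)
  also have "\<bar>\<dots>\<bar> \<le> (\<Sum>t<K. \<delta>)"
  proof (rule order_trans[OF sum_abs], rule sum_mono)
    fix t
    show "\<bar>\<Sum>x\<in>V. \<Sum>y\<in>V. (f x * of_bool (col x = t)) * (g y * of_bool (t < col y)) * D x y\<bar> \<le> \<delta>"
      using f g by (intro abs_sum_weighted_le_cut V cut) auto
  qed
  finally show ?thesis by simp
qed

lemma (in prob_space) integral_same_label:
  assumes \<kappa>: "\<kappa> \<in> measurable M (count_space UNIV)" and C: "finite C" "\<And>x. x \<in> space M \<Longrightarrow> \<kappa> x \<in> C"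
  shows "(\<integral>x. (\<integral>y. of_bool (\<kappa> x = \<kappa> y) \<partial>M) \<partial>M) = (\<Sum>c\<in>C. (measure M {x\<in>space M. \<kappa> x = c})\<^sup>2)"
proof -
  let ?q = "\<lambda>c. measure M {x\<in>space M. \<kappa> x = c}"
  have "(\<integral>y. of_bool (\<kappa> x = \<kappa> y) \<partial>M) = ?q (\<kappa> x)" if "x \<in> space M" for x
  proof -
    have "(\<integral>y. of_bool (\<kappa> x = \<kappa> y) \<partial>M) = (\<Sum>c\<in>C. of_bool (\<kappa> x = c) * ?q c)"
      by (rule integral_finite_range[OF assms])
    also have "\<dots> = (\<Sum>c\<in>C. if \<kappa> x = c then ?q c else 0)" by (intro sum.cong) auto
    finally show ?thesis using C that by simp
  qed
  then have "(\<integral>x. (\<integral>y. of_bool (\<kappa> x = \<kappa> y) \<partial>M) \<partial>M) = (\<integral>x. ?q (\<kappa> x) \<partial>M)"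
    by (intro Bochner_Integration.integral_cong) auto
  also have "\<dots> = (\<Sum>c\<in>C. ?q c * ?q c)" by (rule integral_finite_range[OF assms])
  finally show ?thesis by (simp add: power2_eq_square)
qed

lemma (in prob_space) unit_kernel_same_label:
  fixes \<kappa> :: "'a \<Rightarrow> nat"
  assumes \<kappa> [measurable]: "\<kappa> \<in> measurable M (count_space UNIV)"
  shows "unit_kernel M (\<lambda>x y. of_bool (\<kappa> x = \<kappa> y))"
proof -
  have "{u \<in> space (M \<Otimes>\<^sub>M M). real (\<kappa> (fst u)) = real (\<kappa> (snd u))} \<in> sets (M \<Otimes>\<^sub>M M)"
    by measurable
  then have "{u \<in> space (M \<Otimes>\<^sub>M M). \<kappa> (fst u) = \<kappa> (snd u)} \<in> sets (M \<Otimes>\<^sub>M M)"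
    by simp
  then have "(\<lambda>u. of_bool (\<kappa> (fst u) = \<kappa> (snd u)) :: real) \<in> borel_measurable (M \<Otimes>\<^sub>M M)"
    by measurable
  then show ?thesis by (simp add: unit_kernel_def split_beta')
qed

lemma unit_kernel_uniform_count:
  assumes "finite V" "\<And>x y. U x y \<in> {0..1}"
  shows "unit_kernel (uniform_count_measure V) U"
  using assms by (auto simp: unit_kernel_def measurable_uniform_count_measure_pair)

section \<open>Graphs with convergent cell data\<close>

abbreviation vertices :: "ordered_graph \<Rightarrow> nat set" where
  "vertices G \<equiv> {1..nverts G}"

definition edge_indicator :: "ordered_graph \<Rightarrow> nat \<Rightarrow> nat \<Rightarrow> real" where
  "edge_indicator G x y = of_bool (adj G x y)"

lemma edge_indicator_bounds: "edge_indicator H x y \<in> {0..1}"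
  by (simp add: edge_indicator_def)

lemma cell_average_edge_bounds: "cell_average (vertices H) \<kappa> (edge_indicator H) c d \<in> {0..1}"
  unfolding atLeastAtMost_iff[of "cell_average _ _ _ _ _"]
  by (intro conjI cell_average_bounds edge_indicator_bounds finite_atLeastAtMost)

lemma energy_edge_bounds: "energy (vertices H) \<kappa> (edge_indicator H) \<in> {0..1}"
  unfolding atLeastAtMost_iff[of "energy _ _ _"]
  by (intro conjI energy_bounds edge_indicator_bounds finite_atLeastAtMost)

definition refining_labels :: "ordered_graph \<Rightarrow> (nat \<Rightarrow> nat \<Rightarrow> nat \<times> nat) \<Rightarrow> bool" where
  "refining_labels G \<kappa> \<longleftrightarrow>
     (\<forall>m. \<forall>x\<in>vertices G. \<kappa> m x \<in> grid m) \<and>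
     (\<forall>m x. fst (\<kappa> m x) = vertex_column (nverts G) m x) \<and>
     (\<forall>l m x. l \<le> m \<longrightarrow> \<kappa> l x = coarsen (m - l) (\<kappa> m x)) \<and>
     (\<forall>m. energy_controls_cut (vertices G) (edge_indicator G) (\<kappa> m) (\<kappa> (Suc m)))"

lemma ex_refining_labels: "\<exists>\<kappa>. refining_labels G \<kappa>"
proof -
  let ?V = "vertices G" and ?N = "nverts G" and ?g = "edge_indicator G"
  have col: "vertex_column ?N m x = vertex_column ?N (Suc m) x div 4" for m x
    by (rule vertex_column_Suc)
  obtain z :: "nat \<Rightarrow> nat \<Rightarrow> nat" where z0: "\<And>x. z 0 x = 0"
    and zdiv: "\<And>m x. z m x = z (Suc m) x div 4"
    and cut: "\<And>m. energy_controls_cut ?V ?g (\<lambda>x. (vertex_column ?N m x, z m x))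
      (\<lambda>x. (vertex_column ?N (Suc m) x, z (Suc m) x))"
    using greedy_label_sequence[where V="?V" and col="vertex_column ?N" and g="?g", OF finite_atLeastAtMost col]
    by blast
  define \<kappa> where "\<kappa> m x = (vertex_column ?N m x, z m x)" for m x
  have iterate: "h l x = h m x div 4 ^ (m - l)" if "\<And>m x. h m x = h (Suc m) x div 4" "l \<le> m"
    for h :: "nat \<Rightarrow> nat \<Rightarrow> nat" and l m x
    using that(2)
  proof (induction m rule: dec_induct)
    case (step m)
    have "h l x = (h (Suc m) x div 4) div 4 ^ (m - l)"
      using step.IH by (simp only: that(1)[of m x, symmetric])
    also have "\<dots> = h (Suc m) x div 4 ^ (Suc m - l)"
      using step.hyps by (simp add: div_mult2_eq[symmetric] Suc_diff_le)
    finally show ?case .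
  qed simp
  have z_less: "z m x < 4 ^ m" for m x
    using iterate[where h=z, OF zdiv, of 0 m x] z0[of x] by (simp add: div_eq_0_iff)
  have "refining_labels G \<kappa>"
    unfolding refining_labels_def
  proof (intro conjI allI ballI impI)
    show "\<kappa> m x \<in> grid m" if "x \<in> ?V" for m x
      using vertex_column_less[OF that] z_less by (simp add: \<kappa>_def grid_def)
    show "fst (\<kappa> m x) = vertex_column ?N m x" for m x by (simp add: \<kappa>_def)
    show "\<kappa> l x = coarsen (m - l) (\<kappa> m x)" if "l \<le> m" for l m x
      using iterate[where h=z, OF zdiv that, of x] iterate[where h="vertex_column ?N", OF col that, of x] by (simp add: \<kappa>_def coarsen_def)
    have "\<kappa> m = (\<lambda>x. (vertex_column ?N m x, z m x))" for m by (auto simp: \<kappa>_def)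
    then show "energy_controls_cut ?V ?g (\<kappa> m) (\<kappa> (Suc m))" for m
      using cut[of m] by simp
  qed
  then show ?thesis by blast
qed

text \<open>
  A sequence of growing graphs with labels as above for which all cell masses, all edge densities
  between cells and all energies converge.
\<close>

locale convergent_labels =
  fixes G :: "nat \<Rightarrow> ordered_graph"
    and \<kappa> :: "nat \<Rightarrow> nat \<Rightarrow> nat \<Rightarrow> nat \<times> nat"
    and p :: "nat \<Rightarrow> nat \<times> nat \<Rightarrow> real"
    and w :: "nat \<Rightarrow> nat \<times> nat \<Rightarrow> nat \<times> nat \<Rightarrow> real"
    and e :: "nat \<Rightarrow> real"
  assumes ordered: "is_ordered_graph (G n)"
    and size_pos: "nverts (G n) > 0"
    and size_lim: "filterlim (\<lambda>n. nverts (G n)) at_top sequentially"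
    and labels: "refining_labels (G n) (\<kappa> n)"
    and mass_lim: "(\<lambda>n. cell_mass (vertices (G n)) (\<kappa> n m) c) \<longlonglongrightarrow> p m c"
    and average_lim: "(\<lambda>n. cell_average (vertices (G n)) (\<kappa> n m) (edge_indicator (G n)) c d) \<longlonglongrightarrow> w m c d"
    and energy_lim: "(\<lambda>n. energy (vertices (G n)) (\<kappa> n m) (edge_indicator (G n))) \<longlonglongrightarrow> e m"
begin

abbreviation V :: "nat \<Rightarrow> nat set" where "V n \<equiv> vertices (G n)"
abbreviation N :: "nat \<Rightarrow> nat" where "N n \<equiv> nverts (G n)"
abbreviation g :: "nat \<Rightarrow> nat \<Rightarrow> nat \<Rightarrow> real" where "g n \<equiv> edge_indicator (G n)"

lemma \<kappa>_grid: "x \<in> V n \<Longrightarrow> \<kappa> n m x \<in> grid m"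
  using labels[of n] by (simp add: refining_labels_def)

lemma \<kappa>_column: "fst (\<kappa> n m x) = vertex_column (N n) m x"
  using labels[of n] by (simp add: refining_labels_def)

lemma \<kappa>_nested: "l \<le> m \<Longrightarrow> \<kappa> n l x = coarsen (m - l) (\<kappa> n m x)"
  using labels[of n] unfolding refining_labels_def by blast

lemma cut: "S \<subseteq> V n \<Longrightarrow> T \<subseteq> V n \<Longrightarrow>
      \<bar>\<Sum>x\<in>S. \<Sum>y\<in>T. g n x y -
          cell_average (V n) (\<kappa> n m) (g n) (\<kappa> n m x) (\<kappa> n m y)\<bar>
       \<le> (real (N n))\<^sup>2 * sqrt (energy (V n) (\<kappa> n (Suc m)) (g n) -
            energy (V n) (\<kappa> n m) (g n))"
proof -
  have "energy_controls_cut (V n) (g n) (\<kappa> n m) (\<kappa> n (Suc m))"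
    using labels[of n] unfolding refining_labels_def by blast
  moreover assume "S \<subseteq> V n" "T \<subseteq> V n"
  ultimately show ?thesis
    unfolding energy_controls_cut_def by (simp add: One_nat_def)
qed

lemma column_mass_lim:
  assumes "i < 4 ^ m"
  shows "(\<lambda>n. card {x\<in>V n. vertex_column (N n) m x = i} / N n) \<longlonglongrightarrow> 1 / 4 ^ m"
proof -
  have "(\<lambda>n. 1 / real (N n)) \<longlonglongrightarrow> 0"
    by (intro real_tendsto_divide_at_top[OF tendsto_const] filterlim_compose[OF filterlim_real_sequentially size_lim])
  then have "(\<lambda>n. card {x\<in>V n. vertex_column (N n) m x = i} / N n - 1 / 4 ^ m) \<longlonglongrightarrow> 0"
    by (rule Lim_null_comparison[rotated])
       (use card_vertex_column[OF size_pos assms] in \<open>simp add: always_eventually\<close>)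
  then show ?thesis by (simp add: LIM_zero_iff)
qed

sublocale cell_limit p w
proof
  fix m c assume "c \<in> grid m"
  show "0 \<le> p m c"
    by (rule LIMSEQ_le_const[OF mass_lim]) (simp add: cell_mass_def)
next
  fix l m c assume lm: "l \<le> m" and c: "c \<in> grid l"
  have "cell_mass (V n) (\<kappa> n l) c =
      (\<Sum>c'\<in>{c'\<in>grid m. coarsen (m - l) c' = c}. cell_mass (V n) (\<kappa> n m) c')" for n
    by (rule cell_mass_refinement) (auto intro: \<kappa>_nested lm \<kappa>_grid)
  then have "(\<lambda>n. \<Sum>c'\<in>{c'\<in>grid m. coarsen (m - l) c' = c}. cell_mass (V n) (\<kappa> n m) c') \<longlonglongrightarrow> p l c"
    using mass_lim[of l c] by simp
  moreover have "(\<lambda>n. \<Sum>c'\<in>{c'\<in>grid m. coarsen (m - l) c' = c}. cell_mass (V n) (\<kappa> n m) c')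
      \<longlonglongrightarrow> (\<Sum>c'\<in>{c'\<in>grid m. coarsen (m - l) c' = c}. p m c')"
    by (intro tendsto_sum mass_lim)
  ultimately show "p l c = (\<Sum>c'\<in>{c'\<in>grid m. coarsen (m - l) c' = c}. p m c')"
    by (rule LIMSEQ_unique)
next
  fix i m :: nat assume i: "i < 4 ^ m"
  have "(\<Sum>t<4 ^ m. cell_mass (V n) (\<kappa> n m) (i, t)) =
      card {x\<in>V n. vertex_column (N n) m x = i} / N n" for n
  proof -
    let ?A = "{x\<in>V n. vertex_column (N n) m x = i}"
    have "cell (V n) (\<kappa> n m) (i, t) = {x\<in>?A. snd (\<kappa> n m x) = t}" for t
      using \<kappa>_column[of n m] by (auto simp: cell_def prod_eq_iff)
    then have "(\<Sum>t<4 ^ m. real (card (cell (V n) (\<kappa> n m) (i, t)))) =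
        (\<Sum>t<4 ^ m. \<Sum>x\<in>{x\<in>?A. snd (\<kappa> n m x) = t}. 1)" by simp
    also have "\<dots> = (\<Sum>x\<in>?A. 1)"
      using \<kappa>_grid[of _ n m] by (intro sum.group) (auto simp: grid_def mem_Times_iff)
    finally show ?thesis by (simp add: cell_mass_def sum_divide_distrib[symmetric])
  qed
  then have "(\<lambda>n. \<Sum>t<4 ^ m. cell_mass (V n) (\<kappa> n m) (i, t)) \<longlonglongrightarrow> 1 / 4 ^ m"
    using column_mass_lim[OF i] by simp
  moreover have "(\<lambda>n. \<Sum>t<4 ^ m. cell_mass (V n) (\<kappa> n m) (i, t)) \<longlonglongrightarrow> (\<Sum>t<4 ^ m. p m (i, t))"
    by (intro tendsto_sum mass_lim)
  ultimately show "(\<Sum>t<4 ^ m. p m (i, t)) = 1 / 4 ^ m"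
    by (rule LIMSEQ_unique[rotated])
next
  fix m c d
  show "w m c d \<in> {0..1}"
    by (rule Lim_in_closed_set[OF closed_atLeastAtMost _ sequentially_bot average_lim[of m c d]],
        intro always_eventually allI cell_average_edge_bounds)
next
  fix m c d
  have "cell_average (V n) (\<kappa> n m) (g n) c d =
      cell_average (V n) (\<kappa> n m) (g n) d c" for n
    using ordered[of n] by (intro cell_average_sym) (auto simp: edge_indicator_def is_ordered_graph_def)
  then show "w m c d = w m d c"
    using average_lim[of m c d] average_lim[of m d c] by (auto intro: LIMSEQ_unique)
next
  fix l m c d assume lm: "l \<le> m" and "c \<in> grid l" "d \<in> grid l"
  let ?p = "\<lambda>n m. cell_mass (V n) (\<kappa> n m)"
  let ?w = "\<lambda>n m. cell_average (V n) (\<kappa> n m) (g n)"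
  let ?R = "\<lambda>c. {c'\<in>grid m. coarsen (m - l) c' = c}"
  have "?p n l c * ?p n l d * ?w n l c d =
      (\<Sum>c'\<in>?R c. \<Sum>d'\<in>?R d. ?p n m c' * ?p n m d' * ?w n m c' d')" for n
    by (rule mass_average_refinement) (auto intro: \<kappa>_nested lm \<kappa>_grid)
  moreover have "(\<lambda>n. ?p n l c * ?p n l d * ?w n l c d) \<longlonglongrightarrow> p l c * p l d * w l c d"
    by (intro tendsto_mult mass_lim average_lim)
  ultimately have "(\<lambda>n. \<Sum>c'\<in>?R c. \<Sum>d'\<in>?R d. ?p n m c' * ?p n m d' * ?w n m c' d') \<longlonglongrightarrow> p l c * p l d * w l c d"
    by simp
  moreover have "(\<lambda>n. \<Sum>c'\<in>?R c. \<Sum>d'\<in>?R d. ?p n m c' * ?p n m d' * ?w n m c' d') \<longlonglongrightarrow>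
      (\<Sum>c'\<in>?R c. \<Sum>d'\<in>?R d. p m c' * p m d' * w m c' d')"
    by (intro tendsto_sum tendsto_mult mass_lim average_lim)
  ultimately show "p l c * p l d * w l c d = (\<Sum>c'\<in>?R c. \<Sum>d'\<in>?R d. p m c' * p m d' * w m c' d')"
    by (rule LIMSEQ_unique)
qed

abbreviation vertex_measure :: "nat \<Rightarrow> nat measure" where
  "vertex_measure n \<equiv> uniform_count_measure (V n)"

abbreviation step :: "nat \<Rightarrow> nat \<Rightarrow> nat \<times> nat \<Rightarrow> nat \<times> nat \<Rightarrow> real" where
  "step n m \<equiv> cell_average (V n) (\<kappa> n m) (g n)"

abbreviation same_column :: "nat \<Rightarrow> nat \<Rightarrow> real" where
  "same_column n l \<equiv> (\<Sum>c<4 ^ l. (card {x\<in>V n. vertex_column (N n) l x = c} / N n)\<^sup>2)"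

text \<open>
  The order of two addresses, as far as their columns show it after \<open>k\<close> digits are dropped.
\<close>

definition cell_less :: "nat \<Rightarrow> nat \<times> nat \<Rightarrow> nat \<times> nat \<Rightarrow> bool" where
  "cell_less k c d \<longleftrightarrow> fst (coarsen k c) < fst (coarsen k d)"

lemma vertices_nonempty: "V n \<noteq> {}"
  using size_pos[of n] by auto

lemma prob_space_vertex_measure: "prob_space (vertex_measure n)"
  by (rule uniform_count_measure_simps(1)[OF finite_atLeastAtMost vertices_nonempty])

lemma measure_vertices:
  "measure (vertex_measure n) {x \<in> space (vertex_measure n). P x} = card {x \<in> V n. P x} / N n"
proof -
  have "measure (vertex_measure n) {x \<in> V n. P x} = card {x \<in> V n. P x} / card (V n)"
    by (rule uniform_count_measure_simps(3)[OF finite_atLeastAtMost vertices_nonempty]) auto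
  then show ?thesis by (simp only: space_uniform_count_measure card_atLeastAtMost diff_Suc_1 Suc_eq_plus1 add_diff_cancel_right')
qed

lemma unit_kernel_vertex:
  assumes "\<And>x y. U x y \<in> {0..1}"
  shows "unit_kernel (vertex_measure n) (pattern_kernel F R U q)"
  using assms by (intro unit_kernel_uniform_count) (auto simp: pattern_kernel_def)

text \<open>
  The order of two vertices and the order of their columns disagree only if the columns are equal.
\<close>

lemma order_error:
  "\<bar>pair_integral k (vertex_measure n) (pattern_kernel F (<) (g n)) -
    pair_integral k (vertex_measure n) (pattern_kernel F
      (\<lambda>x y. vertex_column (N n) l x < vertex_column (N n) l y) (g n))\<bar>
   \<le> card (vertex_pairs k) * same_column n l"
proof -
  let ?M = "vertex_measure n" and ?N = "N n"
  let ?D = "\<lambda>x y. of_bool (vertex_column ?N l x = vertex_column ?N l y) :: real"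
  interpret M: prob_space ?M by (rule prob_space_vertex_measure)
  have sp: "space ?M = V n" by (simp add: space_uniform_count_measure)
  have "(\<integral>x. (\<integral>y. ?D x y \<partial>?M) \<partial>?M) =
      (\<Sum>c\<in>{..<4 ^ l}. (measure ?M {x\<in>space ?M. vertex_column ?N l x = c})\<^sup>2)"
    using vertex_column_less
    by (intro M.integral_same_label) (auto simp: sp measurable_def sets_uniform_count_measure)
  also have "\<dots> = same_column n l"
    by (simp only: measure_vertices)
  finally have D: "(\<integral>x. (\<integral>y. ?D x y \<partial>?M) \<partial>?M) = same_column n l" .
  have "\<bar>pattern_kernel F (<) (g n) q x y -
      pattern_kernel F (\<lambda>x y. vertex_column ?N l x < vertex_column ?N l y) (g n) q x y\<bar> \<le> ?D x y"
    for q x y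
  proof (rule order_trans[OF pattern_kernel_order_diff_le])
    show "(of_bool ((x < y) \<noteq> (vertex_column ?N l x < vertex_column ?N l y)) :: real) \<le> ?D x y"
      using vertex_column_mono[of x y ?N l] vertex_column_mono[of y x ?N l] by auto
  qed (use edge_indicator_bounds in auto)
  moreover have "unit_kernel ?M ?D"
    by (rule unit_kernel_uniform_count) auto
  ultimately show ?thesis
    unfolding D[symmetric]
    by (intro M.counting_lemma_L1 unit_kernel_vertex edge_indicator_bounds)
qed

text \<open>
  Averaging at level \<open>m\<close> costs the cut distance, multiplied by the number \<open>4 ^ l\<close> of columns through
  which the order is observed. The columns stay at the coarser level \<open>l\<close>, so that this factor is fixed
  while the cut distance tends to 0.
\<close>

lemma cut_error:
  assumes lm: "l \<le> m"
  shows "\<bar>pair_integral k (vertex_measure n) (pattern_kernel F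
      (\<lambda>x y. vertex_column (N n) l x < vertex_column (N n) l y) (g n)) -
    pair_integral k (vertex_measure n) (\<lambda>q x y. pattern_kernel F (cell_less (m - l)) (step n m) q (\<kappa> n m x) (\<kappa> n m y))\<bar>
   \<le> card (vertex_pairs k) * (4 ^ l * sqrt (energy (V n) (\<kappa> n (Suc m)) (g n) -
            energy (V n) (\<kappa> n m) (g n)))"
proof -
  let ?M = "vertex_measure n" and ?N = "N n" and ?V = "V n"
  let ?g = "g n" and ?col = "vertex_column (N n) l"
  let ?\<epsilon> = "sqrt (energy ?V (\<kappa> n (Suc m)) ?g - energy ?V (\<kappa> n m) ?g)"
  let ?s = "\<lambda>x y. step n m (\<kappa> n m x) (\<kappa> n m y)"
  let ?a = "pattern_kernel F (\<lambda>x y. ?col x < ?col y) ?g" and ?b = "pattern_kernel F (\<lambda>x y. ?col x < ?col y) ?s"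
  interpret M: prob_space ?M by (rule prob_space_vertex_measure)
  have "fst (coarsen (m - l) (\<kappa> n m x)) = ?col x" for x
    using \<kappa>_nested[OF lm, of n x] \<kappa>_column[of n l x] by simp
  then have eq: "pattern_kernel F (cell_less (m - l)) (step n m) q (\<kappa> n m x) (\<kappa> n m y) =
      ?b q x y" for q x y
    by (simp add: pattern_kernel_def cell_less_def)
  \<comment> \<open>The sign is negative for non-edges of \<open>F\<close>, where the factor is one minus the kernel.\<close>
  have diff: "\<exists>\<sigma>\<in>{1, -1}. \<forall>x y. ?a q x y - ?b q x y = \<sigma> * (of_bool (?col x < ?col y) * (?g x y - ?s x y))" for q
    by (cases "adj F (fst q) (snd q)") (auto simp: pattern_kernel_def algebra_simps)
  show ?thesis
    unfolding eq
  proof (rule M.counting_lemma)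
    fix q and f h :: "nat \<Rightarrow> real" assume f: "\<And>x. f x \<in> {0..1}" and h: "\<And>x. h x \<in> {0..1}"
    obtain \<sigma> where \<sigma>: "\<sigma> \<in> {1, -1 :: real}" and d: "\<And>x y. ?a q x y - ?b q x y = \<sigma> * (of_bool (?col x < ?col y) * (?g x y - ?s x y))"
      using diff[of q] by blast
    define Z where "Z = (\<Sum>x\<in>?V. \<Sum>y\<in>?V. f x * h y * (of_bool (?col x < ?col y) * (?g x y - ?s x y)))"
    have "(\<integral>x. (\<integral>y. f x * h y * (?a q x y - ?b q x y) \<partial>?M) \<partial>?M) = \<sigma> * Z / (real ?N)\<^sup>2"
      unfolding d uniform_count_measure_simps(2)[OF finite_atLeastAtMost vertices_nonempty] Z_def
      by (simp add: sum_divide_distrib sum_distrib_left power2_eq_square mult_ac)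
    moreover have "\<bar>\<sigma> * Z / (real ?N)\<^sup>2\<bar> = \<bar>Z\<bar> / (real ?N)\<^sup>2"
      using \<sigma> by (auto simp: abs_mult)
    moreover have "\<bar>Z\<bar> / (real ?N)\<^sup>2 \<le> real (4 ^ l) * ((real ?N)\<^sup>2 * ?\<epsilon>) / (real ?N)\<^sup>2"
    proof (rule divide_right_mono)
      show "\<bar>Z\<bar> \<le> real (4 ^ l) * ((real ?N)\<^sup>2 * ?\<epsilon>)"
        unfolding Z_def
        by (rule abs_sum_ordered_le_cut[OF finite_atLeastAtMost f h vertex_column_less cut]) auto
    qed simp
    moreover have "real (4 ^ l) * ((real ?N)\<^sup>2 * ?\<epsilon>) / (real ?N)\<^sup>2 = 4 ^ l * ?\<epsilon>"
      using size_pos[of n] by simp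
    ultimately show "\<bar>\<integral>x. (\<integral>y. f x * h y * (?a q x y - ?b q x y) \<partial>?M) \<partial>?M\<bar> \<le> 4 ^ l * ?\<epsilon>"
      by (simp only:)
  qed (intro unit_kernel_vertex edge_indicator_bounds cell_average_edge_bounds)+
qed

text \<open>
  Both sides are the same polynomial in cell masses and edge densities, evaluated at the values for the
  \<open>n\<close>-th graph and at their limits.
\<close>

lemma step_density_lim:
  "(\<lambda>n. pair_integral k (vertex_measure n) (\<lambda>q x y. pattern_kernel F R (step n m) q (\<kappa> n m x) (\<kappa> n m y))) \<longlonglongrightarrow>
   pair_integral k uniform_square (\<lambda>q u v. pattern_kernel F R (w m) q (address m u) (address m v))"
proof -
  let ?E = "{1..k} \<rightarrow>\<^sub>E grid m"
  have 1: "pair_integral k (vertex_measure n) (\<lambda>q x y. pattern_kernel F R (step n m) q (\<kappa> n m x) (\<kappa> n m y)) =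
     (\<Sum>c\<in>?E. (\<Prod>i\<in>{1..k}. cell_mass (V n) (\<kappa> n m) (c i)) *
       (\<Prod>q\<in>vertex_pairs k. pattern_kernel F R (step n m) q (c (fst q)) (c (snd q))))" for n
  proof -
    interpret M: prob_space "vertex_measure n" by (rule prob_space_vertex_measure)
    have "measure (vertex_measure n) {x\<in>space (vertex_measure n). \<kappa> n m x = c} = cell_mass (V n) (\<kappa> n m) c" for c
      by (simp add: measure_vertices[of n "\<lambda>x. \<kappa> n m x = c"] cell_mass_def cell_def)
    then show ?thesis
      using \<kappa>_grid by (subst M.pair_integral_step[where C="grid m"])
        (auto simp: space_uniform_count_measure measurable_def sets_uniform_count_measure)
  qed
  have 2: "pair_integral k uniform_square (\<lambda>q u v. pattern_kernel F R (w m) q (address m u) (address m v)) =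
     (\<Sum>c\<in>?E. (\<Prod>i\<in>{1..k}. p m (c i)) *
       (\<Prod>q\<in>vertex_pairs k. pattern_kernel F R (w m) q (c (fst q)) (c (snd q))))"
  proof (subst SQ.pair_integral_step[OF measurable_address finite_grid address_grid], intro sum.cong refl arg_cong2[where f="(*)"] prod.cong)
    fix c i assume "c \<in> ?E" "i \<in> {1..k}"
    then show "measure uniform_square {u\<in>space uniform_square. address m u = c i} = p m (c i)"
      by (intro measure_address) auto
  qed
  have "(\<lambda>n. pattern_kernel F R (step n m) q c d) \<longlonglongrightarrow> pattern_kernel F R (w m) q c d" for q c d
    unfolding pattern_kernel_def by (cases "adj F (fst q) (snd q)") (auto intro!: tendsto_intros average_lim)
  then show ?thesis
    unfolding 1 2 by (intro tendsto_sum tendsto_mult tendsto_prod mass_lim)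
qed

lemma measurable_column_fst: "(\<lambda>u. column l (fst u)) \<in> measurable uniform_square (count_space UNIV)"
  by measurable

lemma measure_column_square:
  assumes "c < 4 ^ l"
  shows "measure uniform_square {u\<in>space uniform_square. column l (fst u) = c} = 1 / 4 ^ l"
proof -
  have "{u\<in>space uniform_square. column l (fst u) = c} = {u. column l (fst u) = c \<and> layer l u < 4 ^ l}"
    by (simp add: layer_less)
  then show ?thesis using measure_column_layer[OF assms order_refl] p_column[OF assms] by simp
qed

text \<open>
  The step kernel is replaced by its limit \<open>W\<close>, and then the order of the columns by the order of the
  positions.
\<close>

lemma limit_error:
  assumes W: "unit_kernel uniform_square W" and lm: "l \<le> m"
  shows "\<bar>pair_integral k uniform_square (\<lambda>q u v. pattern_kernel F (cell_less (m - l)) (w m) q (address m u) (address m v)) -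
      pair_integral k uniform_square (pattern_kernel F (\<lambda>u v. fst u \<le> fst v) W)\<bar>
    \<le> card (vertex_pairs k) *
       (\<integral>u. (\<integral>v. \<bar>w m (address m u) (address m v) - W u v\<bar> \<partial>uniform_square) \<partial>uniform_square) +
      card (vertex_pairs k) * (1 / 4 ^ l)"
proof -
  let ?S = uniform_square
  let ?less = "\<lambda>u v. column l (fst u) < column l (fst v)"
  let ?w = "\<lambda>u v. w m (address m u) (address m v)"
  have less_sets: "{u \<in> space (?S \<Otimes>\<^sub>M ?S). ?less (fst u) (snd u)} \<in> sets (?S \<Otimes>\<^sub>M ?S)"
  proof -
    have "{u \<in> space (?S \<Otimes>\<^sub>M ?S). real (column l (fst (fst u))) < real (column l (fst (snd u)))} \<in> sets (?S \<Otimes>\<^sub>M ?S)"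
      by measurable
    then show ?thesis by simp
  qed
  have le_sets: "{u \<in> space (?S \<Otimes>\<^sub>M ?S). fst (fst u) \<le> fst (snd u)} \<in> sets (?S \<Otimes>\<^sub>M ?S)"
    by measurable
  have w_kernel: "unit_kernel ?S ?w"
  proof -
    have "(\<lambda>u. (address m (fst u), address m (snd u))) \<in> measurable (?S \<Otimes>\<^sub>M ?S) (count_space UNIV)"
      by (rule measurable_address_pair)
    from measurable_compose[OF this, of "case_prod (w m)" borel]
    show ?thesis using w_bounds by (simp add: unit_kernel_def split_beta')
  qed
  let ?D1 = "\<lambda>u v. \<bar>?w u v - W u v\<bar>"
  have D1: "unit_kernel ?S ?D1"
  proof -
    have "(\<lambda>u. ?D1 (fst u) (snd u)) \<in> borel_measurable (?S \<Otimes>\<^sub>M ?S)"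
      using unit_kernelD(1)[OF w_kernel] unit_kernelD(1)[OF W] by (simp add: split_beta')
    moreover have "?D1 u v \<le> 1" for u v
      using unit_kernelD(2,3)[OF w_kernel, of u v] unit_kernelD(2,3)[OF W, of u v] by linarith
    ultimately show ?thesis by (simp add: unit_kernel_def split_beta')
  qed
  have "cell_less (m - l) (address m u) (address m v) = ?less u v" for u v
    unfolding cell_less_def coarsen_def address_def using column_nested[OF lm] by simp
  then have eq: "pattern_kernel F (cell_less (m - l)) (w m) q (address m u) (address m v) =
      pattern_kernel F ?less ?w q u v" for q u v
    by (simp add: pattern_kernel_def)
  have w_error: "\<bar>pair_integral k ?S (pattern_kernel F ?less ?w) - pair_integral k ?S (pattern_kernel F ?less W)\<bar>
      \<le> card (vertex_pairs k) * (\<integral>u. (\<integral>v. ?D1 u v \<partial>?S) \<partial>?S)"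
    by (intro SQ.counting_lemma_L1 unit_kernel_pattern less_sets w_kernel W D1 pattern_kernel_diff_le)
  have less_error: "\<bar>pair_integral k ?S (pattern_kernel F ?less W) - pair_integral k ?S (pattern_kernel F (\<lambda>u v. fst u \<le> fst v) W)\<bar>
      \<le> card (vertex_pairs k) * (\<integral>u. (\<integral>v. of_bool (column l (fst u) = column l (fst v)) \<partial>?S) \<partial>?S)"
  proof (intro SQ.counting_lemma_L1 unit_kernel_pattern less_sets le_sets W
      SQ.unit_kernel_same_label measurable_column_fst)
    fix q and u v :: "real \<times> real"
    have "(of_bool (?less u v \<noteq> (fst u \<le> fst v)) :: real) \<le> of_bool (column l (fst u) = column l (fst v))"
      using column_mono[of "fst u" "fst v" l] column_mono[of "fst v" "fst u" l] by auto
    then show "\<bar>pattern_kernel F ?less W q u v - pattern_kernel F (\<lambda>u v. fst u \<le> fst v) W q u v\<bar>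
        \<le> of_bool (column l (fst u) = column l (fst v))"
      using pattern_kernel_order_diff_le[of W u v F ?less q "\<lambda>u v. fst u \<le> fst v"] unit_kernelD(2,3)[OF W]
      by (meson order_trans)
  qed
  have same: "(\<integral>u. (\<integral>v. of_bool (column l (fst u) = column l (fst v)) \<partial>?S) \<partial>?S) = (1 / 4 ^ l :: real)"
  proof -
    have "(\<integral>u. (\<integral>v. of_bool (column l (fst u) = column l (fst v)) \<partial>?S) \<partial>?S) =
        (\<Sum>c\<in>{..<4 ^ l}. (measure ?S {u\<in>space ?S. column l (fst u) = c})\<^sup>2)"
      by (intro SQ.integral_same_label measurable_column_fst) (auto simp: column_less)
    also have "\<dots> = (\<Sum>c\<in>{..<(4::nat) ^ l}. (1 / 4 ^ l :: real)\<^sup>2)"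
      by (intro sum.cong refl) (simp only: measure_column_square lessThan_iff)
    also have "\<dots> = 1 / 4 ^ l" by (simp add: power2_eq_square)
    finally show ?thesis .
  qed
  show ?thesis unfolding eq using w_error less_error unfolding same by linarith
qed

lemma density_difference_lim:
  "(\<lambda>n. density_graph F (G n) - fact (nverts F) *
      pair_integral (nverts F) (vertex_measure n) (pattern_kernel F (<) (g n))) \<longlonglongrightarrow> 0"
proof (rule Lim_null_comparison)
  let ?k = "nverts F"
  have "filterlim (\<lambda>n. real (N n)) at_top sequentially"
    by (rule filterlim_compose[OF filterlim_real_sequentially size_lim])
  from tendsto_diff[OF tendsto_const tendsto_falling_product[OF this, of ?k], of 1]
  show "(\<lambda>n. 1 - (\<Prod>i<?k. real (N n) - real i) / real (N n) ^ ?k) \<longlonglongrightarrow> 0"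
    by simp
  have eq: "g n = (\<lambda>x y. of_bool (adj (G n) x y))" for n
    by (simp add: edge_indicator_def fun_eq_iff)
  show "\<forall>\<^sub>F n in sequentially. norm (density_graph F (G n) - fact ?k *
      pair_integral ?k (vertex_measure n) (pattern_kernel F (<) (g n)))
      \<le> 1 - (\<Prod>i<?k. real (N n) - real i) / real (N n) ^ ?k"
    unfolding eq increasing_copies_eq_pair_integral[OF size_pos, symmetric] real_norm_def
    by (intro always_eventually allI density_graph_approx size_pos)
qed

lemma energy_increment_lim: "(\<lambda>m. sqrt (e (Suc m) - e m)) \<longlonglongrightarrow> 0"
proof -
  have step_le: "e m \<le> e (Suc m)" for m
  proof (rule LIMSEQ_le[OF energy_lim energy_lim], intro exI allI impI)
    fix n
    let ?x = "\<lambda>m. energy (V n) (\<kappa> n m) (g n)"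
    have "0 \<le> (real (N n))\<^sup>2 * sqrt (?x (Suc m) - ?x m)"
      using cut[of "{}" n "{}" m] by simp
    then have "0 \<le> sqrt (?x (Suc m) - ?x m)"
      using size_pos[of n] by (simp add: zero_le_mult_iff)
    then show "?x m \<le> ?x (Suc m)" by simp
  qed
  have "e m \<le> 1" for m
    using energy_edge_bounds by (intro LIMSEQ_le_const2[OF energy_lim]) auto
  moreover have "incseq e" using step_le by (rule incseq_SucI)
  ultimately obtain L where "e \<longlonglongrightarrow> L" using incseq_convergent[of e 1] by blast
  then have "(\<lambda>m. e (Suc m) - e m) \<longlonglongrightarrow> L - L" by (intro tendsto_diff LIMSEQ_Suc)
  then have "(\<lambda>m. sqrt (e (Suc m) - e m)) \<longlonglongrightarrow> sqrt 0" by (intro tendsto_real_sqrt) simp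
  then show ?thesis by simp
qed

lemma same_column_lim: "(\<lambda>n. same_column n l) \<longlonglongrightarrow> 1 / 4 ^ l"
proof -
  have "(\<lambda>n. same_column n l) \<longlonglongrightarrow> (\<Sum>c<(4::nat) ^ l. (1 / 4 ^ l)\<^sup>2)"
    by (intro tendsto_sum tendsto_power column_mass_lim) simp
  then show ?thesis by (simp add: power2_eq_square)
qed

text \<open>
  The preceding estimates bound the distance between the two densities by four errors. In the limit of
  large \<open>n\<close>, the errors for order at level \<open>l\<close> contribute a multiple of \<open>1 / 4 ^ l\<close>, the averaging error a
  multiple of \<open>4 ^ l * sqrt (e (Suc m) - e m)\<close>, and the step functions contribute their distance from \<open>W\<close>.
  So \<open>l\<close> is chosen first, and then \<open>m\<close>.
\<close>

theorem density_tendsto: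
  assumes W: "unit_kernel uniform_square W"
    and W_lim: "(\<lambda>m. \<integral>u. (\<integral>v. \<bar>w m (address m u) (address m v) - W u v\<bar> \<partial>uniform_square) \<partial>uniform_square) \<longlonglongrightarrow> 0"
  shows "(\<lambda>n. density_graph F (G n)) \<longlonglongrightarrow> density_orderon F W"
proof -
  let ?k = "nverts F" and ?S = uniform_square
  let ?Q = "real (card (vertex_pairs ?k))"
  define T where "T n = pair_integral ?k (vertex_measure n) (pattern_kernel F (<) (g n))" for n
  define T' where "T' = pair_integral ?k ?S (pattern_kernel F (\<lambda>u v. fst u \<le> fst v) W)"
  define A where "A l m n = pair_integral ?k (vertex_measure n)
      (\<lambda>q x y. pattern_kernel F (cell_less (m - l)) (step n m) q (\<kappa> n m x) (\<kappa> n m y))" for l m n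
  define B where "B l m = pair_integral ?k ?S
      (\<lambda>q u v. pattern_kernel F (cell_less (m - l)) (w m) q (address m u) (address m v))" for l m
  define \<epsilon> where "\<epsilon> n m = sqrt (energy (V n) (\<kappa> n (Suc m)) (g n) -
            energy (V n) (\<kappa> n m) (g n))" for n m
  define \<omega> where "\<omega> m = (\<integral>u. (\<integral>v. \<bar>w m (address m u) (address m v) - W u v\<bar> \<partial>?S) \<partial>?S)" for m
  define b where "b l m n = ?Q * same_column n l + ?Q * (4 ^ l * \<epsilon> n m) + \<bar>A l m n - B l m\<bar> +
      (?Q * \<omega> m + ?Q * (1 / 4 ^ l))" for l m n
  define c where "c l m = ?Q * (1 / 4 ^ l) + ?Q * (4 ^ l * sqrt (e (Suc m) - e m)) + 0 +
      (?Q * \<omega> m + ?Q * (1 / 4 ^ l))" for l m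
  have bound: "\<bar>T n - T'\<bar> \<le> b l m n" if "l \<le> m" for n l m
    using order_error[of ?k n F l] cut_error[OF that, of ?k n F] limit_error[OF W that, of ?k F]
    unfolding T_def T'_def A_def B_def \<epsilon>_def \<omega>_def b_def by linarith
  have "(\<lambda>n. \<epsilon> n m) \<longlonglongrightarrow> sqrt (e (Suc m) - e m)" for m
    unfolding \<epsilon>_def by (intro tendsto_real_sqrt tendsto_diff energy_lim)
  moreover have "(\<lambda>n. \<bar>A l m n - B l m\<bar>) \<longlonglongrightarrow> 0" for l m
    unfolding A_def B_def by (intro tendsto_rabs_zero LIM_zero step_density_lim)
  ultimately have b_lim: "b l m \<longlonglongrightarrow> c l m" for l m
    unfolding b_def c_def by (intro tendsto_add tendsto_mult tendsto_const same_column_lim)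
  have c_lim: "c l \<longlonglongrightarrow> ?Q * (1 / 4 ^ l) + ?Q * (4 ^ l * 0) + 0 + (?Q * 0 + ?Q * (1 / 4 ^ l))" for l
    unfolding c_def \<omega>_def by (intro tendsto_add tendsto_mult tendsto_const energy_increment_lim W_lim)
  have "T \<longlonglongrightarrow> T'"
  proof (rule LIMSEQ_I)
    fix \<delta> :: real assume "\<delta> > 0"
    have "(\<lambda>l. ?Q * (1 / 4 ^ l) + (?Q * (1 / 4 ^ l))) \<longlonglongrightarrow> ?Q * 0 + ?Q * 0"
      by (intro tendsto_intros) (auto intro!: LIMSEQ_divide_realpow_zero)
    then have "eventually (\<lambda>l. ?Q * (1 / 4 ^ l) + (?Q * (1 / 4 ^ l)) < \<delta>) sequentially"
      using \<open>\<delta> > 0\<close> by (intro order_tendstoD(2)) auto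
    then obtain l where "?Q * (1 / 4 ^ l) + ?Q * (1 / 4 ^ l) < \<delta>"
      by (auto simp: eventually_sequentially)
    then have "eventually (\<lambda>m. c l m < \<delta>) sequentially"
      by (intro order_tendstoD(2)[OF c_lim]) simp
    then have "eventually (\<lambda>m. l \<le> m \<and> c l m < \<delta>) sequentially"
      using eventually_ge_at_top[of l] by (rule eventually_conj[rotated])
    then obtain m where lm: "l \<le> m" and m: "c l m < \<delta>"
      by (auto simp: eventually_sequentially)
    obtain n0 where n0: "\<And>n. n \<ge> n0 \<Longrightarrow> b l m n < \<delta>"
      using order_tendstoD(2)[OF b_lim m] by (auto simp: eventually_sequentially)
    show "\<exists>n0. \<forall>n\<ge>n0. norm (T n - T') < \<delta>"
      using le_less_trans[OF bound[OF lm] n0] by (intro exI[of _ n0]) auto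
  qed
  then have "(\<lambda>n. fact ?k * T n) \<longlonglongrightarrow> fact ?k * T'" by (intro tendsto_mult tendsto_const)
  from tendsto_add[OF density_difference_lim[of F, folded T_def] this]
  show ?thesis
    unfolding density_orderon_eq_pair_integral[OF W] T'_def[symmetric] by simp
qed

end

section \<open>Compactness\<close>

text \<open>
  The cell masses, the edge densities and the energies of greedy labels are countably many numbers in
  the unit interval for each graph, so they converge along a common subsequence.
\<close>

lemma ordered_graph_compactness_nonempty:
  assumes ordered: "\<And>n. is_ordered_graph (G n)"
    and size_pos: "\<And>n. nverts (G n) > 0"
    and size_lim: "filterlim (\<lambda>n. nverts (G n)) at_top sequentially"
  shows "\<exists>W r. strict_mono (r :: nat \<Rightarrow> nat) \<and> orderon W \<and>
    (\<forall>F. (\<lambda>n. density_graph F (G (r n))) \<longlonglongrightarrow> density_orderon F W)"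
proof -
  have "\<forall>n. \<exists>\<kappa>. refining_labels (G n) \<kappa>"
    using ex_refining_labels by blast
  then obtain \<kappa> where \<kappa>: "\<And>n. refining_labels (G n) (\<kappa> n)"
    using choice[of "\<lambda>n. refining_labels (G n)"] by blast
  define f :: "nat \<Rightarrow> (nat \<times> nat \<times> nat) + (nat \<times> (nat \<times> nat) \<times> (nat \<times> nat)) + nat \<Rightarrow> real" where
    "f n = case_sum (\<lambda>(m, c). cell_mass (vertices (G n)) (\<kappa> n m) c)
       (case_sum (\<lambda>(m, c, d). cell_average (vertices (G n)) (\<kappa> n m) (edge_indicator (G n)) c d)
         (\<lambda>m. energy (vertices (G n)) (\<kappa> n m) (edge_indicator (G n))))" for n
  have mass: "cell_mass (vertices (G n)) (\<kappa> n m) c \<in> {0..1}" for n m c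
  proof -
    have "card (cell (vertices (G n)) (\<kappa> n m) c) \<le> card (vertices (G n))"
      by (intro card_mono) (auto simp: cell_def)
    then show ?thesis by (auto simp: cell_mass_def divide_le_eq_1)
  qed
  have "f n i \<in> {0..1}" for n i
    unfolding f_def
    by (auto split: sum.split simp del: atLeastAtMost_iff intro: mass cell_average_edge_bounds energy_edge_bounds)
  then obtain r where r: "strict_mono r" and conv: "\<And>i. convergent (\<lambda>n. f (r n) i)"
    using bounded_family_convergent_subseq[of f] by blast
  define lim_f where "lim_f i = lim (\<lambda>n. f (r n) i)" for i
  have lim: "(\<lambda>n. f (r n) i) \<longlonglongrightarrow> lim_f i" for i
    using conv[of i] by (simp add: lim_f_def convergent_LIMSEQ_iff)
  interpret convergent_labels "\<lambda>n. G (r n)" "\<lambda>n. \<kappa> (r n)" "\<lambda>m c. lim_f (Inl (m, c))"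
    "\<lambda>m c d. lim_f (Inr (Inl (m, c, d)))" "\<lambda>m. lim_f (Inr (Inr m))"
  proof
    show "filterlim (\<lambda>n. nverts (G (r n))) at_top sequentially"
      by (rule filterlim_compose[OF size_lim filterlim_subseq[OF r]])
    show "(\<lambda>n. cell_mass (vertices (G (r n))) (\<kappa> (r n) m) c) \<longlonglongrightarrow> lim_f (Inl (m, c))" for m c
      using lim[of "Inl (m, c)"] by (simp add: f_def)
    show "(\<lambda>n. cell_average (vertices (G (r n))) (\<kappa> (r n) m) (edge_indicator (G (r n))) c d)
        \<longlonglongrightarrow> lim_f (Inr (Inl (m, c, d)))" for m c d
      using lim[of "Inr (Inl (m, c, d))"] by (simp add: f_def)
    show "(\<lambda>n. energy (vertices (G (r n))) (\<kappa> (r n) m) (edge_indicator (G (r n)))) \<longlonglongrightarrow> lim_f (Inr (Inr m))" for m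
      using lim[of "Inr (Inr m)"] by (simp add: f_def)
  qed (rule ordered size_pos \<kappa>; assumption)+
  obtain W where W: "unit_kernel uniform_square W" "\<And>u v. W u v = W v u"
    "(\<lambda>m. \<integral>u. (\<integral>v. \<bar>lim_f (Inr (Inl (m, address m u, address m v))) - W u v\<bar> \<partial>uniform_square) \<partial>uniform_square)
      \<longlonglongrightarrow> 0"
    using ex_limit_orderon by blast
  show ?thesis
    using r orderonI[OF W(1,2)] density_tendsto[OF W(1,3)] by blast
qed

text \<open>
  Only finitely many of the graphs can be empty, and they are skipped.
\<close>

theorem ordered_graph_compactness:
  assumes "\<And>n. is_ordered_graph (G n)"
    and size_lim: "filterlim (\<lambda>n. nverts (G n)) at_top sequentially"
  shows "\<exists>W r. strict_mono (r :: nat \<Rightarrow> nat) \<and> orderon W \<and>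
    (\<forall>F. (\<lambda>n. density_graph F (G (r n))) \<longlonglongrightarrow> density_orderon F W)"
proof -
  have "eventually (\<lambda>n. 1 \<le> nverts (G n)) sequentially"
    using size_lim unfolding filterlim_at_top by blast
  then obtain n0 where "\<forall>n\<ge>n0. 1 \<le> nverts (G n)"
    unfolding eventually_sequentially by blast
  then have n0: "0 < nverts (G (n + n0))" for n
    by (metis le_add2 less_le_trans zero_less_one)
  have "filterlim (\<lambda>n. nverts (G (n + n0))) at_top sequentially"
    by (rule filterlim_compose[OF size_lim filterlim_add_const_nat_at_top])
  from ordered_graph_compactness_nonempty[where G="\<lambda>n. G (n + n0)", OF assms(1) n0 this]
  obtain W r where r: "strict_mono (r :: nat \<Rightarrow> nat)" and W: "orderon W"
    and lim: "\<forall>F. (\<lambda>n. density_graph F (G (r n + n0))) \<longlonglongrightarrow> density_orderon F W"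
    by blast
  have "strict_mono (\<lambda>n. r n + n0)"
    using r by (simp add: strict_mono_def)
  then show ?thesis
    using W lim by (intro exI[of _ W] exI[of _ "\<lambda>n. r n + n0"] conjI)
qed

theorem corollary1p3:
  fixes G :: "nat \<Rightarrow> ordered_graph"
  assumes "convergent_ordered_graphs G"
  shows "\<exists>W. orderon W \<and>
           (\<forall>F. simple_ordered_graph F \<longrightarrow>
              (\<lambda>n. density_graph F (G n)) \<longlonglongrightarrow> density_orderon F W)"
proof -
  have G: "\<And>n. is_ordered_graph (G n)" "filterlim (\<lambda>n. nverts (G n)) at_top sequentially"
    and conv: "\<And>F. simple_ordered_graph F \<Longrightarrow> convergent (\<lambda>n. density_graph F (G n))"
    using assms by (auto simp: convergent_ordered_graphs_def)
  obtain W r where r: "strict_mono (r :: nat \<Rightarrow> nat)" and W: "orderon W"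
    and lim: "\<And>F. (\<lambda>n. density_graph F (G (r n))) \<longlonglongrightarrow> density_orderon F W"
    using ordered_graph_compactness[OF G] by blast
  have "(\<lambda>n. density_graph F (G n)) \<longlonglongrightarrow> density_orderon F W" if F: "simple_ordered_graph F" for F
  proof -
    obtain L where L: "(\<lambda>n. density_graph F (G n)) \<longlonglongrightarrow> L"
      using conv[OF F] by (auto simp: convergent_def)
    have "(\<lambda>n. density_graph F (G (r n))) \<longlonglongrightarrow> L"
      using LIMSEQ_subseq_LIMSEQ[OF L r] by (simp add: o_def)
    then have "L = density_orderon F W" using lim by (rule LIMSEQ_unique)
    then show ?thesis using L by simp
  qed
  then show ?thesis using W by blast
qed

end
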